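(* Let $X\subseteq\mathbb{N}\setminus\{0\}$ be a $\Sigma_2$ set, where each $k\in X$ is identified with the finite order-type $\mathbf{k}$. Let $C\subseteq\mathbb{N}$ be a co-c.e. cohesive set. Then there is a computable linear order $\mathcal{M}$ of order-type $\omega$ such that the cohesive power $\Pi_C\mathcal{M}$ has order-type $\omega+\boldsymbol{\sigma}(X\cup\{\alpha\})$, where $\alpha=\omega+\zeta\eta+\omega^*$.
   Context: A set $C\subseteq\mathbb{N}$ is cohesive if it is infinite and for every c.e. set $W$, either $C\setminus W$ or $C\cap W$ is finite; co-c.e. means $\mathbb{N}\setminus C$ is c.e. Write $X\subseteq^* Y$ if $X\setminus Y$ is finite. For a computable linear order $\mathcal{L}=(L,\prec_{\mathcal{L}})$, the cohesive power $\Pi_C\mathcal{L}$ has as elements the classes $[\varphi]$ of partial computable $\varphi\colon\mathbb{N}\to L$ with $C\subseteq^*\mathrm{dom}(\varphi)$ under $\varphi=_C\psi$ iff $C\subseteq^*\{x:\varphi(x)\downarrow=\psi(x)\downarrow\}$, ordered by $[\varphi]\prec[\psi]$ iff $C\subseteq^*\{x:\varphi(x)\downarrow,\psi(x)\downarrow,\varphi(x)\prec_{\mathcal{L}}\psi(x)\}$. $\mathbf{k}$ is the order-type of a $k$-element linear order; $\omega,\zeta,\eta$ are the order-types of $\mathbb{N},\mathbb{Z},\mathbb{Q}$; $\omega^*$ is the reverse of $\omega$; $\zeta\eta$ is $\eta$-many copies of $\zeta$ ordered lexicographically. Shuffle: for a non-empty at most countable set $X$ of order-types, choose a coloring of $\mathbb{Q}$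 with $|X|$ colors each of which is dense in $\mathbb{Q}$, assign distinct colors to members of $X$, and replace each rational by a copy of the order-type assigned to its color; the resulting order-type is $\boldsymbol{\sigma}(X)$. *)

theory Defs
  imports Complex_Main "HOL-Library.Nat_Bijection"
begin

section \<open>Computability\<close>

text \<open>
  The unary partial recursive functions, Kleene's schemes being phrased with the Cantor pairing
  function \<^const>\<open>prod_encode\<close> instead of with functions of several arguments.
  Divergence is \<^const>\<open>None\<close>.
\<close>

inductive partial_computable :: "(nat \<rightharpoonup> nat) \<Rightarrow> bool" where
  zero: "partial_computable (\<lambda>_. Some 0)"
| succ: "partial_computable (\<lambda>n. Some (Suc n))"
| left: "partial_computable (\<lambda>n. Some (fst (prod_decode n)))"
| right: "partial_computable (\<lambda>n. Some (snd (prod_decode n)))"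
| pair: "partial_computable f \<Longrightarrow> partial_computable g \<Longrightarrow>
    partial_computable (\<lambda>n. Option.bind (f n) (\<lambda>a. Option.bind (g n) (\<lambda>b. Some (prod_encode (a, b)))))"
| comp: "partial_computable f \<Longrightarrow> partial_computable g \<Longrightarrow> partial_computable (f \<circ>\<^sub>m g)"
| prim_rec: "partial_computable f \<Longrightarrow> partial_computable g \<Longrightarrow>
    partial_computable (\<lambda>n. case prod_decode n of (a, k) \<Rightarrow>
      rec_nat (f a) (\<lambda>m r. Option.bind r (\<lambda>v. g (prod_encode (a, prod_encode (m, v))))) k)"
| minimize: "partial_computable f \<Longrightarrow>
    partial_computable (\<lambda>a.
      if \<exists>n. f (prod_encode (a, n)) = Some 0 \<and> (\<forall>m<n. \<exists>y. f (prod_encode (a, m)) = Some (Suc y))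
      then Some (LEAST n. f (prod_encode (a, n)) = Some 0) else None)"

definition ce :: "nat set \<Rightarrow> bool" where
  "ce W \<longleftrightarrow> (\<exists>\<phi>. partial_computable \<phi> \<and> W = dom \<phi>)"

definition computable_set :: "nat set \<Rightarrow> bool" where
  "computable_set A \<longleftrightarrow> partial_computable (\<lambda>n. Some (if n \<in> A then 1 else 0))"

definition sigma2 :: "nat set \<Rightarrow> bool" where
  "sigma2 X \<longleftrightarrow> (\<exists>R. computable_set R \<and>
     X = {x. \<exists>u. \<forall>v. prod_encode (x, prod_encode (u, v)) \<in> R})"

definition almost_subset :: "'a set \<Rightarrow> 'a set \<Rightarrow> bool" (infix \<open>\<subseteq>\<^sup>*\<close> 50) where
  "X \<subseteq>\<^sup>* Y \<longleftrightarrow> finite (X - Y)"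

definition cohesive :: "nat set \<Rightarrow> bool" where
  "cohesive C \<longleftrightarrow> infinite C \<and> (\<forall>W. ce W \<longrightarrow> finite (C - W) \<or> finite (C \<inter> W))"


section \<open>Linear orders and order-types\<close>

text \<open>
  A linear order is a carrier together with a strict order relation.  A carrier is needed because
  the strict relation of a one-element order is empty.  Order-types are represented
  by linear orders; having the same order-type is \<open>\<cong>\<close>.
\<close>

type_synonym 'a lorder = "'a set \<times> 'a rel"

definition lin_order :: "'a lorder \<Rightarrow> bool" where
  "lin_order M \<longleftrightarrow> snd M \<subseteq> fst M \<times> fst M \<and> strict_linear_order_on (fst M) (snd M)"

definition same_order_type :: "'a lorder \<Rightarrow> 'b lorder \<Rightarrow> bool" (infix \<open>\<cong>\<close> 50) where
  "M \<cong> N \<longleftrightarrow> (\<exists>f. bij_betw f (fst M) (fst N) \<and>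
     (\<forall>x\<in>fst M. \<forall>y\<in>fst M. (x, y) \<in> snd M \<longleftrightarrow> (f x, f y) \<in> snd N))"

definition computable_lin_order :: "nat lorder \<Rightarrow> bool" where
  "computable_lin_order M \<longleftrightarrow>
     lin_order M \<and> computable_set (fst M) \<and> computable_set (prod_encode ` snd M)"

definition finite_type :: "nat \<Rightarrow> nat lorder" where
  "finite_type k = ({..<k}, {(m, n). m < n \<and> n < k})"

definition omega :: "nat lorder" where
  "omega = (UNIV, {(m, n). m < n})"

definition zeta :: "int lorder" where
  "zeta = (UNIV, {(m, n). m < n})"

definition eta :: "rat lorder" where
  "eta = (UNIV, {(p, q). p < q})"

definition reverse :: "'a lorder \<Rightarrow> 'a lorder" where
  "reverse M = (fst M, (snd M)\<inverse>)"

definition order_sum :: "'a lorder \<Rightarrow> 'b lorder \<Rightarrow> ('a + 'b) lorder" (infixl \<open>\<oplus>\<close> 65) where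
  "M \<oplus> N = (fst M <+> fst N,
     {(Inl x, Inl y) | x y. (x, y) \<in> snd M} \<union>
     {(Inr x, Inr y) | x y. (x, y) \<in> snd N} \<union>
     {(Inl x, Inr y) | x y. x \<in> fst M \<and> y \<in> fst N})"

text \<open>Replace each \<open>i\<close> in the order \<open>I\<close> by a copy of \<open>A i\<close>.\<close>

definition lex_sum :: "'i lorder \<Rightarrow> ('i \<Rightarrow> 'a lorder) \<Rightarrow> ('i \<times> 'a) lorder" where
  "lex_sum I A = (SIGMA i:fst I. fst (A i),
     {((i, x), (j, y)) | i x j y. i \<in> fst I \<and> j \<in> fst I \<and> x \<in> fst (A i) \<and> y \<in> fst (A j) \<and>
        ((i, j) \<in> snd I \<or> i = j \<and> (x, y) \<in> snd (A i))})"

definition copy :: "('a \<Rightarrow> 'b) \<Rightarrow> 'a lorder \<Rightarrow> 'b lorder" where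
  "copy f M = (f ` fst M, map_prod f f ` snd M)"


section \<open>Shuffles\<close>

text \<open>
  The members of \<open>\<X>\<close> serve as the colors.  So \<open>\<X>\<close> must be non-empty, at most countable, and
  consist of pairwise non-isomorphic linear orders.
\<close>

definition dense_coloring :: "'a lorder set \<Rightarrow> (rat \<Rightarrow> 'a lorder) \<Rightarrow> bool" where
  "dense_coloring \<X> c \<longleftrightarrow>
     range c \<subseteq> \<X> \<and> (\<forall>S\<in>\<X>. \<forall>p q. p < q \<longrightarrow> (\<exists>r. p < r \<and> r < q \<and> c r = S))"

text \<open>The order-type does not depend on the chosen coloring.\<close>

definition shuffle :: "'a lorder set \<Rightarrow> (rat \<times> 'a) lorder" where
  "shuffle \<X> = lex_sum eta (SOME c. dense_coloring \<X> c)"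

definition alpha :: "(nat + (rat \<times> int) + nat) lorder" where
  "alpha = omega \<oplus> (lex_sum eta (\<lambda>_. zeta) \<oplus> reverse omega)"

text \<open>The set \<open>X \<union> {\<alpha>}\<close> of order-types, copied into one type by the injections \<open>Inl\<close> and \<open>Inr\<close>.\<close>

definition finite_types_and_alpha :: "nat set \<Rightarrow> (nat + (nat + (rat \<times> int) + nat)) lorder set" where
  "finite_types_and_alpha X = (\<lambda>k. copy Inl (finite_type k)) ` X \<union> {copy Inr alpha}"


section \<open>Cohesive powers\<close>

definition cohesive_power_dom :: "nat set \<Rightarrow> nat lorder \<Rightarrow> (nat \<rightharpoonup> nat) set" where
  "cohesive_power_dom C M = {\<phi>. partial_computable \<phi> \<and> ran \<phi> \<subseteq> fst M \<and> C \<subseteq>\<^sup>* dom \<phi>}"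

definition cohesive_eq :: "nat set \<Rightarrow> nat lorder \<Rightarrow> (nat \<rightharpoonup> nat) rel" where
  "cohesive_eq C M = {(\<phi>, \<psi>). \<phi> \<in> cohesive_power_dom C M \<and> \<psi> \<in> cohesive_power_dom C M \<and>
     C \<subseteq>\<^sup>* {x. \<exists>a. \<phi> x = Some a \<and> \<psi> x = Some a}}"

definition cohesive_power :: "nat set \<Rightarrow> nat lorder \<Rightarrow> (nat \<rightharpoonup> nat) set lorder" where
  "cohesive_power C M = (cohesive_power_dom C M // cohesive_eq C M,
     {(cohesive_eq C M `` {\<phi>}, cohesive_eq C M `` {\<psi>}) | \<phi> \<psi>.
        \<phi> \<in> cohesive_power_dom C M \<and> \<psi> \<in> cohesive_power_dom C M \<and>
        C \<subseteq>\<^sup>* {x. \<exists>a b. \<phi> x = Some a \<and> \<psi> x = Some b \<and> (a, b) \<in> snd M}})"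

end

theory Submission
  imports Defs "HOL-Library.Countable_Set"
begin

text \<open>
  Elements of the cohesive power are germs along \<open>C\<close> of total computable functions.  The order
  places finite blocks at dyadic rationals, inserting new ones at every stage \<open>t\<close> at which a number
  \<open>m\<close> enters \<open>- C\<close>, but only above level \<open>r\<close>, the number of elements below \<open>m\<close> that
  are still in \<open>C\<close> at stage \<open>t\<close>.  Only finitely many stages act below a given level, whence
  order-type \<open>\<omega>\<close>.  A computable \<open>g\<close> that is unbounded on \<open>C\<close> is, by cohesiveness, increasing on
  almost all of \<open>C\<close>, hence eventually dominates the rank in \<open>C\<close>.  So arbitrarily late (in
  the sense of any computable function \<open>f\<close>) there is a stage acting above level \<open>g n\<close>: otherwise
  the rank of \<open>n\<close> in \<open>C\<close> would be computable on \<open>C\<close>, and its parity would split \<open>C\<close>.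
  Therefore blocks of every color appear between any two nonstandard blocks.  A block
  of color \<open>(x, u)\<close> has \<open>x\<close> elements unless \<open>u\<close> is refuted as a witness of \<open>x \<in> X\<close>, in which case
  it is made larger than its level.  By cohesiveness a nonstandard block then has either
  a constant size in \<open>X\<close> or a nonstandard size, and in the latter case order-type \<open>\<alpha>\<close>.
\<close>

section \<open>Computable functions\<close>

text \<open>Two demands conflict. For order-type \<omega> the insertions below each fixed level must
  stop, whereas density among the nonstandard blocks asks for insertions later than any computable
  bound in terms of the level. The stopping is therefore tied to the enumeration of
  \<open>- C\<close>, whose settling is not computable along \<open>C\<close>. The germs of
  computable functions behave like a nonstandard model of arithmetic, the dichotomy of c.e.
  predicates on \<open>C\<close> taking the place of elementarity. A block of nonstandard size has
  order-type \<alpha> for the same reason as a nonstandard initial segment there. This also explains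
  how a \<Sigma>_2 set can be handled. A universal condition on \<open>v\<close> can be refuted but
  never confirmed in finite time, so a wrong guess has already placed its \<open>x\<close> elements
  when it is refuted. They cannot be withdrawn, but the block can still be enlarged, and a block of
  nonstandard size is harmless because \<alpha> is shuffled in anyway.\<close>

abbreviation nfst :: "nat \<Rightarrow> nat" where "nfst n \<equiv> fst (prod_decode n)"
abbreviation nsnd :: "nat \<Rightarrow> nat" where "nsnd n \<equiv> snd (prod_decode n)"

definition computable :: "(nat \<Rightarrow> nat) \<Rightarrow> bool" where
  "computable f \<longleftrightarrow> partial_computable (\<lambda>n. Some (f n))"

definition decidable :: "(nat \<Rightarrow> bool) \<Rightarrow> bool" where
  "decidable P \<longleftrightarrow> computable (\<lambda>n. if P n then 1 else 0)"

section \<open>Closure of the computable functions under arithmetic and case distinction\<close>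

lemma computable_comp: "computable f \<Longrightarrow> computable g \<Longrightarrow> computable (\<lambda>n. f (g n))"
  unfolding computable_def using partial_computable.comp[of "\<lambda>n. Some (f n)" "\<lambda>n. Some (g n)"]
  by (simp add: map_comp_def)

lemma computable_pair:
  "computable f \<Longrightarrow> computable g \<Longrightarrow> computable (\<lambda>n. prod_encode (f n, g n))"
  unfolding computable_def using partial_computable.pair[of "\<lambda>n. Some (f n)" "\<lambda>n. Some (g n)"]
  by simp

lemma computable_nfst: "computable f \<Longrightarrow> computable (\<lambda>n. nfst (f n))"
  by (rule computable_comp[where f = nfst]) (simp_all add: computable_def partial_computable.left)

lemma computable_nsnd: "computable f \<Longrightarrow> computable (\<lambda>n. nsnd (f n))"
  by (rule computable_comp[where f = nsnd]) (simp_all add: computable_def partial_computable.right)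

lemma computable_Suc: "computable f \<Longrightarrow> computable (\<lambda>n. Suc (f n))"
  by (rule computable_comp[where f = Suc]) (simp_all add: computable_def partial_computable.succ)

lemma computable_id: "computable (\<lambda>n. n)"
  using computable_pair[of nfst nsnd]
  by (simp add: computable_def partial_computable.left partial_computable.right)

lemma computable_const: "computable (\<lambda>_. k)"
proof (induction k)
  case 0
  show ?case by (simp add: computable_def partial_computable.zero)
qed (rule computable_Suc)

text \<open>The whole argument \<open>n\<close> is carried along as the parameter of the recursion,
  so the start, the step and the number of iterations may all depend on it.\<close>

lemma computable_rec:
  assumes "computable f"
    and "computable (\<lambda>p. g (nfst p) (nfst (nsnd p)) (nsnd (nsnd p)))"
    and "computable k"
  shows "computable (\<lambda>n. rec_nat (f n) (g n) (k n))"
proof -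
  have rec: "rec_nat (Some a) (\<lambda>m r. Option.bind r (\<lambda>v. Some (h m v))) j = Some (rec_nat a h j)"
    for a j :: nat and h
    by (induction j) auto
  have "computable (\<lambda>n. rec_nat (f (nfst n)) (g (nfst n)) (nsnd n))"
    using partial_computable.prim_rec[OF assms(1,2)[unfolded computable_def]]
    by (simp add: computable_def rec case_prod_beta)
  from computable_comp[OF this computable_pair[OF computable_id assms(3)]]
  show ?thesis by simp
qed

lemma computable_add:
  assumes "computable f" "computable g" shows "computable (\<lambda>n. f n + g n)"
proof -
  have eq: "rec_nat a (\<lambda>_. Suc) b = a + b" for a b :: nat by (induction b) auto
  have "computable (\<lambda>n. rec_nat (f n) (\<lambda>_. Suc) (g n))"
    by (intro computable_rec assms computable_Suc computable_nsnd computable_id)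
  then show ?thesis by (simp add: eq)
qed

lemma computable_diff:
  assumes "computable f" "computable g" shows "computable (\<lambda>n. f n - g n)"
proof -
  have "rec_nat 0 (\<lambda>m _. m) a = a - 1" for a :: nat by (cases a) auto
  then have pred: "computable (\<lambda>n. h n - 1)" if "computable h" for h
    using computable_rec[OF computable_const[of 0] _ that, of "\<lambda>_ m _. m"]
    by (simp add: computable_nfst computable_nsnd computable_id)
  have eq: "rec_nat a (\<lambda>_ v. v - 1) b = a - b" for a b :: nat by (induction b) auto
  have "computable (\<lambda>n. rec_nat (f n) (\<lambda>_ v. v - 1) (g n))"
    by (intro computable_rec assms pred computable_nsnd computable_id)
  then show ?thesis by (simp only: eq)
qed

lemma computable_mult:
  assumes "computable f" "computable g" shows "computable (\<lambda>n. f n * g n)"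
proof -
  have eq: "rec_nat 0 (\<lambda>_ v. v + a) b = a * b" for a b :: nat by (induction b) auto
  have "computable (\<lambda>n. rec_nat 0 (\<lambda>_ v. v + f n) (g n))"
    by (intro computable_rec assms computable_const computable_add computable_nfst
        computable_nsnd computable_id computable_comp[OF assms(1)])
  then show ?thesis by (simp add: eq)
qed

lemma computable_power:
  assumes "computable f" "computable g" shows "computable (\<lambda>n. f n ^ g n)"
proof -
  have eq: "rec_nat 1 (\<lambda>_ v. a * v) b = a ^ b" for a b :: nat by (induction b) auto
  have "computable (\<lambda>n. rec_nat 1 (\<lambda>_ v. f n * v) (g n))"
    by (intro computable_rec assms computable_const computable_mult computable_nfst
        computable_nsnd computable_id computable_comp[OF assms(1)])
  then show ?thesis by (simp only: eq)
qed

lemma computable_sum: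
  assumes "computable (\<lambda>p. f (nfst p) (nsnd p))" "computable b"
  shows "computable (\<lambda>n. \<Sum>i<b n. f n i)"
proof -
  have eq: "rec_nat 0 (\<lambda>i v. v + f n i) k = (\<Sum>i<k. f n i)" for n k by (induction k) auto
  have "computable (\<lambda>p. f (nfst p) (nfst (nsnd p)))"
    using computable_comp[OF assms(1), of "\<lambda>p. prod_encode (nfst p, nfst (nsnd p))"]
    by (simp add: computable_pair computable_nfst computable_nsnd computable_id)
  then have "computable (\<lambda>n. rec_nat 0 (\<lambda>i v. v + f n i) (b n))"
    by (intro computable_rec assms computable_const computable_add computable_nsnd computable_id)
  then show ?thesis by (simp add: eq)
qed

lemma computable_if:
  assumes "decidable P" "computable f" "computable g"
  shows "computable (\<lambda>n. if P n then f n else g n)"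
proof -
  have "(if P n then f n else g n) =
      (if P n then 1 else 0) * f n + (1 - (if P n then 1 else 0)) * g n" for n
    by simp
  then show ?thesis
    using assms by (simp only: decidable_def) (intro computable_add computable_mult
        computable_diff computable_const)
qed

section \<open>Decidable predicates and bounded quantifiers\<close>

lemma decidable_comp: "decidable P \<Longrightarrow> computable f \<Longrightarrow> decidable (\<lambda>n. P (f n))"
  unfolding decidable_def by (rule computable_comp)

lemma decidable_not:
  assumes "decidable P" shows "decidable (\<lambda>n. \<not> P n)"
proof -
  have "(if \<not> P n then 1 else 0) = (if P n then 0 else (1::nat))" for n by simp
  then show ?thesis unfolding decidable_def
    by (simp only:) (intro computable_if assms computable_const)
qed

lemma decidable_conj:
  assumes "decidable P" "decidable Q" shows "decidable (\<lambda>n. P n \<and> Q n)"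
proof -
  have "(if P n \<and> Q n then 1 else 0) = (if P n then 1 else 0) * (if Q n then 1 else (0::nat))" for n
    by simp
  then show ?thesis using assms unfolding decidable_def by (simp only:) (rule computable_mult)
qed

lemma decidable_disj:
  assumes "decidable P" "decidable Q" shows "decidable (\<lambda>n. P n \<or> Q n)"
  using decidable_not[OF decidable_conj[OF assms[THEN decidable_not]]] by simp

lemma decidable_imp:
  assumes "decidable P" "decidable Q" shows "decidable (\<lambda>n. P n \<longrightarrow> Q n)"
  using decidable_disj[OF decidable_not[OF assms(1)] assms(2)] by simp

lemma decidable_nonzero:
  assumes "computable f" shows "decidable (\<lambda>n. f n \<noteq> 0)"
proof -
  have "(if f n \<noteq> 0 then 1 else 0) = 1 - (1 - f n)" for n by simp
  then show ?thesis using assms unfolding decidable_def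
    by (simp only:) (intro computable_diff computable_const)
qed

lemma decidable_less:
  assumes "computable f" "computable g" shows "decidable (\<lambda>n. f n < g n)"
  using decidable_nonzero[OF computable_diff[OF assms(2,1)]] by (simp add: not_le)

lemma decidable_le:
  assumes "computable f" "computable g" shows "decidable (\<lambda>n. f n \<le> g n)"
  using decidable_not[OF decidable_less[OF assms(2,1)]] by (simp add: not_less)

lemma decidable_eq:
  assumes "computable f" "computable g" shows "decidable (\<lambda>n. f n = g n)"
proof -
  have "f n = g n \<longleftrightarrow> f n \<le> g n \<and> g n \<le> f n" for n by auto
  then show ?thesis by (simp only:) (intro decidable_conj decidable_le assms)
qed

lemma decidable_ex_less:
  assumes "decidable (\<lambda>p. P (nfst p) (nsnd p))" "computable b"
  shows "decidable (\<lambda>n. \<exists>i<b n. P n i)"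
proof -
  have "(\<exists>i<b n. P n i) \<longleftrightarrow> (\<Sum>i<b n. if P n i then 1 else 0) \<noteq> (0::nat)" for n by auto
  then show ?thesis
    by (simp only:) (intro decidable_nonzero computable_sum assms(2) assms(1)[unfolded decidable_def])
qed

lemma decidable_ex_le:
  assumes "decidable (\<lambda>p. P (nfst p) (nsnd p))" "computable b"
  shows "decidable (\<lambda>n. \<exists>i\<le>b n. P n i)"
  using decidable_ex_less[OF assms(1) computable_Suc[OF assms(2)]] by (simp add: less_Suc_eq_le)

lemma decidable_all_less:
  assumes "decidable (\<lambda>p. P (nfst p) (nsnd p))" "computable b"
  shows "decidable (\<lambda>n. \<forall>i<b n. P n i)"
  using decidable_not[OF decidable_ex_less[OF decidable_not[OF assms(1)] assms(2)]] by simp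

lemma computable_card_less:
  assumes "decidable (\<lambda>p. P (nfst p) (nsnd p))" "computable b"
  shows "computable (\<lambda>n. card {i. i < b n \<and> P n i})"
proof -
  have "card {i. i < b n \<and> P n i} = (\<Sum>i<b n. if P n i then 1 else 0)" for n
    by (simp add: sum.If_cases lessThan_def Collect_conj_eq)
  then show ?thesis
    by (simp only:) (intro computable_sum assms(2) assms(1)[unfolded decidable_def])
qed

lemma partial_computable_search:
  assumes "decidable (\<lambda>p. P (nfst p) (nsnd p))"
  shows "partial_computable (\<lambda>n. if \<exists>i. P n i then Some (LEAST i. P n i) else None)"
proof -
  \<comment> \<open>Minimization stops at the value 0, so the characteristic function of the
    negation is used. Being total, it also meets the demand for positive values before the first
    zero.\<close>
  let ?f = "\<lambda>p. if \<not> P (nfst p) (nsnd p) then 1 else (0::nat)"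
  have "partial_computable (\<lambda>p. Some (?f p))"
    using decidable_not[OF assms] unfolding decidable_def computable_def .
  note partial_computable.minimize[OF this]
  moreover have "(\<exists>n. Some (?f (prod_encode (a, n))) = Some 0 \<and>
      (\<forall>m<n. \<exists>y. Some (?f (prod_encode (a, m))) = Some (Suc y))) \<longleftrightarrow> (\<exists>n. P a n)" for a
  proof -
    have "(\<exists>n. P a n) \<longleftrightarrow> (\<exists>n. P a n \<and> (\<forall>m<n. \<not> P a m))"
      using exists_least_iff[of "P a"] .
    then show ?thesis by auto
  qed
  moreover have "(LEAST n. Some (?f (prod_encode (a, n))) = Some 0) = (LEAST n. P a n)" for a
    by (rule arg_cong[where f = Least]) auto
  ultimately show ?thesis by (simp only:)
qed

lemma computable_LEAST:
  assumes "decidable (\<lambda>p. P (nfst p) (nsnd p))" "\<And>n. \<exists>i. P n i"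
  shows "computable (\<lambda>n. LEAST i. P n i)"
  using partial_computable_search[OF assms(1)] assms(2) by (simp add: computable_def)

lemma ce_ex:
  assumes "decidable (\<lambda>p. P (nfst p) (nsnd p))"
  shows "ce {n. \<exists>i. P n i}"
  unfolding ce_def
  by (rule exI, rule conjI, rule partial_computable_search[OF assms]) (auto split: if_splits)

lemma computable_div:
  assumes "computable f" "computable g" shows "computable (\<lambda>n. f n div g n)"
proof -
  \<comment> \<open>The disjunct \<open>b = 0\<close> lets the search stop at 0 for a zero divisor,
    in accordance with \<open>a div 0 = 0\<close>.\<close>
  have eq: "(LEAST q. a < Suc q * b \<or> b = 0) = a div b" for a b :: nat
  proof (cases "b = 0")
    case False
    show ?thesis
    proof (rule Least_equality)
      show "a < Suc (a div b) * b \<or> b = 0"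
        using False by (metis dividend_less_div_times mult_Suc neq0_conv)
      show "a div b \<le> q" if "a < Suc q * b \<or> b = 0" for q
        using that False by (metis less_Suc_eq_le less_mult_imp_div_less)
    qed
  qed simp
  have "computable (\<lambda>n. LEAST q. f n < Suc q * g n \<or> g n = 0)"
  proof (intro computable_LEAST decidable_disj decidable_less decidable_eq computable_mult
      computable_Suc computable_const computable_nsnd computable_id
      computable_comp[OF assms(1)] computable_comp[OF assms(2)] computable_nfst)
    show "\<exists>q. f n < Suc q * g n \<or> g n = 0" for n
      by (rule exI[of _ "f n"]) (cases "g n", auto)
  qed
  then show ?thesis by (simp only: eq)
qed

lemma computable_mod:
  assumes "computable f" "computable g" shows "computable (\<lambda>n. f n mod g n)"
  using computable_diff[OF assms(1) computable_mult[OF computable_div[OF assms] assms(2)]]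
  by (simp add: minus_div_mult_eq_mod)

lemmas computable_intros =
  computable_id computable_const computable_Suc computable_nfst computable_nsnd computable_pair
  computable_add computable_diff computable_mult computable_power computable_div computable_mod
  computable_sum computable_card_less computable_if
  decidable_not decidable_conj decidable_disj decidable_imp decidable_less decidable_le
  decidable_eq decidable_ex_less decidable_ex_le decidable_all_less

text \<open>Lets finitely many exceptions be built into an algorithm, which is how
  \<open>\<subseteq>\<^sup>*\<close> is dealt with later.\<close>

lemma decidable_mem_finite: "finite E \<Longrightarrow> decidable (\<lambda>n. n \<in> E)"
proof (induction E rule: finite_induct)
  case empty
  show ?case by (simp add: decidable_def computable_const)
next
  case (insert x E)
  then show ?case using decidable_disj[OF decidable_eq[OF computable_id computable_const]] by simp
qed

subsection \<open>Stage approximations\<close>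

text \<open>\<open>G n s\<close> is 0 while the computation of \<open>\<phi> n\<close> is still
  running at stage \<open>s\<close>, and \<open>Suc v\<close> once it has returned \<open>v\<close>.
  Built by induction over the schemes, such approximations do the work of a universal machine with a
  step counter.\<close>

definition stage_approx :: "(nat \<rightharpoonup> nat) \<Rightarrow> (nat \<Rightarrow> nat \<Rightarrow> nat) \<Rightarrow> bool" where
  "stage_approx \<phi> G \<longleftrightarrow> computable (\<lambda>p. G (nfst p) (nsnd p)) \<and>
     (\<forall>n s t. s \<le> t \<longrightarrow> G n s \<noteq> 0 \<longrightarrow> G n t = G n s) \<and>
     (\<forall>n v. \<phi> n = Some v \<longleftrightarrow> (\<exists>s. G n s = Suc v))"

lemma stage_approx_computable:
  assumes "stage_approx \<phi> G" "computable f" "computable g"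
  shows "computable (\<lambda>n. G (f n) (g n))"
  using computable_comp[of "\<lambda>p. G (nfst p) (nsnd p)" "\<lambda>n. prod_encode (f n, g n)"] assms
  by (simp add: stage_approx_def computable_pair)

lemma stage_approx_mono: "stage_approx \<phi> G \<Longrightarrow> G n s = Suc v \<Longrightarrow> s \<le> t \<Longrightarrow> G n t = Suc v"
  unfolding stage_approx_def by (metis nat.simps(3))

lemma stage_approx_Some: "stage_approx \<phi> G \<Longrightarrow> \<phi> n = Some v \<longleftrightarrow> (\<exists>s. G n s = Suc v)"
  unfolding stage_approx_def by blast

lemma stage_approx_SomeI: "stage_approx \<phi> G \<Longrightarrow> G n s = Suc v \<Longrightarrow> \<phi> n = Some v"
  using stage_approx_Some by blast

lemma stage_approxI:
  assumes "computable (\<lambda>p. G (nfst p) (nsnd p))"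
    and "\<And>n s t v. s \<le> t \<Longrightarrow> G n s = Suc v \<Longrightarrow> G n t = Suc v"
    and "\<And>n s v. G n s = Suc v \<Longrightarrow> \<phi> n = Some v"
    and "\<And>n v. \<phi> n = Some v \<Longrightarrow> \<exists>s. G n s = Suc v"
  shows "stage_approx \<phi> G"
  unfolding stage_approx_def using assms by (metis not0_implies_Suc)

lemma stage_approx_total: "computable f \<Longrightarrow> stage_approx (\<lambda>n. Some (f n)) (\<lambda>n _. Suc (f n))"
  by (rule stage_approxI)
    (use computable_Suc[OF computable_comp[of f nfst]] computable_nfst[OF computable_id] in auto)

lemma stage_approx_pair:
  assumes "stage_approx f F" "stage_approx g G"
  shows "\<exists>H. stage_approx (\<lambda>n. Option.bind (f n) (\<lambda>a. Option.bind (g n) (\<lambda>b. Some (prod_encode (a, b))))) H"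
proof
  let ?H = "\<lambda>n s. if F n s = 0 \<or> G n s = 0 then 0 else Suc (prod_encode (F n s - 1, G n s - 1))"
  show "stage_approx (\<lambda>n. Option.bind (f n) (\<lambda>a. Option.bind (g n) (\<lambda>b. Some (prod_encode (a, b))))) ?H"
  proof (rule stage_approxI)
    show "computable (\<lambda>p. ?H (nfst p) (nsnd p))"
      by (intro computable_intros stage_approx_computable[OF assms(1)]
          stage_approx_computable[OF assms(2)])
  next
    fix n s t v assume "s \<le> t" "?H n s = Suc v"
    then show "?H n t = Suc v"
      using stage_approx_mono[OF assms(1) _ \<open>s \<le> t\<close>, of n] stage_approx_mono[OF assms(2) _ \<open>s \<le> t\<close>, of n]
      by (cases "F n s"; cases "G n s") auto
  next
    fix n s v assume "?H n s = Suc v"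
    then obtain a b where "F n s = Suc a" "G n s = Suc b" "v = prod_encode (a, b)"
      by (cases "F n s"; cases "G n s") auto
    then have "f n = Some a" "g n = Some b"
      using stage_approx_Some[OF assms(1)] stage_approx_Some[OF assms(2)] by blast+
    then show "Option.bind (f n) (\<lambda>a. Option.bind (g n) (\<lambda>b. Some (prod_encode (a, b)))) = Some v"
      using \<open>v = _\<close> by simp
  next
    fix n v assume "Option.bind (f n) (\<lambda>a. Option.bind (g n) (\<lambda>b. Some (prod_encode (a, b)))) = Some v"
    then obtain a b where ab: "f n = Some a" "g n = Some b" "v = prod_encode (a, b)"
      by (auto simp: bind_eq_Some_conv)
    then obtain s t where st: "F n s = Suc a" "G n t = Suc b"
      using stage_approx_Some[OF assms(1)] stage_approx_Some[OF assms(2)] by blast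
    have "F n (max s t) = Suc a" "G n (max s t) = Suc b"
      by (rule stage_approx_mono[OF assms(1) st(1) max.cobounded1]
          stage_approx_mono[OF assms(2) st(2) max.cobounded2])+
    then show "\<exists>s. ?H n s = Suc v" using ab by (intro exI[of _ "max s t"]) simp
  qed
qed

lemma stage_approx_comp:
  assumes "stage_approx f F" "stage_approx g G"
  shows "\<exists>H. stage_approx (f \<circ>\<^sub>m g) H"
proof
  let ?H = "\<lambda>n s. if G n s = 0 then 0 else F (G n s - 1) s"
  show "stage_approx (f \<circ>\<^sub>m g) ?H"
  proof (rule stage_approxI)
    show "computable (\<lambda>p. ?H (nfst p) (nsnd p))"
      by (intro computable_intros stage_approx_computable[OF assms(1)]
          stage_approx_computable[OF assms(2)])
  next
    fix n s t v assume "s \<le> t" "?H n s = Suc v"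
    then show "?H n t = Suc v"
      using stage_approx_mono[OF assms(1) _ \<open>s \<le> t\<close>] stage_approx_mono[OF assms(2) _ \<open>s \<le> t\<close>, of n]
      by (cases "G n s") auto
  next
    fix n s v assume "?H n s = Suc v"
    then obtain a where "G n s = Suc a" "F a s = Suc v"
      by (cases "G n s") auto
    then have "g n = Some a" "f a = Some v"
      using stage_approx_Some[OF assms(1)] stage_approx_Some[OF assms(2)] by blast+
    then show "(f \<circ>\<^sub>m g) n = Some v" by simp
  next
    fix n v assume "(f \<circ>\<^sub>m g) n = Some v"
    then obtain a where ab: "g n = Some a" "f a = Some v"
      by (auto simp: map_comp_Some_iff)
    then obtain s t where st: "G n s = Suc a" "F a t = Suc v"
      using stage_approx_Some[OF assms(1)] stage_approx_Some[OF assms(2)] by blast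
    have "G n (max s t) = Suc a" "F a (max s t) = Suc v"
      by (rule stage_approx_mono[OF assms(2) st(1) max.cobounded1]
          stage_approx_mono[OF assms(1) st(2) max.cobounded2])+
    then show "\<exists>s. ?H n s = Suc v" by (intro exI[of _ "max s t"]) simp
  qed
qed

lemma stage_approx_prim_rec:
  assumes F: "stage_approx f F" and G: "stage_approx g G"
  shows "\<exists>H. stage_approx (\<lambda>n. case prod_decode n of (a, k) \<Rightarrow>
      rec_nat (f a) (\<lambda>m r. Option.bind r (\<lambda>v. g (prod_encode (a, prod_encode (m, v))))) k) H"
    (is "\<exists>H. stage_approx ?\<phi> H")
proof
  define R where "R a k = rec_nat (f a) (\<lambda>m r. Option.bind r (\<lambda>v. g (prod_encode (a, prod_encode (m, v))))) k"
    for a k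
  \<comment> \<open>All calls inside the recursion share the stage \<open>s\<close>. A halting run
    makes finitely many calls, and by monotonicity the maximum of their stages serves for all of
    them.\<close>
  define H where "H a s k = rec_nat (F a s)
      (\<lambda>m r. if r = 0 then 0 else G (prod_encode (a, prod_encode (m, r - 1))) s) k" for a s k
  have R: "?\<phi> n = R (nfst n) (nsnd n)" for n by (simp add: R_def case_prod_beta)
  have mono: "H a t k = Suc v" if "H a s k = Suc v" "s \<le> t" for a s t k v
    using that
  proof (induction k arbitrary: v)
    case 0
    then show ?case using stage_approx_mono[OF F _ \<open>s \<le> t\<close>] by (simp add: H_def)
  next
    case (Suc k)
    then obtain w where w: "H a s k = Suc w" "G (prod_encode (a, prod_encode (k, w))) s = Suc v"
      by (cases "H a s k") (auto simp: H_def)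
    then have "H a t k = Suc w" "G (prod_encode (a, prod_encode (k, w))) t = Suc v"
      using Suc stage_approx_mono[OF G _ \<open>s \<le> t\<close>] by blast+
    then show ?case by (simp add: H_def)
  qed
  show "stage_approx ?\<phi> (\<lambda>n s. H (nfst n) s (nsnd n))"
  proof (rule stage_approxI)
    show "computable (\<lambda>p. H (nfst (nfst p)) (nsnd p) (nsnd (nfst p)))"
      unfolding H_def
      by (intro computable_rec computable_intros stage_approx_computable[OF F]
          stage_approx_computable[OF G])
  next
    fix n s t v assume "s \<le> t" "H (nfst n) s (nsnd n) = Suc v"
    then show "H (nfst n) t (nsnd n) = Suc v" using mono by blast
  next
    fix n s v assume "H (nfst n) s (nsnd n) = Suc v"
    moreover have "H a s k = Suc v \<Longrightarrow> R a k = Some v" for a k v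
    proof (induction k arbitrary: v)
      case 0
      then show ?case using stage_approx_Some[OF F] by (auto simp: H_def R_def)
    next
      case (Suc k)
      then obtain w where w: "H a s k = Suc w" "G (prod_encode (a, prod_encode (k, w))) s = Suc v"
        by (cases "H a s k") (auto simp: H_def)
      then have "R a k = Some w" "g (prod_encode (a, prod_encode (k, w))) = Some v"
        using Suc stage_approx_Some[OF G] by blast+
      then show ?case by (simp add: R_def)
    qed
    ultimately show "?\<phi> n = Some v" by (simp only: R)
  next
    fix n v assume "?\<phi> n = Some v"
    moreover have "R a k = Some v \<Longrightarrow> \<exists>s. H a s k = Suc v" for a k v
    proof (induction k arbitrary: v)
      case 0
      then show ?case using stage_approx_Some[OF F] by (auto simp: H_def R_def)
    next
      case (Suc k)
      then obtain w where w: "R a k = Some w" "g (prod_encode (a, prod_encode (k, w))) = Some v"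
        by (auto simp: R_def bind_eq_Some_conv)
      then obtain s t where st: "H a s k = Suc w" "G (prod_encode (a, prod_encode (k, w))) t = Suc v"
        using Suc stage_approx_Some[OF G] by blast
      have "H a (max s t) k = Suc w" "G (prod_encode (a, prod_encode (k, w))) (max s t) = Suc v"
        by (rule mono[OF st(1) max.cobounded1] stage_approx_mono[OF G st(2) max.cobounded2])+
      then show ?case by (intro exI[of _ "max s t"]) (simp add: H_def)
    qed
    ultimately show "\<exists>s. H (nfst n) s (nsnd n) = Suc v" by (simp only: R)
  qed
qed

lemma stage_approx_minimize:
  assumes F: "stage_approx f F"
  shows "\<exists>H. stage_approx (\<lambda>a.
      if \<exists>n. f (prod_encode (a, n)) = Some 0 \<and> (\<forall>m<n. \<exists>y. f (prod_encode (a, m)) = Some (Suc y))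
      then Some (LEAST n. f (prod_encode (a, n)) = Some 0) else None) H"
    (is "\<exists>H. stage_approx ?\<phi> H")
proof
  define Q where "Q a n \<longleftrightarrow> f (prod_encode (a, n)) = Some 0 \<and>
      (\<forall>m<n. \<exists>y. f (prod_encode (a, m)) = Some (Suc y))" for a n
  \<comment> \<open>In the encoding of \<open>F\<close>, 1 stands for the value 0 and 2 or more for
    a positive value; so \<open>P\<close> says that \<open>n\<close> is recognized as the result by
    stage \<open>s\<close>.\<close>
  define P where "P a s n \<longleftrightarrow> F (prod_encode (a, n)) s = 1 \<and> (\<forall>m<n. 2 \<le> F (prod_encode (a, m)) s)"
    for a s n
  \<comment> \<open>\<open>P\<close> determines \<open>n\<close>, so at most one summand is nonzero;
    the bound \<open>i < s\<close> keeps the search finite.\<close>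
  define H where "H a s = (\<Sum>i<s. if P a s i then Suc i else 0)" for a s
  have Least: "(LEAST n. f (prod_encode (a, n)) = Some 0) = n" if "Q a n" for a n
  proof (rule Least_equality)
    show "f (prod_encode (a, n)) = Some 0" using that by (simp add: Q_def)
    show "n \<le> m" if "f (prod_encode (a, m)) = Some 0" for m
      using \<open>Q a n\<close> that by (intro leI) (auto simp: Q_def)
  qed
  have \<phi>_eq: "?\<phi> a = (if \<exists>n. Q a n then Some (LEAST n. f (prod_encode (a, n)) = Some 0) else None)" for a
    by (simp only: Q_def)
  have \<phi>: "?\<phi> a = Some n \<longleftrightarrow> Q a n" for a n
  proof (cases "\<exists>m. Q a m")
    case True
    then obtain m where m: "Q a m" ..
    then have "Q a n \<longleftrightarrow> n = m" using Least by blast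
    then show ?thesis using True Least[OF m] by (subst \<phi>_eq) auto
  next
    case False
    then show ?thesis unfolding \<phi>_eq by auto
  qed
  have P_mono: "P a t n" if "P a s n" "s \<le> t" for a s t n
  proof -
    have "F (prod_encode (a, m)) t = F (prod_encode (a, m)) s" if "m \<le> n" for m
    proof -
      have "F (prod_encode (a, m)) s \<noteq> 0"
        using \<open>P a s n\<close> that unfolding P_def by (metis le_neq_implies_less not_numeral_le_zero zero_neq_one)
      then show ?thesis using F \<open>s \<le> t\<close> by (auto simp: stage_approx_def)
    qed
    then show ?thesis using \<open>P a s n\<close> by (simp add: P_def)
  qed
  have P_unique: "m = n" if "P a s m" "P a s n" for a s m n
  proof -
    have "\<not> m' < n'" if "P a s m'" "P a s n'" for m' n'
    proof
      assume "m' < n'"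
      then have "2 \<le> F (prod_encode (a, m')) s" using that(2) by (simp add: P_def)
      then show False using that(1) by (simp add: P_def)
    qed
    from this[OF that] this[OF that(2,1)] show ?thesis by simp
  qed
  have H: "H a s = Suc n \<longleftrightarrow> n < s \<and> P a s n" for a s n
  proof
    assume *: "n < s \<and> P a s n"
    have "H a s = (\<Sum>i<s. if i = n then Suc i else 0)"
      unfolding H_def using * by (intro sum.cong refl) (auto dest: P_unique[of a s n])
    then show "H a s = Suc n" using * by simp
  next
    assume *: "H a s = Suc n"
    have "\<exists>i<s. P a s i"
    proof (rule ccontr)
      assume "\<not> (\<exists>i<s. P a s i)"
      then have "H a s = 0" unfolding H_def by simp
      then show False using * by simp
    qed
    then obtain i where i: "i < s" "P a s i" by blast
    have "H a s = (\<Sum>j<s. if j = i then Suc j else 0)"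
      unfolding H_def using i by (intro sum.cong refl) (auto dest: P_unique[of a s i])
    then show "n < s \<and> P a s n" using * i by simp
  qed
  have P_Q: "Q a n" if "P a s n" for a s n
    unfolding Q_def
  proof (intro conjI allI impI)
    show "f (prod_encode (a, n)) = Some 0"
      using that by (intro stage_approx_SomeI[OF F, of _ s]) (simp add: P_def)
    show "\<exists>y. f (prod_encode (a, m)) = Some (Suc y)" if "m < n" for m
    proof -
      have "2 \<le> F (prod_encode (a, m)) s" using \<open>P a s n\<close> that by (simp add: P_def)
      then have "F (prod_encode (a, m)) s = Suc (Suc (F (prod_encode (a, m)) s - 2))" by simp
      then show ?thesis using stage_approx_SomeI[OF F] by blast
    qed
  qed
  have Q_P: "\<exists>s. P a s n" if "Q a n" for a n
  proof -
    have "\<forall>m\<le>n. \<exists>s. F (prod_encode (a, m)) s \<noteq> 0"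
    proof (intro allI impI)
      fix m assume "m \<le> n"
      then obtain y where "f (prod_encode (a, m)) = Some y"
        using \<open>Q a n\<close> unfolding Q_def by (metis le_neq_implies_less)
      then obtain s where "F (prod_encode (a, m)) s = Suc y"
        using stage_approx_Some[OF F] by blast
      then show "\<exists>s. F (prod_encode (a, m)) s \<noteq> 0" by (intro exI[of _ s]) simp
    qed
    then obtain u where u: "F (prod_encode (a, m)) (u m) \<noteq> 0" if "m \<le> n" for m by metis
    define s where "s = Max (u ` {..n})"
    have val: "F (prod_encode (a, m)) s = Suc y"
      if m: "m \<le> n" and y: "f (prod_encode (a, m)) = Some y" for m y
    proof -
      obtain z where z: "F (prod_encode (a, m)) (u m) = Suc z"
        using not0_implies_Suc[OF u[OF m]] ..
      moreover have "z = y" using stage_approx_SomeI[OF F z] y by simp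
      moreover have "u m \<le> s" using m by (simp add: s_def)
      ultimately show ?thesis using stage_approx_mono[OF F z] by simp
    qed
    have "P a s n"
      unfolding P_def
    proof (intro conjI allI impI)
      show "F (prod_encode (a, n)) s = 1" using val[of n 0] \<open>Q a n\<close> by (simp add: Q_def)
      show "2 \<le> F (prod_encode (a, m)) s" if m: "m < n" for m
      proof -
        obtain y where "f (prod_encode (a, m)) = Some (Suc y)"
          using \<open>Q a n\<close> m by (auto simp: Q_def)
        then show ?thesis using val[of m] m by simp
      qed
    qed
    then show ?thesis ..
  qed
  show "stage_approx ?\<phi> H"
  proof (rule stage_approxI)
    show "computable (\<lambda>p. H (nfst p) (nsnd p))"
      unfolding H_def P_def
      by (intro computable_intros stage_approx_computable[OF F])
  next
    fix n s t v assume "s \<le> t" "H n s = Suc v"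
    then show "H n t = Suc v" using P_mono[of n s v t] by (simp add: H)
  next
    fix n s v assume "H n s = Suc v"
    then have "P n s v" by (simp add: H)
    then have "Q n v" by (rule P_Q)
    then show "?\<phi> n = Some v" by (simp only: \<phi>)
  next
    fix n v assume "?\<phi> n = Some v"
    then have "Q n v" by (simp only: \<phi>)
    then obtain s where "P n s v" using Q_P by blast
    then have "P n (max s (Suc v)) v" by (rule P_mono) simp
    then have "H n (max s (Suc v)) = Suc v" using H by simp
    then show "\<exists>s. H n s = Suc v" ..
  qed
qed

lemma partial_computable_stage_approx: "partial_computable \<phi> \<Longrightarrow> \<exists>G. stage_approx \<phi> G"
proof (induction rule: partial_computable.induct)
  case zero
  show ?case using stage_approx_total[OF computable_const] by blast
next
  case succ
  show ?case using stage_approx_total[OF computable_Suc[OF computable_id]] by blast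
next
  case left
  show ?case using stage_approx_total[OF computable_nfst[OF computable_id]] by blast
next
  case right
  show ?case using stage_approx_total[OF computable_nsnd[OF computable_id]] by blast
next
  case (pair f g)
  then obtain F G where "stage_approx f F" "stage_approx g G" by blast
  then show ?case by (rule stage_approx_pair)
next
  case (comp f g)
  then obtain F G where "stage_approx f F" "stage_approx g G" by blast
  then show ?case by (rule stage_approx_comp)
next
  case (prim_rec f g)
  then obtain F G where "stage_approx f F" "stage_approx g G" by blast
  then show ?case by (rule stage_approx_prim_rec)
next
  case (minimize f)
  then obtain F where "stage_approx f F" by blast
  then show ?case by (rule stage_approx_minimize)
qed

subsection \<open>Countability\<close>

text \<open>The constructors mirror the schemes. Only countability is at stake: the back-and-forth
  argument enumerates sets of germs.\<close>

datatype code = CZero | CSucc | CLeft | CRight | CPair code code | CComp code code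
  | CRec code code | CMin code

instance code :: countable by countable_datatype

primrec run_code :: "code \<Rightarrow> nat \<rightharpoonup> nat" where
  "run_code CZero = (\<lambda>_. Some 0)"
| "run_code CSucc = (\<lambda>n. Some (Suc n))"
| "run_code CLeft = (\<lambda>n. Some (nfst n))"
| "run_code CRight = (\<lambda>n. Some (nsnd n))"
| "run_code (CPair c d) = (\<lambda>n. Option.bind (run_code c n)
    (\<lambda>a. Option.bind (run_code d n) (\<lambda>b. Some (prod_encode (a, b)))))"
| "run_code (CComp c d) = run_code c \<circ>\<^sub>m run_code d"
| "run_code (CRec c d) = (\<lambda>n. case prod_decode n of (a, k) \<Rightarrow> rec_nat (run_code c a)
    (\<lambda>m r. Option.bind r (\<lambda>v. run_code d (prod_encode (a, prod_encode (m, v))))) k)"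
| "run_code (CMin c) = (\<lambda>a.
    if \<exists>n. run_code c (prod_encode (a, n)) = Some 0 \<and>
      (\<forall>m<n. \<exists>y. run_code c (prod_encode (a, m)) = Some (Suc y))
    then Some (LEAST n. run_code c (prod_encode (a, n)) = Some 0) else None)"

lemma partial_computable_run_code: "partial_computable \<phi> \<Longrightarrow> \<phi> \<in> range run_code"
proof (induction rule: partial_computable.induct)
  case zero then show ?case by (rule range_eqI[of _ _ CZero]) simp
next
  case succ then show ?case by (rule range_eqI[of _ _ CSucc]) simp
next
  case left then show ?case by (rule range_eqI[of _ _ CLeft]) simp
next
  case right then show ?case by (rule range_eqI[of _ _ CRight]) simp
next
  case (pair f g)
  then obtain c d where "f = run_code c" "g = run_code d" by blast
  then show ?case by (intro range_eqI[of _ _ "CPair c d"]) (simp only: run_code.simps)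
next
  case (comp f g)
  then obtain c d where "f = run_code c" "g = run_code d" by blast
  then show ?case by (intro range_eqI[of _ _ "CComp c d"]) (simp only: run_code.simps)
next
  case (prim_rec f g)
  then obtain c d where "f = run_code c" "g = run_code d" by blast
  then show ?case by (intro range_eqI[of _ _ "CRec c d"]) (simp only: run_code.simps)
next
  case (minimize f)
  then obtain c where "f = run_code c" by blast
  then show ?case by (intro range_eqI[of _ _ "CMin c"]) (simp only: run_code.simps)
qed

lemma countable_partial_computable: "countable {\<phi>. partial_computable \<phi>}"
  by (rule countable_subset[of _ "range run_code"]) (use partial_computable_run_code in auto)

lemma countable_computable: "countable {f. computable f}"
proof (rule countable_image_inj_on)
  show "inj_on (\<lambda>f n. Some (f n)) {f. computable f}"
    by (auto simp: inj_on_def fun_eq_iff)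
  show "countable ((\<lambda>f n. Some (f n)) ` {f. computable f})"
    by (rule countable_subset[OF _ countable_partial_computable]) (auto simp: computable_def)
qed

section \<open>Order-types\<close>

subsection \<open>Colored dense orders\<close>

text \<open>Cantor's setting with colors: a countable order without endpoints in which every color
  of \<open>K\<close> is dense. The explicit carrier lets it cover sets of chosen representatives as
  well as the rationals.\<close>

locale dense_colored =
  fixes A :: "'a set" and lt :: "'a \<Rightarrow> 'a \<Rightarrow> bool" (infix "\<sqsubset>" 50)
    and col :: "'a \<Rightarrow> 'k" and K :: "'k set"
  assumes nonempty: "A \<noteq> {}"
    and countable: "countable A"
    and irrefl: "x \<in> A \<Longrightarrow> \<not> x \<sqsubset> x"
    and trans: "x \<in> A \<Longrightarrow> y \<in> A \<Longrightarrow> z \<in> A \<Longrightarrow> x \<sqsubset> y \<Longrightarrow> y \<sqsubset> z \<Longrightarrow> x \<sqsubset> z"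
    and total: "x \<in> A \<Longrightarrow> y \<in> A \<Longrightarrow> x \<noteq> y \<Longrightarrow> x \<sqsubset> y \<or> y \<sqsubset> x"
    and no_least: "x \<in> A \<Longrightarrow> \<exists>y\<in>A. y \<sqsubset> x"
    and no_greatest: "x \<in> A \<Longrightarrow> \<exists>y\<in>A. x \<sqsubset> y"
    and color: "x \<in> A \<Longrightarrow> col x \<in> K"
    and dense: "x \<in> A \<Longrightarrow> y \<in> A \<Longrightarrow> x \<sqsubset> y \<Longrightarrow> k \<in> K \<Longrightarrow> \<exists>z\<in>A. x \<sqsubset> z \<and> z \<sqsubset> y \<and> col z = k"
begin

text \<open>Duality: statements about upper ends follow from those about lower ends.\<close>

lemma converse: "dense_colored A (\<lambda>x y. y \<sqsubset> x) col K"
proof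
  show "z \<sqsubset> x" if "x \<in> A" "y \<in> A" "z \<in> A" "y \<sqsubset> x" "z \<sqsubset> y" for x y z
    using that by (blast intro: trans[of z y x])
  show "y \<sqsubset> x \<or> x \<sqsubset> y" if "x \<in> A" "y \<in> A" "x \<noteq> y" for x y
    using total[OF that] by blast
  show "\<exists>z\<in>A. z \<sqsubset> x \<and> y \<sqsubset> z \<and> col z = k" if "x \<in> A" "y \<in> A" "y \<sqsubset> x" "k \<in> K" for x y k
    using dense[OF that(2,1,3,4)] by blast
qed (fact nonempty countable irrefl no_least no_greatest color)+

lemma le_less_trans:
  assumes "x \<in> A" "y \<in> A" "z \<in> A" "x = y \<or> x \<sqsubset> y" "y \<sqsubset> z" shows "x \<sqsubset> z"
  using assms(4)
proof
  assume "x \<sqsubset> y"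
  then show ?thesis using trans[OF assms(1-3)] assms(5) by simp
qed (simp add: assms(5))

lemma finite_greatest:
  assumes "finite L" "L \<noteq> {}" "L \<subseteq> A"
  shows "\<exists>m\<in>L. \<forall>l\<in>L. l = m \<or> l \<sqsubset> m"
  using assms
proof (induction L rule: finite_ne_induct)
  case (insert x L)
  then obtain m where m: "m \<in> L" "\<And>l. l \<in> L \<Longrightarrow> l = m \<or> l \<sqsubset> m" by auto
  have A: "x \<in> A" "m \<in> A" "\<And>l. l \<in> L \<Longrightarrow> l \<in> A" using m(1) insert.prems by auto
  show ?case
  proof (cases "m \<sqsubset> x")
    case True
    show ?thesis
    proof (intro bexI ballI)
      fix l assume "l \<in> insert x L"
      then show "l = x \<or> l \<sqsubset> x" using le_less_trans[OF A(3) A(2,1) m(2) True] by auto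
    qed simp
  next
    case False
    then have "x = m \<or> x \<sqsubset> m" using total[OF A(1,2)] by auto
    with m show ?thesis by auto
  qed
qed simp

text \<open>For nonempty \<open>L\<close> its maximum serves, hence the weak inequality; for empty
  \<open>L\<close> there is an element below \<open>U\<close> because no least element exists. The
  converse order then yields the other end of an interval that fits between \<open>L\<close> and
  \<open>U\<close>.\<close>

lemma lower_end:
  assumes "finite L" "finite U" "L \<subseteq> A" "U \<subseteq> A" and LU: "\<And>l u. l \<in> L \<Longrightarrow> u \<in> U \<Longrightarrow> l \<sqsubset> u"
  shows "\<exists>a\<in>A. (\<forall>l\<in>L. l = a \<or> l \<sqsubset> a) \<and> (\<forall>u\<in>U. a \<sqsubset> u)"
proof (cases "L = {}")
  case False
  then obtain m where "m \<in> L" "\<forall>l\<in>L. l = m \<or> l \<sqsubset> m"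
    using finite_greatest[OF assms(1) _ assms(3)] by auto
  then show ?thesis using LU assms(3) by (intro bexI[of _ m]) auto
next
  case L: True
  show ?thesis
  proof (cases "U = {}")
    case False
    interpret c: dense_colored A "\<lambda>x y. y \<sqsubset> x" col K by (rule converse)
    obtain m where m: "m \<in> U" "\<forall>u\<in>U. u = m \<or> m \<sqsubset> u"
      using c.finite_greatest[OF assms(2) False assms(4)] by auto
    obtain a where a: "a \<in> A" "a \<sqsubset> m" using no_least[of m] m(1) assms(4) by auto
    have "a \<sqsubset> u" if "u \<in> U" for u
      using c.le_less_trans[of u m a] m that assms(4) a by auto
    with a L show ?thesis by (intro bexI[of _ a]) auto
  qed (use L nonempty in auto)
qed

lemma between:
  assumes "finite L" "finite U" "L \<subseteq> A" "U \<subseteq> A" and LU: "\<And>l u. l \<in> L \<Longrightarrow> u \<in> U \<Longrightarrow> l \<sqsubset> u"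
    and "k \<in> K"
  shows "\<exists>z\<in>A. (\<forall>l\<in>L. l \<sqsubset> z) \<and> (\<forall>u\<in>U. z \<sqsubset> u) \<and> col z = k"
proof -
  interpret c: dense_colored A "\<lambda>x y. y \<sqsubset> x" col K by (rule converse)
  obtain a where a: "a \<in> A" "\<forall>l\<in>L. l = a \<or> l \<sqsubset> a" "\<forall>u\<in>U. a \<sqsubset> u"
    using lower_end[OF assms(1-5)] by auto
  obtain b where b: "b \<in> A" "\<forall>u\<in>U. u = b \<or> b \<sqsubset> u" "a \<sqsubset> b"
    using c.lower_end[of U "{a}"] assms(2,4) a by auto
  obtain z where z: "z \<in> A" "a \<sqsubset> z" "z \<sqsubset> b" "col z = k"
    using dense[OF a(1) b(1,3) \<open>k \<in> K\<close>] by auto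
  show ?thesis
  proof (intro bexI[of _ z] conjI ballI)
    show "l \<sqsubset> z" if "l \<in> L" for l
      using le_less_trans[of l a z] a z that assms(3) by auto
    show "z \<sqsubset> u" if "u \<in> U" for u
      using c.le_less_trans[of u b z] b z that assms(4) by auto
  qed (use z in auto)
qed

end

text \<open>A finite relation instead of a function, so that the back step is the forth step for the
  converse. Between irreflexive total orders it is automatically one-to-one.\<close>

definition partial_iso where
  "partial_iso A lt c B lt' c' h \<longleftrightarrow> finite h \<and> h \<subseteq> A \<times> B \<and> (\<forall>(x, y)\<in>h. c' y = c x) \<and>
     (\<forall>(x, y)\<in>h. \<forall>(x', y')\<in>h. lt x x' \<longleftrightarrow> lt' y y')"

lemma partial_iso_converse:
  "partial_iso A lt c B lt' c' h \<Longrightarrow> partial_iso B lt' c' A lt c (h\<inverse>)"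
  unfolding partial_iso_def by (auto 0 3)

lemma partial_iso_extend:
  assumes A: "dense_colored A lt c K" and B: "dense_colored B lt' c' K"
    and h: "partial_iso A lt c B lt' c' h" and a: "a \<in> A"
  shows "\<exists>h'. partial_iso A lt c B lt' c' h' \<and> h \<subseteq> h' \<and> a \<in> Domain h'"
proof (cases "a \<in> Domain h")
  case True
  with h show ?thesis by blast
next
  case False
  interpret A: dense_colored A lt c K by (rule A)
  interpret B: dense_colored B lt' c' K by (rule B)
  \<comment> \<open>The images of the points below and above \<open>a\<close>; density provides a
    point of the color of \<open>a\<close> between them.\<close>
  define L where "L = {y. \<exists>x. (x, y) \<in> h \<and> lt x a}"
  define U where "U = {y. \<exists>x. (x, y) \<in> h \<and> lt a x}"
  have fin: "finite h" and sub: "h \<subseteq> A \<times> B"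
    and iso: "(x, y) \<in> h \<Longrightarrow> (x', y') \<in> h \<Longrightarrow> lt x x' \<longleftrightarrow> lt' y y'" for x y x' y'
    using h unfolding partial_iso_def by fast+
  have LU: "L \<subseteq> snd ` h" "U \<subseteq> snd ` h" by (force simp: L_def U_def)+
  have "\<exists>z\<in>B. (\<forall>l\<in>L. lt' l z) \<and> (\<forall>u\<in>U. lt' z u) \<and> c' z = c a"
  proof (rule B.between)
    show "finite L" "finite U" using LU fin finite_surj by blast+
    have "snd ` h \<subseteq> B" using sub by auto
    then show "L \<subseteq> B" "U \<subseteq> B" using LU by blast+
    show "lt' l u" if l: "l \<in> L" and u: "u \<in> U" for l u
    proof -
      obtain x where "(x, l) \<in> h" "lt x a" using l by (auto simp: L_def)
      moreover obtain x' where "(x', u) \<in> h" "lt a x'" using u by (auto simp: U_def)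
      ultimately have x: "(x, l) \<in> h" "lt x a" "(x', u) \<in> h" "lt a x'" by simp_all
      then have "lt x x'" using A.trans[of x a x'] a sub by blast
      with x iso show ?thesis by blast
    qed
    show "c a \<in> K" by (rule A.color[OF a])
  qed
  then obtain b where b: "b \<in> B" "\<forall>l\<in>L. lt' l b" "\<forall>u\<in>U. lt' b u" "c' b = c a" by blast
  have side: "(lt x a \<longleftrightarrow> lt' y b) \<and> (lt a x \<longleftrightarrow> lt' b y)" if xy: "(x, y) \<in> h" for x y
  proof -
    have x: "x \<in> A" "y \<in> B" "x \<noteq> a" using xy sub False by auto
    then have "lt x a \<or> lt a x" using A.total a by blast
    then show ?thesis
    proof
      assume *: "lt x a"
      then have "y \<in> L" using xy by (auto simp: L_def)
      then show ?thesis
        using * b x a A.irrefl A.trans[of x a x] B.irrefl B.trans[of y b y] by blast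
    next
      assume *: "lt a x"
      then have "y \<in> U" using xy by (auto simp: U_def)
      then show ?thesis
        using * b x a A.irrefl A.trans[of x a x] B.irrefl B.trans[of y b y] by blast
    qed
  qed
  have "partial_iso A lt c B lt' c' (insert (a, b) h)"
    unfolding partial_iso_def
  proof (intro conjI)
    show "\<forall>(x, y)\<in>insert (a, b) h. \<forall>(x', y')\<in>insert (a, b) h. lt x x' \<longleftrightarrow> lt' y y'"
      using side iso A.irrefl[OF a] B.irrefl[OF b(1)] by auto
    show "\<forall>(x, y)\<in>insert (a, b) h. c' y = c x"
      using h b(4) by (auto simp: partial_iso_def)
  qed (use fin sub a b in auto)
  then show ?thesis by blast
qed

text \<open>Back and forth: step \<open>n\<close> brings the \<open>n\<close>-th element of
  \<open>A\<close> into the domain and that of \<open>B\<close> into the range, and the union of the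
  chain is the isomorphism.\<close>

lemma dense_colored_iso:
  assumes A: "dense_colored A lt c K" and B: "dense_colored B lt' c' K"
  shows "\<exists>f. f ` A = B \<and> (\<forall>x\<in>A. \<forall>y\<in>A. lt x y \<longleftrightarrow> lt' (f x) (f y)) \<and> (\<forall>x\<in>A. c' (f x) = c x)"
proof -
  interpret A: dense_colored A lt c K by (rule A)
  interpret B: dense_colored B lt' c' K by (rule B)
  let ?iso = "partial_iso A lt c B lt' c'"
  let ?a = "from_nat_into A" and ?b = "from_nat_into B"
  have "\<exists>h. \<forall>n. ?iso (h n) \<and>
      (h n \<subseteq> h (Suc n) \<and> ?a n \<in> Domain (h (Suc n)) \<and> ?b n \<in> Range (h (Suc n)))"
  proof (rule dependent_nat_choice[where P = "\<lambda>_. ?iso" and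
        Q = "\<lambda>n h h'. h \<subseteq> h' \<and> ?a n \<in> Domain h' \<and> ?b n \<in> Range h'"])
    show "\<exists>h. ?iso h" by (rule exI[of _ "{}"]) (simp add: partial_iso_def)
  next
    fix h n assume "?iso h"
    obtain h' where h': "?iso h'" "h \<subseteq> h'" "?a n \<in> Domain h'"
      using partial_iso_extend[OF A B \<open>?iso h\<close> from_nat_into[OF A.nonempty, of n]] by auto
    obtain g where g: "partial_iso B lt' c' A lt c g" "h'\<inverse> \<subseteq> g" "?b n \<in> Domain g"
      using partial_iso_extend[OF B A partial_iso_converse[OF h'(1)] from_nat_into[OF B.nonempty, of n]]
      by auto
    have "?iso (g\<inverse>)" "h' \<subseteq> g\<inverse>" "?b n \<in> Range (g\<inverse>)"
      using partial_iso_converse[OF g(1)] g(2,3) by auto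
    then show "\<exists>h'. ?iso h' \<and> h \<subseteq> h' \<and> ?a n \<in> Domain h' \<and> ?b n \<in> Range h'"
      using h' by (intro exI[of _ "g\<inverse>"]) auto
  qed
  then obtain h where "\<forall>n. ?iso (h n) \<and>
      (h n \<subseteq> h (Suc n) \<and> ?a n \<in> Domain (h (Suc n)) \<and> ?b n \<in> Range (h (Suc n)))" ..
  then have h: "\<And>n. ?iso (h n)" "\<And>n. h n \<subseteq> h (Suc n)"
    "\<And>n. ?a n \<in> Domain (h (Suc n))" "\<And>n. ?b n \<in> Range (h (Suc n))" by simp_all
  define H where "H = (\<Union>n. h n)"
  have mono: "m \<le> n \<Longrightarrow> h m \<subseteq> h n" for m n
    using h(2) by (rule lift_Suc_mono_le)
  have H: "x \<in> A \<and> y \<in> B \<and> c' y = c x" if xy: "(x, y) \<in> H" for x y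
  proof -
    obtain n where "(x, y) \<in> h n" using xy by (auto simp: H_def)
    then show ?thesis using h(1)[of n] by (auto simp: partial_iso_def)
  qed
  have H2: "lt x x' \<longleftrightarrow> lt' y y'" if xy: "(x, y) \<in> H" "(x', y') \<in> H" for x y x' y'
  proof -
    obtain m n where "(x, y) \<in> h m" "(x', y') \<in> h n" using xy by (auto simp: H_def)
    then have "(x, y) \<in> h (max m n)" "(x', y') \<in> h (max m n)"
      using mono[of m "max m n"] mono[of n "max m n"] by auto
    then show ?thesis using h(1)[of "max m n"] unfolding partial_iso_def by fast
  qed
  have "A \<subseteq> Domain H"
  proof
    fix x assume "x \<in> A"
    then obtain n where "?a n = x"
      using from_nat_into_surj[OF A.countable] by auto
    then show "x \<in> Domain H" using h(3)[of n] by (auto simp: H_def)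
  qed
  then have "\<forall>x\<in>A. \<exists>y. (x, y) \<in> H" by auto
  then obtain f where f: "\<And>x. x \<in> A \<Longrightarrow> (x, f x) \<in> H"
    using bchoice[of A "\<lambda>x y. (x, y) \<in> H"] by auto
  have "y \<in> f ` A" if y: "y \<in> B" for y
  proof -
    obtain n where "?b n = y"
      using from_nat_into_surj[OF B.countable y] by auto
    then have "y \<in> Range H" using h(4)[of n] by (auto simp: H_def)
    then obtain x where x: "(x, y) \<in> H" by auto
    then have "x \<in> A" using H by simp
    then have fx: "(x, f x) \<in> H" by (rule f)
    have "\<not> lt' y (f x)" "\<not> lt' (f x) y"
      using H2[OF x fx] H2[OF fx x] A.irrefl[OF \<open>x \<in> A\<close>] by auto
    then have "y = f x" using B.total[OF y, of "f x"] H[OF fx] by auto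
    then show ?thesis using \<open>x \<in> A\<close> by (rule image_eqI)
  qed
  then have "f ` A = B" using H[OF f] by auto
  moreover have "\<forall>x\<in>A. \<forall>y\<in>A. lt x y \<longleftrightarrow> lt' (f x) (f y)" using H2[OF f f] by simp
  moreover have "\<forall>x\<in>A. c' (f x) = c x" using H[OF f] by simp
  ultimately show ?thesis by blast
qed

lemma dense_colored_rat:
  assumes "dense_coloring \<X> d"
  shows "dense_colored UNIV ((<) :: rat \<Rightarrow> _) d \<X>"
  by unfold_locales
    (use assms in \<open>auto simp: dense_coloring_def intro: gt_ex lt_ex\<close>)

lemma dense_colored_Rats: "dense_colored UNIV ((<) :: rat \<Rightarrow> _) (\<lambda>_. ()) UNIV"
  by unfold_locales (auto intro: gt_ex lt_ex dense)

lemma (in dense_colored) forget_colors: "dense_colored A lt (\<lambda>_. ()) UNIV"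
proof unfold_locales
  show "\<exists>z\<in>A. x \<sqsubset> z \<and> z \<sqsubset> y \<and> () = k" if "x \<in> A" "y \<in> A" "x \<sqsubset> y" for x y and k :: unit
    using dense[OF that color[OF that(1)]] by auto
qed (simp_all add: nonempty countable irrefl total no_least no_greatest, blast intro: trans)

text \<open>Ensures that the choice in \<open>shuffle\<close> picks a genuine coloring: the colors
  are carried over to the rationals along an isomorphism that ignores them. Applied to the blocks of
  the cohesive power, this saves building a coloring of the rationals by hand.\<close>

lemma dense_colored_imp_dense_coloring:
  assumes "dense_colored A lt col \<X>"
  shows "\<exists>d. dense_coloring \<X> d"
proof -
  interpret dense_colored A lt col \<X> by (rule assms)
  obtain f :: "rat \<Rightarrow> 'a" where f: "range f = A" "\<And>p q. p < q \<longleftrightarrow> lt (f p) (f q)"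
    using dense_colored_iso[OF dense_colored_Rats forget_colors] by blast
  have "dense_coloring \<X> (col \<circ> f)"
    unfolding dense_coloring_def
  proof (intro conjI ballI allI impI)
    show "range (col \<circ> f) \<subseteq> \<X>" using f(1) color by auto
  next
    fix S and p q :: rat assume "S \<in> \<X>" "p < q"
    then obtain z where z: "z \<in> A" "lt (f p) z" "lt z (f q)" "col z = S"
      using dense[of "f p" "f q" S] f by blast
    then obtain r where "z = f r" using f(1) by blast
    with z f(2) show "\<exists>r>p. r < q \<and> (col \<circ> f) r = S" by auto
  qed
  then show ?thesis by blast
qed

text \<open>A countable set of representatives, compared by a strict weak order, stands for the
  order of its equivalence classes.\<close>

locale weak_dense_colored =
  fixes S :: "'a set" and lt :: "'a \<Rightarrow> 'a \<Rightarrow> bool" (infix "\<sqsubset>" 50)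
    and col :: "'a \<Rightarrow> 'k" and K :: "'k set"
  assumes nonempty: "S \<noteq> {}"
    and countable: "countable S"
    and irrefl: "x \<in> S \<Longrightarrow> \<not> x \<sqsubset> x"
    and trans: "x \<in> S \<Longrightarrow> y \<in> S \<Longrightarrow> z \<in> S \<Longrightarrow> x \<sqsubset> y \<Longrightarrow> y \<sqsubset> z \<Longrightarrow> x \<sqsubset> z"
    and cotrans: "x \<in> S \<Longrightarrow> y \<in> S \<Longrightarrow> z \<in> S \<Longrightarrow> x \<sqsubset> z \<Longrightarrow> x \<sqsubset> y \<or> y \<sqsubset> z"
    and no_least: "x \<in> S \<Longrightarrow> \<exists>y\<in>S. y \<sqsubset> x"
    and no_greatest: "x \<in> S \<Longrightarrow> \<exists>y\<in>S. x \<sqsubset> y"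
    and color: "x \<in> S \<Longrightarrow> col x \<in> K"
    and color_eq: "x \<in> S \<Longrightarrow> y \<in> S \<Longrightarrow> \<not> x \<sqsubset> y \<Longrightarrow> \<not> y \<sqsubset> x \<Longrightarrow> col x = col y"
    and dense: "x \<in> S \<Longrightarrow> y \<in> S \<Longrightarrow> x \<sqsubset> y \<Longrightarrow> k \<in> K \<Longrightarrow> \<exists>z\<in>S. x \<sqsubset> z \<and> z \<sqsubset> y \<and> col z = k"
begin

definition rep :: "'a \<Rightarrow> 'a" where
  "rep x = (SOME y. y \<in> S \<and> \<not> x \<sqsubset> y \<and> \<not> y \<sqsubset> x)"

lemma rep: "x \<in> S \<Longrightarrow> rep x \<in> S \<and> \<not> x \<sqsubset> rep x \<and> \<not> rep x \<sqsubset> x"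
  unfolding rep_def by (rule someI[of _ x]) (simp add: irrefl)

lemma rep_cong:
  assumes "x \<in> S" "y \<in> S" "\<not> x \<sqsubset> y" "\<not> y \<sqsubset> x"
  shows "rep x = rep y"
proof -
  \<comment> \<open>Cotransitivity makes incomparability transitive, so both choices are made from
    the same set.\<close>
  have "(z \<in> S \<and> \<not> x \<sqsubset> z \<and> \<not> z \<sqsubset> x) = (z \<in> S \<and> \<not> y \<sqsubset> z \<and> \<not> z \<sqsubset> y)" for z
    using assms cotrans[of x y z] cotrans[of z y x] cotrans[of y x z] cotrans[of z x y] by blast
  then show ?thesis by (simp only: rep_def)
qed

lemma rep_less_iff:
  assumes "x \<in> S" "y \<in> S"
  shows "rep x \<sqsubset> rep y \<longleftrightarrow> x \<sqsubset> y"
proof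
  assume "rep x \<sqsubset> rep y"
  then show "x \<sqsubset> y"
    using assms rep[of x] rep[of y] cotrans[of "rep x" x "rep y"] cotrans[of x y "rep y"] by blast
next
  assume "x \<sqsubset> y"
  then show "rep x \<sqsubset> rep y"
    using assms rep[of x] rep[of y] cotrans[of x "rep x" y] cotrans[of "rep x" "rep y" y] by blast
qed

lemma dense_colored_reps: "dense_colored (rep ` S) (\<sqsubset>) col K"
proof
  show "rep ` S \<noteq> {}" using nonempty by simp
  show "countable (rep ` S)" using countable by simp
  have sub: "x \<in> S" if "x \<in> rep ` S" for x using that rep by auto
  show "\<not> x \<sqsubset> x" if "x \<in> rep ` S" for x using irrefl[OF sub[OF that]] .
  show "x \<sqsubset> z" if "x \<in> rep ` S" "y \<in> rep ` S" "z \<in> rep ` S" "x \<sqsubset> y" "y \<sqsubset> z" for x y z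
    using trans[OF sub sub sub] that .
  show "col x \<in> K" if "x \<in> rep ` S" for x using color[OF sub[OF that]] .
  show "x \<sqsubset> y \<or> y \<sqsubset> x" if xy: "x \<in> rep ` S" "y \<in> rep ` S" "x \<noteq> y" for x y
  proof -
    obtain a where "a \<in> S" "x = rep a" using xy(1) by auto
    moreover obtain b where "b \<in> S" "y = rep b" using xy(2) by auto
    ultimately show ?thesis using xy(3) rep_cong[of a b] rep_less_iff[of a b] rep_less_iff[of b a] by auto
  qed
  show "\<exists>y\<in>rep ` S. y \<sqsubset> x" if x: "x \<in> rep ` S" for x
  proof -
    obtain a where a: "a \<in> S" "x = rep a" using x by auto
    obtain b where "b \<in> S" "b \<sqsubset> a" using no_least[OF a(1)] by auto
    then show ?thesis using a rep_less_iff by (intro bexI[of _ "rep b"]) auto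
  qed
  show "\<exists>y\<in>rep ` S. x \<sqsubset> y" if x: "x \<in> rep ` S" for x
  proof -
    obtain a where a: "a \<in> S" "x = rep a" using x by auto
    obtain b where "b \<in> S" "a \<sqsubset> b" using no_greatest[OF a(1)] by auto
    then show ?thesis using a rep_less_iff by (intro bexI[of _ "rep b"]) auto
  qed
  show "\<exists>z\<in>rep ` S. x \<sqsubset> z \<and> z \<sqsubset> y \<and> col z = k"
    if xy: "x \<in> rep ` S" "y \<in> rep ` S" "x \<sqsubset> y" "k \<in> K" for x y k
  proof -
    obtain a where a: "a \<in> S" "x = rep a" using xy(1) by auto
    moreover obtain b where b: "b \<in> S" "y = rep b" using xy(2) by auto
    ultimately have ab: "a \<in> S" "x = rep a" "b \<in> S" "y = rep b" by auto
    then have "a \<sqsubset> b" using xy(3) rep_less_iff by simp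
    then obtain c where c: "c \<in> S" "a \<sqsubset> c" "c \<sqsubset> b" "col c = k"
      using dense[OF a(1) b(1) _ xy(4)] by auto
    moreover have "col (rep c) = k" using color_eq[of "rep c" c] rep[OF c(1)] c by simp
    ultimately show ?thesis using ab rep_less_iff by (intro bexI[of _ "rep c"]) auto
  qed
qed

lemma map_to_rat:
  assumes "dense_colored UNIV ((<) :: rat \<Rightarrow> _) d K"
  shows "\<exists>q :: 'a \<Rightarrow> rat. q ` S = UNIV \<and> (\<forall>x\<in>S. \<forall>y\<in>S. x \<sqsubset> y \<longleftrightarrow> q x < q y) \<and> (\<forall>x\<in>S. d (q x) = col x)"
proof -
  obtain f :: "'a \<Rightarrow> rat" where f: "f ` rep ` S = UNIV"
      "\<And>x y. x \<in> rep ` S \<Longrightarrow> y \<in> rep ` S \<Longrightarrow> x \<sqsubset> y \<longleftrightarrow> f x < f y"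
      "\<And>x. x \<in> rep ` S \<Longrightarrow> d (f x) = col x"
    using dense_colored_iso[OF dense_colored_reps assms] by metis
  have "(f \<circ> rep) ` S = UNIV" using f(1) by (simp add: image_comp)
  moreover have "\<forall>x\<in>S. \<forall>y\<in>S. x \<sqsubset> y \<longleftrightarrow> (f \<circ> rep) x < (f \<circ> rep) y"
    using f(2) rep_less_iff by auto
  moreover have "\<forall>x\<in>S. d ((f \<circ> rep) x) = col x"
  proof
    fix x assume x: "x \<in> S"
    then have "col (rep x) = col x" using color_eq[of "rep x" x] rep[of x] by simp
    then show "d ((f \<circ> rep) x) = col x" using f(3) x by simp
  qed
  ultimately show ?thesis by (intro exI[of _ "f \<circ> rep"] conjI)
qed

end

subsection \<open>Presentations of order-types\<close>

text \<open>An order-type given by redundant representatives: \<open>F\<close> is onto and both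
  preserves and reflects the order but need not be injective, so germs can be handled through
  functions without forming quotients.\<close>

definition presents :: "'x set \<Rightarrow> ('x \<Rightarrow> 'x \<Rightarrow> bool) \<Rightarrow> 'a lorder \<Rightarrow> ('x \<Rightarrow> 'a) \<Rightarrow> bool" where
  "presents S lt N F \<longleftrightarrow> F ` S = fst N \<and> (\<forall>x\<in>S. \<forall>y\<in>S. lt x y \<longleftrightarrow> (F x, F y) \<in> snd N)"

lemma presents_copy:
  assumes "inj f" "presents S lt N F"
  shows "presents S lt (copy f N) (f \<circ> F)"
proof -
  have "(f a, f b) \<in> map_prod f f ` snd N \<longleftrightarrow> (a, b) \<in> snd N" for a b
    using assms(1) by (force simp: inj_eq)
  moreover have "(f \<circ> F) ` S = f ` fst N"
    using assms(2) unfolding presents_def by (metis image_comp)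
  ultimately show ?thesis using assms(2) by (simp add: presents_def copy_def)
qed

lemma presents_sum:
  assumes "presents S0 lt N0 F0" "presents S1 lt N1 F1"
    and "S0 \<inter> S1 = {}" and "\<And>x y. x \<in> S0 \<Longrightarrow> y \<in> S1 \<Longrightarrow> lt x y \<and> \<not> lt y x"
  shows "presents (S0 \<union> S1) lt (N0 \<oplus> N1) (\<lambda>x. if x \<in> S0 then Inl (F0 x) else Inr (F1 x))"
  unfolding presents_def
proof
  let ?F = "\<lambda>x. if x \<in> S0 then Inl (F0 x) else Inr (F1 x)"
  have "?F ` S0 = Inl ` fst N0" using assms(1) by (simp add: presents_def flip: image_image)
  moreover have "?F ` S1 = Inr ` fst N1"
  proof -
    have "?F ` S1 = (Inr \<circ> F1) ` S1" using assms(3) by (intro image_cong) auto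
    also have "\<dots> = Inr ` fst N1"
      using assms(2) unfolding presents_def by (metis image_comp)
    finally show ?thesis .
  qed
  ultimately show "?F ` (S0 \<union> S1) = fst (N0 \<oplus> N1)"
    by (simp only: image_Un order_sum_def Plus_def fst_conv)
  have in_fst: "x \<in> S0 \<Longrightarrow> F0 x \<in> fst N0" "x \<in> S1 \<Longrightarrow> F1 x \<in> fst N1" for x
    using assms(1,2) by (auto simp: presents_def)
  have ord: "x \<in> S0 \<Longrightarrow> y \<in> S0 \<Longrightarrow> lt x y \<longleftrightarrow> (F0 x, F0 y) \<in> snd N0"
    "x \<in> S1 \<Longrightarrow> y \<in> S1 \<Longrightarrow> lt x y \<longleftrightarrow> (F1 x, F1 y) \<in> snd N1" for x y
    using assms(1,2) by (auto simp: presents_def)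
  show "\<forall>x\<in>S0 \<union> S1. \<forall>y\<in>S0 \<union> S1. lt x y \<longleftrightarrow> (?F x, ?F y) \<in> snd (N0 \<oplus> N1)"
  proof (intro ballI)
    fix x y assume "x \<in> S0 \<union> S1" "y \<in> S0 \<union> S1"
    then consider "x \<in> S0" "y \<in> S0" | "x \<in> S0" "y \<in> S1" "y \<notin> S0"
      | "x \<in> S1" "x \<notin> S0" "y \<in> S0" | "x \<in> S1" "x \<notin> S0" "y \<in> S1" "y \<notin> S0"
      using assms(3) by blast
    then show "lt x y \<longleftrightarrow> (?F x, ?F y) \<in> snd (N0 \<oplus> N1)"
      using in_fst ord assms(4) by cases (simp_all add: order_sum_def)
  qed
qed

text \<open>\<open>q\<close> picks the summand and \<open>G r\<close> presents the fiber over
  \<open>r\<close>: distinct indices decide a comparison, equal ones leave it to the fiber.\<close>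

lemma presents_lex_sum_eta:
  fixes q :: "'x \<Rightarrow> rat"
  assumes q: "q ` S = UNIV"
    and less: "\<And>x y. x \<in> S \<Longrightarrow> y \<in> S \<Longrightarrow> q x < q y \<Longrightarrow> lt x y \<and> \<not> lt y x"
    and G: "\<And>r. presents {x\<in>S. q x = r} lt (N r) (G r)"
  shows "presents S lt (lex_sum eta N) (\<lambda>x. (q x, G (q x) x))"
  unfolding presents_def
proof
  have mem: "G (q x) x \<in> fst (N (q x))" if "x \<in> S" for x
    using G[of "q x"] that by (auto simp: presents_def)
  show "(\<lambda>x. (q x, G (q x) x)) ` S = fst (lex_sum eta N)"
  proof
    show "(\<lambda>x. (q x, G (q x) x)) ` S \<subseteq> fst (lex_sum eta N)"
      using mem by (auto simp: lex_sum_def eta_def)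
    show "fst (lex_sum eta N) \<subseteq> (\<lambda>x. (q x, G (q x) x)) ` S"
    proof
      fix p assume "p \<in> fst (lex_sum eta N)"
      then obtain r a where p: "p = (r, a)" "a \<in> fst (N r)"
        by (auto simp: lex_sum_def eta_def)
      then have "a \<in> G r ` {x\<in>S. q x = r}" using G[of r] by (simp add: presents_def)
      then obtain x where "x \<in> S" "q x = r" "G r x = a" by auto
      then show "p \<in> (\<lambda>x. (q x, G (q x) x)) ` S" using p by blast
    qed
  qed
  show "\<forall>x\<in>S. \<forall>y\<in>S. lt x y \<longleftrightarrow> ((q x, G (q x) x), (q y, G (q y) y)) \<in> snd (lex_sum eta N)"
  proof (intro ballI)
    fix x y assume xy: "x \<in> S" "y \<in> S"
    have *: "((q x, G (q x) x), (q y, G (q y) y)) \<in> snd (lex_sum eta N) \<longleftrightarrow>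
        q x < q y \<or> q x = q y \<and> (G (q x) x, G (q y) y) \<in> snd (N (q x))"
      using mem xy by (auto simp: lex_sum_def eta_def)
    show "lt x y \<longleftrightarrow> ((q x, G (q x) x), (q y, G (q y) y)) \<in> snd (lex_sum eta N)"
      using xy G[of "q x"] less[of x y] less[of y x] unfolding *
      by (cases "q x" "q y" rule: linorder_cases) (simp_all add: presents_def)
  qed
qed

lemma lin_orderD:
  assumes "lin_order M"
  shows "(x, y) \<in> snd M \<Longrightarrow> x \<in> fst M \<and> y \<in> fst M"
    and "(x, x) \<notin> snd M"
    and "(x, y) \<in> snd M \<Longrightarrow> (y, z) \<in> snd M \<Longrightarrow> (x, z) \<in> snd M"
    and "x \<in> fst M \<Longrightarrow> y \<in> fst M \<Longrightarrow> x \<noteq> y \<Longrightarrow> (x, y) \<in> snd M \<or> (y, x) \<in> snd M"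
  using assms unfolding lin_order_def strict_linear_order_on_def irrefl_def total_on_def
  by (blast dest: transD)+

text \<open>The number of predecessors is strictly increasing, and its range is downward closed
  because the predecessors of \<open>x\<close> realize exactly the numbers below the value at
  \<open>x\<close>.\<close>

lemma presents_omega:
  assumes M: "lin_order M" and inf: "infinite (fst M)"
    and fin: "\<And>x. finite {y. (y, x) \<in> snd M}"
  shows "presents (fst M) (\<lambda>x y. (x, y) \<in> snd M) omega (\<lambda>x. card {y. (y, x) \<in> snd M})"
proof -
  let ?F = "\<lambda>x. card {y. (y, x) \<in> snd M}"
  have mono: "?F x < ?F y" if "(x, y) \<in> snd M" for x y
    using that lin_orderD[OF M] by (intro psubset_card_mono fin) blast
  have iff: "(x, y) \<in> snd M \<longleftrightarrow> ?F x < ?F y" if "x \<in> fst M" "y \<in> fst M" for x y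
    using that mono[of x y] mono[of y x] lin_orderD(4)[OF M, of x y] by (cases "x = y") auto
  have inj: "inj_on ?F (fst M)"
  proof (rule inj_onI, rule ccontr)
    fix x y assume "x \<in> fst M" "y \<in> fst M" "?F x = ?F y" "x \<noteq> y"
    then show False using lin_orderD(4)[OF M, of x y] mono[of x y] mono[of y x] by auto
  qed
  have down: "?F ` {y. (y, x) \<in> snd M} = {..<?F x}" for x
  proof (rule card_subset_eq)
    show "?F ` {y. (y, x) \<in> snd M} \<subseteq> {..<?F x}" using mono by auto
    have "inj_on ?F {y. (y, x) \<in> snd M}"
      by (rule inj_on_subset[OF inj]) (use lin_orderD(1)[OF M] in auto)
    then show "card (?F ` {y. (y, x) \<in> snd M}) = card {..<?F x}" by (simp add: card_image)
  qed simp
  have "?F ` fst M = UNIV"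
  proof -
    have "n \<in> ?F ` fst M" for n
    proof -
      have "infinite (?F ` fst M)" using inf inj by (simp add: finite_image_iff)
      then obtain x where "x \<in> fst M" "n < ?F x"
        using infinite_nat_iff_unbounded[of "?F ` fst M"] by auto
      then have "n \<in> ?F ` {y. (y, x) \<in> snd M}" unfolding down by simp
      then show ?thesis using lin_orderD(1)[OF M] by blast
    qed
    then show ?thesis by blast
  qed
  then show ?thesis using iff by (simp add: presents_def omega_def)
qed

lemma presents_lin_order_iso:
  assumes M: "lin_order M" and N: "\<And>a. (a, a) \<notin> snd N"
    and F: "presents (fst M) (\<lambda>x y. (x, y) \<in> snd M) N F"
  shows "M \<cong> N"
proof -
  have "inj_on F (fst M)"
  proof (rule inj_onI, rule ccontr)
    fix x y assume xy: "x \<in> fst M" "y \<in> fst M" "F x = F y" "x \<noteq> y"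
    then have "(F x, F y) \<in> snd N \<or> (F y, F x) \<in> snd N"
      using lin_orderD(4)[OF M, of x y] F by (auto simp: presents_def)
    then show False using xy(3) N by simp
  qed
  then show ?thesis using F unfolding presents_def same_order_type_def bij_betw_def by blast
qed

section \<open>Germs along a co-c.e. cohesive set\<close>

text \<open>Truth on almost all of \<open>C\<close> as a filter, so that equality and order in the
  cohesive power become \<open>eventually\<close> statements.\<close>

definition germ :: "nat set \<Rightarrow> nat filter" where
  "germ C = inf cofinite (principal C)"

lemma eventually_germ: "eventually P (germ C) \<longleftrightarrow> finite {n \<in> C. \<not> P n}"
proof -
  have "{n. \<not> (n \<in> C \<longrightarrow> P n)} = {n \<in> C. \<not> P n}" by auto
  then show ?thesis by (simp add: germ_def eventually_inf_principal eventually_cofinite)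
qed

lemma eventually_germ_ge: "eventually P (germ C) \<longleftrightarrow> (\<exists>N. \<forall>n\<ge>N. n \<in> C \<longrightarrow> P n)"
  unfolding eventually_germ finite_nat_set_iff_bounded
  by (metis (mono_tags, lifting) mem_Collect_eq not_less)

lemma almost_subset_eventually: "C \<subseteq>\<^sup>* {n. P n} \<longleftrightarrow> eventually P (germ C)"
proof -
  have "C - {n. P n} = {n \<in> C. \<not> P n}" by auto
  then show ?thesis by (simp add: almost_subset_def eventually_germ)
qed

text \<open>An element \<open>t\<close> of \<open>St\<close> is the stage at which \<open>nfst t\<close> is enumerated into \<open>- C\<close>.\<close>

lemma ce_stages:
  assumes "ce W"
  shows "\<exists>St. decidable (\<lambda>t. t \<in> St) \<and> inj_on nfst St \<and> nfst ` St = W"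
proof -
  obtain \<phi> where "partial_computable \<phi>" and \<phi>: "W = dom \<phi>" using assms unfolding ce_def by auto
  then obtain G where G: "stage_approx \<phi> G" using partial_computable_stage_approx by auto
  \<comment> \<open>Asking for the first stage of convergence leaves exactly one pair per element of
    \<open>W\<close>.\<close>
  define St where "St = {t. G (nfst t) (nsnd t) \<noteq> 0 \<and> (\<forall>u<nsnd t. G (nfst t) u = 0)}"
  have "decidable (\<lambda>t. t \<in> St)"
    unfolding St_def mem_Collect_eq
    by (intro computable_intros stage_approx_computable[OF G])
  moreover have "inj_on nfst St"
  proof (rule inj_onI)
    fix s t assume st: "s \<in> St" "t \<in> St" "nfst s = nfst t"
    have "\<not> nsnd u < nsnd v" if "u \<in> St" "v \<in> St" "nfst u = nfst v" for u v
    proof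
      assume "nsnd u < nsnd v"
      then have "G (nfst v) (nsnd u) = 0" using that(2) by (simp add: St_def)
      then show False using that(1,3) by (simp add: St_def)
    qed
    from this[OF st] this[OF st(2,1) st(3)[symmetric]]
    have "\<not> nsnd s < nsnd t" "\<not> nsnd t < nsnd s" by simp_all
    then have "prod_decode s = prod_decode t" using st(3) by (simp add: prod_eq_iff)
    then show "s = t" by (simp add: prod_decode_eq)
  qed
  moreover have "nfst ` St = W"
  proof (intro set_eqI iffI)
    fix n assume "n \<in> nfst ` St"
    then obtain t where "n = nfst t" "G (nfst t) (nsnd t) \<noteq> 0" by (auto simp: St_def)
    then obtain v where "G n (nsnd t) = Suc v" using not0_implies_Suc by auto
    from stage_approx_SomeI[OF G this] show "n \<in> W" unfolding \<phi> by auto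
  next
    fix n assume "n \<in> W"
    then obtain v where "\<phi> n = Some v" unfolding \<phi> by auto
    then obtain s where "G n s = Suc v" using stage_approx_Some[OF G, of n v] by auto
    then have ex: "G n s \<noteq> 0" by simp
    define m where "m = (LEAST s. G n s \<noteq> 0)"
    have "G n m \<noteq> 0" unfolding m_def using ex by (rule LeastI)
    moreover have "G n u = 0" if "u < m" for u
      using not_less_Least[of u "\<lambda>s. G n s \<noteq> 0"] that unfolding m_def by simp
    ultimately have "prod_encode (n, m) \<in> St" by (simp add: St_def)
    then show "n \<in> nfst ` St" by (rule rev_image_eqI) simp
  qed
  ultimately show ?thesis by auto
qed

locale cohesive_stages =
  fixes C St :: "nat set"
  assumes cohesive: "cohesive C"
    and decidable_St: "decidable (\<lambda>t. t \<in> St)"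
    and inj_St: "inj_on nfst St"
    and image_St: "nfst ` St = - C"
begin

lemma infinite_C: "infinite C"
  using cohesive by (simp add: cohesive_def)

lemma not_eventually_False: "\<not> eventually (\<lambda>_. False) (germ C)"
  using infinite_C by (simp only: eventually_germ) simp

text \<open>Cohesiveness in filter form: on c.e. predicates \<open>germ C\<close> decides like an
  ultrafilter.\<close>

lemma ce_dichotomy:
  assumes "ce {n. P n}"
  shows "eventually P (germ C) \<or> eventually (\<lambda>n. \<not> P n) (germ C)"
proof -
  have "C - {n. P n} = {n \<in> C. \<not> P n}" "C \<inter> {n. P n} = {n \<in> C. P n}" by auto
  then show ?thesis using cohesive assms unfolding cohesive_def by (force simp: eventually_germ)
qed

lemma decidable_dichotomy:
  assumes "decidable P"
  shows "eventually P (germ C) \<or> eventually (\<lambda>n. \<not> P n) (germ C)"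
  using ce_dichotomy[of P] ce_ex[of "\<lambda>n _. P n"]
    decidable_comp[OF assms computable_nfst[OF computable_id]] by simp

lemma decidable_comp_St: "computable f \<Longrightarrow> decidable (\<lambda>n. f n \<in> St)"
  by (rule decidable_comp[OF decidable_St])

text \<open>Descending from \<open>k\<close>, each comparison is decidable and hence settled on
  almost all of \<open>C\<close>.\<close>

lemma bounded_eventually_const:
  assumes "computable f" "\<forall>\<^sub>F n in germ C. f n \<le> k"
  shows "\<exists>c\<le>k. \<forall>\<^sub>F n in germ C. f n = c"
  using assms(2)
proof (induction k)
  case (Suc k)
  have "decidable (\<lambda>n. f n \<le> k)" by (intro computable_intros assms(1))
  from decidable_dichotomy[OF this] show ?case
  proof
    assume "\<forall>\<^sub>F n in germ C. f n \<le> k"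
    then show ?thesis using Suc.IH le_SucI by metis
  next
    assume "\<forall>\<^sub>F n in germ C. \<not> f n \<le> k"
    with Suc.prems have "\<forall>\<^sub>F n in germ C. f n = Suc k" by eventually_elim simp
    then show ?thesis by auto
  qed
qed simp

section \<open>Standard and nonstandard germs\<close>

definition nonstandard :: "(nat \<Rightarrow> nat) \<Rightarrow> bool" where
  "nonstandard f \<longleftrightarrow> (\<forall>k. \<forall>\<^sub>F n in germ C. k < f n)"

lemma nonstandardD: "nonstandard f \<Longrightarrow> \<forall>\<^sub>F n in germ C. k < f n"
  by (simp add: nonstandard_def)

lemma standard_or_nonstandard:
  assumes "computable f"
  shows "(\<exists>c. \<forall>\<^sub>F n in germ C. f n = c) \<or> nonstandard f"
proof (cases "nonstandard f")
  case False
  then obtain k where k: "\<not> (\<forall>\<^sub>F n in germ C. k < f n)" by (auto simp: nonstandard_def)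
  have "decidable (\<lambda>n. k < f n)" by (intro computable_intros assms)
  then have "\<forall>\<^sub>F n in germ C. \<not> k < f n" using decidable_dichotomy k by auto
  then have "\<forall>\<^sub>F n in germ C. f n \<le> k" by (simp add: not_less)
  then show ?thesis using bounded_eventually_const[OF assms] by auto
qed simp

lemma nonstandard_not_const: "nonstandard f \<Longrightarrow> \<not> (\<forall>\<^sub>F n in germ C. f n = c)"
proof
  assume f: "nonstandard f" and c: "\<forall>\<^sub>F n in germ C. f n = c"
  have "\<forall>\<^sub>F n in germ C. False" using nonstandardD[OF f, of c] c by eventually_elim simp
  then show False using not_eventually_False by simp
qed

lemma nonstandard_mono:
  assumes "nonstandard f" "\<forall>\<^sub>F n in germ C. f n \<le> g n"
  shows "nonstandard g"
  unfolding nonstandard_def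
proof
  fix k
  show "\<forall>\<^sub>F n in germ C. k < g n"
    using nonstandardD[OF assms(1), of k] assms(2) by eventually_elim simp
qed

lemma nonstandard_id: "nonstandard (\<lambda>n. n)"
  unfolding nonstandard_def eventually_germ_ge
proof
  fix k
  show "\<exists>N. \<forall>n\<ge>N. n \<in> C \<longrightarrow> k < n" by (intro exI[of _ "Suc k"]) auto
qed

lemma nonstandard_div2:
  assumes "nonstandard f"
  shows "nonstandard (\<lambda>n. f n div 2)"
  unfolding nonstandard_def
proof
  fix k
  show "\<forall>\<^sub>F n in germ C. k < f n div 2"
    using nonstandardD[OF assms, of "2 * k + 2"] by eventually_elim linarith
qed

lemma mem_C_iff: "i \<in> C \<longleftrightarrow> \<not> (\<exists>t\<in>St. nfst t = i)"
proof -
  have "i \<in> - C \<longleftrightarrow> i \<in> nfst ` St" by (simp only: image_St)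
  then show ?thesis by auto
qed

text \<open>Being a record of \<open>g\<close> along \<open>C\<close> is a c.e. property because
  \<open>i \<notin> C\<close> is one, and records recur infinitely often because \<open>g\<close> is
  unbounded on \<open>C\<close>. By cohesiveness almost every element of \<open>C\<close> is then a
  record.\<close>

lemma nonstandard_increasing:
  assumes g: "computable g" "nonstandard g"
  shows "\<forall>\<^sub>F n in germ C. \<forall>i<n. i \<in> C \<longrightarrow> g i < g n"
proof -
  let ?B = "\<lambda>n. \<forall>i<n. i \<in> C \<longrightarrow> g i < g n"
  \<comment> \<open>A single \<open>u\<close> bounds the stages needed for all \<open>i < n\<close>,
    which turns the property into one unbounded search over a decidable matrix.\<close>
  let ?P = "\<lambda>n u. \<forall>i<n. g i < g n \<or> (\<exists>t<u. t \<in> St \<and> nfst t = i)"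
  have eq: "?B n \<longleftrightarrow> (\<exists>u. ?P n u)" for n
  proof
    assume B: "?B n"
    have "\<exists>u. \<forall>i<m. g i < g n \<or> (\<exists>t<u. t \<in> St \<and> nfst t = i)" if "m \<le> n" for m
      using that
    proof (induction m)
      case (Suc m)
      then obtain u where u: "\<forall>i<m. g i < g n \<or> (\<exists>t<u. t \<in> St \<and> nfst t = i)" by auto
      have "g m < g n \<or> (\<exists>t\<in>St. nfst t = m)" using B Suc.prems mem_C_iff by auto
      then obtain t where t: "g m < g n \<or> (t \<in> St \<and> nfst t = m)" by auto
      show ?case
      proof (intro exI allI impI)
        fix i assume "i < Suc m"
        then consider "i = m" | "i < m" by linarith
        then show "g i < g n \<or> (\<exists>t'<max u (Suc t). t' \<in> St \<and> nfst t' = i)"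
        proof cases
          case 1
          then show ?thesis using t by (auto intro: exI[of _ t])
        next
          case 2
          then show ?thesis using u by (meson less_max_iff_disj)
        qed
      qed
    qed simp
    then show "\<exists>u. ?P n u" by simp
  next
    assume "\<exists>u. ?P n u"
    then show "?B n" using mem_C_iff by auto
  qed
  have "decidable (\<lambda>p. ?P (nfst p) (nsnd p))"
    by (intro computable_intros decidable_comp_St computable_comp[OF g(1)])
  then have "ce {n. ?B n}" unfolding eq by (rule ce_ex)
  then have "eventually ?B (germ C) \<or> eventually (\<lambda>n. \<not> ?B n) (germ C)" by (rule ce_dichotomy)
  moreover have "\<not> eventually (\<lambda>n. \<not> ?B n) (germ C)"
  proof
    assume "eventually (\<lambda>n. \<not> ?B n) (germ C)"
    then obtain N where N: "\<And>n. n \<ge> N \<Longrightarrow> n \<in> C \<Longrightarrow> \<not> ?B n"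
      unfolding eventually_germ_ge by blast
    \<comment> \<open>An upper bound of \<open>g\<close> up to \<open>N\<close>: the first element
      of \<open>C\<close> at which \<open>g\<close> exceeds it is a record, yet lies beyond
      \<open>N\<close>.\<close>
    define k where "k = (\<Sum>i\<le>N. g i)"
    obtain M where M: "\<And>n. n \<ge> M \<Longrightarrow> n \<in> C \<Longrightarrow> k < g n"
      using nonstandardD[OF g(2), of k] unfolding eventually_germ_ge by blast
    obtain n0 where "n0 \<ge> M" "n0 \<in> C"
      using infinite_C infinite_nat_iff_unbounded_le by blast
    then have ex: "n0 \<in> C \<and> k < g n0" using M by simp
    define n where "n = (LEAST n. n \<in> C \<and> k < g n)"
    have n: "n \<in> C" "k < g n" unfolding n_def using LeastI[of "\<lambda>n. n \<in> C \<and> k < g n", OF ex] by auto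
    have "?B n"
    proof (intro allI impI)
      fix i assume "i < n" "i \<in> C"
      then have "\<not> k < g i" unfolding n_def using not_less_Least by blast
      then show "g i < g n" using n(2) by simp
    qed
    then have "n < N" using N n(1) not_less by blast
    then have "g n \<le> k" unfolding k_def by (intro member_le_sum) auto
    then show False using n(2) by simp
  qed
  ultimately show ?thesis by simp
qed

lemma card_le_nonstandard:
  assumes g: "computable g" "nonstandard g"
  shows "\<forall>\<^sub>F n in germ C. card (C \<inter> {..<n}) \<le> g n"
proof -
  \<comment> \<open>Halving makes room: injectivity from \<open>N\<close> on bounds the rank by
    \<open>N + g n div 2\<close>, and the other half of \<open>g n\<close> absorbs
    \<open>N\<close>.\<close>
  have "nonstandard (\<lambda>n. g n div 2)" by (rule nonstandard_div2[OF g(2)])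
  moreover have "computable (\<lambda>n. g n div 2)" by (intro computable_intros g(1))
  ultimately obtain N where N: "\<And>n i. n \<ge> N \<Longrightarrow> n \<in> C \<Longrightarrow> i < n \<Longrightarrow> i \<in> C \<Longrightarrow> g i div 2 < g n div 2"
    using nonstandard_increasing[of "\<lambda>n. g n div 2"] unfolding eventually_germ_ge by blast
  have le: "card (C \<inter> {..<n}) \<le> N + g n div 2" if n: "n \<ge> N" "n \<in> C" for n
  proof -
    have "C \<inter> {..<n} \<subseteq> {..<N} \<union> (C \<inter> {N..<n})" by auto
    then have "card (C \<inter> {..<n}) \<le> card ({..<N} \<union> (C \<inter> {N..<n}))" by (intro card_mono) auto
    also have "\<dots> \<le> N + card (C \<inter> {N..<n})" using card_Un_le[of "{..<N}"] by simp
    also have "card (C \<inter> {N..<n}) \<le> card {..<g n div 2}"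
    proof (rule card_inj_on_le)
      show "inj_on (\<lambda>i. g i div 2) (C \<inter> {N..<n})"
      proof (rule inj_onI, rule ccontr)
        fix x y assume xy: "x \<in> C \<inter> {N..<n}" "y \<in> C \<inter> {N..<n}" "g x div 2 = g y div 2" "x \<noteq> y"
        then consider "x < y" | "y < x" by linarith
        then show False using xy N[of y x] N[of x y] by cases auto
      qed
      show "(\<lambda>i. g i div 2) ` (C \<inter> {N..<n}) \<subseteq> {..<g n div 2}" using N n by auto
    qed simp
    finally show ?thesis by simp
  qed
  then have "\<forall>\<^sub>F n in germ C. card (C \<inter> {..<n}) \<le> N + g n div 2"
    unfolding eventually_germ_ge by auto
  then show ?thesis using nonstandardD[OF g(2), of "2 * N + 2"] by eventually_elim linarith
qed

section \<open>Stages and their restraints\<close>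

definition restraint :: "nat \<Rightarrow> nat" where
  "restraint t = card {i. i < nfst t \<and> \<not> (\<exists>s\<le>t. s \<in> St \<and> nfst s = i)}"

lemma computable_restraint: "computable f \<Longrightarrow> computable (\<lambda>n. restraint (f n))"
proof (rule computable_comp[of restraint])
  show "computable restraint"
    unfolding restraint_def by (intro computable_intros decidable_comp_St)
qed

text \<open>Elements of \<open>C\<close> are never enumerated, so a stage whose number lies above
  \<open>k + 1\<close> of them has restraint beyond \<open>k\<close>; and each number has only one
  stage.\<close>

lemma finite_restraint_le: "finite {t\<in>St. restraint t \<le> k}"
proof -
  obtain T where T: "T \<subseteq> C" "finite T" "card T = Suc k"
    using infinite_arbitrarily_large[OF infinite_C] by blast
  obtain b where b: "\<And>x. x \<in> T \<Longrightarrow> x < b" using T(2) finite_nat_set_iff_bounded by auto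
  have "nfst t < b" if t: "t \<in> St" "restraint t \<le> k" for t
  proof (rule ccontr)
    assume "\<not> nfst t < b"
    then have "T \<subseteq> {i. i < nfst t \<and> \<not> (\<exists>s\<le>t. s \<in> St \<and> nfst s = i)}"
      using b T(1) mem_C_iff by fastforce
    then have "card T \<le> restraint t" unfolding restraint_def by (intro card_mono) auto
    then show False using T(3) t(2) by simp
  qed
  then have "nfst ` {t\<in>St. restraint t \<le> k} \<subseteq> {..<b}" by auto
  then have "finite (nfst ` {t\<in>St. restraint t \<le> k})" by (rule finite_subset) simp
  moreover have "inj_on nfst {t\<in>St. restraint t \<le> k}" by (rule inj_on_subset[OF inj_St]) auto
  ultimately show ?thesis by (simp add: finite_image_iff)
qed

text \<open>If the stages after \<open>f n\<close> were all restrained beyond \<open>g n\<close>, then \<open>C\<close> below \<open>n\<close> would be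
  known at stage \<open>f n\<close>, and the parity of the rank of \<open>n\<close> in \<open>C\<close> would split \<open>C\<close>.\<close>

lemma eventually_unrestrained_stage:
  assumes f: "computable f" and g: "computable g" "nonstandard g"
  shows "\<forall>\<^sub>F n in germ C. \<exists>t\<in>St. f n \<le> t \<and> restraint t \<le> g n"
proof -
  let ?B = "\<lambda>n. \<exists>t\<in>St. f n \<le> t \<and> restraint t \<le> g n"
  have "decidable (\<lambda>p. nsnd p \<in> St \<and> f (nfst p) \<le> nsnd p \<and> restraint (nsnd p) \<le> g (nfst p))"
    by (intro computable_intros decidable_comp_St computable_restraint computable_comp[OF f]
        computable_comp[OF g(1)])
  from ce_ex[OF this[simplified]] have "ce {n. ?B n}" by (simp add: Bex_def)
  then have "eventually ?B (germ C) \<or> eventually (\<lambda>n. \<not> ?B n) (germ C)" by (rule ce_dichotomy)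
  moreover have "\<not> eventually (\<lambda>n. \<not> ?B n) (germ C)"
  proof
    assume nB: "eventually (\<lambda>n. \<not> ?B n) (germ C)"
    \<comment> \<open>The rank of \<open>n\<close> in \<open>C\<close> as guessed at stage
      \<open>f n\<close>; under the assumption this guess is almost always correct.\<close>
    define h where "h n = card {i. i < n \<and> \<not> (\<exists>s<f n. s \<in> St \<and> nfst s = i)}" for n
    have h: "computable h"
      unfolding h_def by (intro computable_intros decidable_comp_St computable_comp[OF f])
    have rank: "\<forall>\<^sub>F n in germ C. h n = card (C \<inter> {..<n})"
      using nB card_le_nonstandard[OF g]
    proof eventually_elim
      case (elim n)
      have "\<exists>s<f n. s \<in> St \<and> nfst s = i" if i: "i < n" "i \<notin> C" for i
      proof (rule ccontr)
        assume not: "\<not> (\<exists>s<f n. s \<in> St \<and> nfst s = i)"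
        let ?T = "{t\<in>St. f n \<le> t \<and> nfst t < n}"
        have "finite (nfst ` ?T)" by (rule finite_subset[of _ "{..<n}"]) auto
        moreover have "inj_on nfst ?T" by (rule inj_on_subset[OF inj_St]) auto
        ultimately have fin: "finite ?T" by (simp add: finite_image_iff)
        obtain s where "s \<in> St" "nfst s = i" using i(2) mem_C_iff by auto
        then have "s \<in> ?T" using not i(1) by auto
        \<comment> \<open>After the last stage that concerns a number below \<open>n\<close>,
          everything still present below that number stays forever. Its restraint thus counts
          elements of \<open>C\<close> only and is at most the rank of \<open>n\<close>, hence at
          most \<open>g n\<close>, contrary to the assumption.\<close>
        define t where "t = Max ?T"
        have t: "t \<in> ?T" unfolding t_def using fin \<open>s \<in> ?T\<close> by (intro Max_in) auto
        have "{i. i < nfst t \<and> \<not> (\<exists>s\<le>t. s \<in> St \<and> nfst s = i)} \<subseteq> C \<inter> {..<n}"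
        proof
          fix j assume j: "j \<in> {i. i < nfst t \<and> \<not> (\<exists>s\<le>t. s \<in> St \<and> nfst s = i)}"
          have "j \<in> C"
          proof (rule ccontr)
            assume "j \<notin> C"
            then obtain u where u: "u \<in> St" "nfst u = j" using mem_C_iff by auto
            then have "t < u" using j not_less by auto
            then have "u \<in> ?T" using t u j by auto
            then have "u \<le> t" unfolding t_def using fin by simp
            then show False using \<open>t < u\<close> by simp
          qed
          then show "j \<in> C \<inter> {..<n}" using j t by auto
        qed
        then have "restraint t \<le> card (C \<inter> {..<n})"
          unfolding restraint_def by (intro card_mono) auto
        then show False using elim t by auto
      qed
      then have "(\<exists>s<f n. s \<in> St \<and> nfst s = i) \<longleftrightarrow> i \<notin> C" if "i < n" for i
        using that mem_C_iff[of i] by blast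
      then have "{i. i < n \<and> \<not> (\<exists>s<f n. s \<in> St \<and> nfst s = i)} = C \<inter> {..<n}"
        by auto
      then show "h n = card (C \<inter> {..<n})" by (simp add: h_def)
    qed
    have "decidable (\<lambda>n. h n mod 2 = 0)" by (intro computable_intros h)
    from decidable_dichotomy[OF this]
    obtain b where "\<forall>\<^sub>F n in germ C. even (h n) = b"
    proof
      assume "\<forall>\<^sub>F n in germ C. h n mod 2 = 0"
      then show ?thesis by (intro that[of True]) (simp add: even_iff_mod_2_eq_zero)
    next
      assume "\<forall>\<^sub>F n in germ C. h n mod 2 \<noteq> 0"
      then show ?thesis by (intro that[of False]) (simp add: even_iff_mod_2_eq_zero)
    qed
    with rank have "\<forall>\<^sub>F n in germ C. even (card (C \<inter> {..<n})) = b"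
      by eventually_elim simp
    then obtain N where N: "\<And>n. n \<ge> N \<Longrightarrow> n \<in> C \<Longrightarrow> even (card (C \<inter> {..<n})) = b"
      unfolding eventually_germ_ge by blast
    obtain m where m: "m \<ge> N" "m \<in> C"
      using infinite_C infinite_nat_iff_unbounded_le by blast
    \<comment> \<open>The next element of \<open>C\<close> after \<open>m\<close>: its rank is
      larger by one and so has the other parity.\<close>
    define m' where "m' = (LEAST k. k \<in> C \<and> m < k)"
    obtain k where "k > m" "k \<in> C"
      using infinite_C infinite_nat_iff_unbounded by blast
    then have m': "m' \<in> C" "m < m'"
      unfolding m'_def using LeastI[of "\<lambda>k. k \<in> C \<and> m < k" k] by auto
    have "i \<notin> C" if "m < i" "i < m'" for i
      using that not_less_Least[of i "\<lambda>k. k \<in> C \<and> m < k"] unfolding m'_def by auto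
    then have "C \<inter> {..<m'} = insert m (C \<inter> {..<m})"
      using m m' by (auto simp: not_less) (metis linorder_neqE_nat)
    then have "card (C \<inter> {..<m'}) = Suc (card (C \<inter> {..<m}))" by simp
    then show False using N[of m] N[of m'] m m' by auto
  qed
  ultimately show ?thesis by simp
qed

text \<open>Waiting until \<open>\<phi> n\<close> converges or \<open>n\<close> is seen to leave
  \<open>C\<close> always ends, apart from finitely many exceptions, which are hardwired as
  \<open>E\<close>. When no value has been found, the default \<open>a\<close> keeps the result in
  \<open>A\<close>.\<close>

lemma total_extension:
  assumes "partial_computable \<phi>" "C \<subseteq>\<^sup>* dom \<phi>" "ran \<phi> \<subseteq> A" "a \<in> A"
  shows "\<exists>f. computable f \<and> (\<forall>n. f n \<in> A) \<and> (\<forall>\<^sub>F n in germ C. \<phi> n = Some (f n))"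
proof -
  obtain G where G: "stage_approx \<phi> G" using partial_computable_stage_approx[OF assms(1)] by auto
  define E where "E = C - dom \<phi>"
  have fin: "finite E" using assms(2) by (simp add: E_def almost_subset_def)
  define Q where "Q n s \<longleftrightarrow> G n s \<noteq> 0 \<or> n \<in> E \<or> (s \<in> St \<and> nfst s = n)" for n s
  define f where "f n = (if G n (LEAST s. Q n s) = 0 then a else G n (LEAST s. Q n s) - 1)" for n
  have Q: "decidable (\<lambda>p. Q (nfst p) (nsnd p))"
    unfolding Q_def
    by (intro computable_intros stage_approx_computable[OF G] decidable_comp_St
        decidable_comp[OF decidable_mem_finite[OF fin]])
  have ex: "\<exists>s. Q n s" for n
  proof (cases "n \<in> C \<and> n \<in> dom \<phi>")
    case True
    then obtain v where "\<phi> n = Some v" by auto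
    then obtain s where "G n s = Suc v" using stage_approx_Some[OF G, of n v] by auto
    then show ?thesis by (intro exI[of _ s]) (simp add: Q_def)
  next
    case False
    then consider "n \<in> E" | "n \<notin> C" by (auto simp: E_def)
    then show ?thesis using mem_C_iff by cases (auto simp: Q_def)
  qed
  have "computable f"
    unfolding f_def
    by (intro computable_intros stage_approx_computable[OF G] computable_LEAST[OF Q ex])
  moreover have "f n \<in> A" for n
  proof (cases "G n (LEAST s. Q n s)")
    case (Suc v)
    from stage_approx_SomeI[OF G this] have "v \<in> ran \<phi>" by (auto simp: ran_def)
    then show ?thesis using Suc assms(3) by (auto simp: f_def)
  qed (simp add: f_def assms(4))
  moreover have "\<forall>\<^sub>F n in germ C. \<phi> n = Some (f n)"
  proof -
    have "\<phi> n = Some (f n)" if "n \<in> C" "n \<notin> E" for n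
    proof -
      have "Q n (LEAST s. Q n s)" using ex by (rule LeastI_ex)
      then have "G n (LEAST s. Q n s) \<noteq> 0" using that mem_C_iff by (auto simp: Q_def)
      then obtain v where v: "G n (LEAST s. Q n s) = Suc v" using not0_implies_Suc by auto
      then have "f n = v" by (simp add: f_def)
      then show ?thesis using stage_approx_SomeI[OF G v] by simp
    qed
    then have "{n \<in> C. \<phi> n \<noteq> Some (f n)} \<subseteq> E" by auto
    then show ?thesis unfolding eventually_germ using fin by (rule finite_subset)
  qed
  ultimately show ?thesis by auto
qed

text \<open>Unbounded search yields a partial function defined on almost all of \<open>C\<close>,
  which \<open>total_extension\<close> makes total; existential statements thus get computable
  witnesses along \<open>C\<close>.\<close>

lemma search:
  assumes P: "decidable (\<lambda>p. P (nfst p) (nsnd p))" and ex: "\<forall>\<^sub>F n in germ C. \<exists>y. P n y"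
    and A: "\<And>n y. P n y \<Longrightarrow> y \<in> A" and a: "a \<in> A"
  shows "\<exists>f. computable f \<and> (\<forall>n. f n \<in> A) \<and> (\<forall>\<^sub>F n in germ C. P n (f n))"
proof -
  let ?\<phi> = "\<lambda>n. if \<exists>y. P n y then Some (LEAST y. P n y) else None"
  have least: "P n (LEAST y. P n y)" if "\<exists>y. P n y" for n using that by (rule LeastI_ex)
  have "dom ?\<phi> = {n. \<exists>y. P n y}" by (auto split: if_splits)
  then have "C \<subseteq>\<^sup>* dom ?\<phi>" using ex by (simp add: almost_subset_eventually)
  moreover have "ran ?\<phi> \<subseteq> A" using least A by (auto simp: ran_def split: if_splits)
  ultimately obtain f where f: "computable f" "\<And>n. f n \<in> A" "\<forall>\<^sub>F n in germ C. ?\<phi> n = Some (f n)"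
    using total_extension[OF partial_computable_search[OF P] _ _ a] by auto
  have "\<forall>\<^sub>F n in germ C. P n (f n)"
    using ex f(3)
  proof eventually_elim
    case (elim n)
    then show ?case using least[OF elim(1)] by (metis option.inject)
  qed
  with f show ?thesis by auto
qed

end

section \<open>Order-types of sets of germs\<close>

text \<open>These properties of a target order force incomparable representatives to have the same
  image.\<close>

definition strict_total :: "'a lorder \<Rightarrow> bool" where
  "strict_total N \<longleftrightarrow> (\<forall>x. (x, x) \<notin> snd N) \<and>
     (\<forall>x\<in>fst N. \<forall>y\<in>fst N. x \<noteq> y \<longrightarrow> (x, y) \<in> snd N \<or> (y, x) \<in> snd N)"

lemma strict_totalD:
  assumes "strict_total N"
  shows "(x, x) \<notin> snd N"
    and "x \<in> fst N \<Longrightarrow> y \<in> fst N \<Longrightarrow> x \<noteq> y \<Longrightarrow> (x, y) \<in> snd N \<or> (y, x) \<in> snd N"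
  using assms by (simp_all add: strict_total_def)

lemma strict_total_sum:
  assumes M: "strict_total M" and N: "strict_total N" shows "strict_total (M \<oplus> N)"
  unfolding strict_total_def
proof (intro conjI allI ballI impI)
  show "(x, x) \<notin> snd (M \<oplus> N)" for x
    using strict_totalD(1)[OF M] strict_totalD(1)[OF N] by (auto simp: order_sum_def)
  fix x y assume xy: "x \<in> fst (M \<oplus> N)" "y \<in> fst (M \<oplus> N)" "x \<noteq> y"
  show "(x, y) \<in> snd (M \<oplus> N) \<or> (y, x) \<in> snd (M \<oplus> N)"
  proof (cases x; cases y)
    fix a b assume "x = Inl a" "y = Inl b"
    then show ?thesis using xy strict_totalD(2)[OF M, of a b] by (auto simp: order_sum_def)
  next
    fix a b assume "x = Inr a" "y = Inr b"
    then show ?thesis using xy strict_totalD(2)[OF N, of a b] by (auto simp: order_sum_def)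
  qed (use xy in \<open>auto simp: order_sum_def\<close>)
qed

lemma strict_total_lex_sum_eta:
  assumes "\<And>r. strict_total (A r)" shows "strict_total (lex_sum eta A)"
  unfolding strict_total_def
proof (intro conjI allI ballI impI)
  show "(x, x) \<notin> snd (lex_sum eta A)" for x
    using strict_totalD(1)[OF assms] by (auto simp: lex_sum_def eta_def)
  fix x y assume xy: "x \<in> fst (lex_sum eta A)" "y \<in> fst (lex_sum eta A)" "x \<noteq> y"
  obtain p a q b where "x = (p, a)" "y = (q, b)" by (cases x; cases y) auto
  then show "(x, y) \<in> snd (lex_sum eta A) \<or> (y, x) \<in> snd (lex_sum eta A)"
    using xy strict_totalD(2)[OF assms, of a p b]
    by (cases p q rule: linorder_cases) (auto simp: lex_sum_def eta_def)
qed

lemma strict_total_copy: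
  assumes "inj f" "strict_total N" shows "strict_total (copy f N)"
proof -
  have iff: "(f a, f b) \<in> map_prod f f ` snd N \<longleftrightarrow> (a, b) \<in> snd N" for a b
    using assms(1) by (force simp: inj_eq)
  have "(x, x) \<notin> map_prod f f ` snd N" for x
  proof
    assume x: "(x, x) \<in> map_prod f f ` snd N"
    then obtain a where "x = f a" by auto
    then show False using x iff assms(2) by (simp add: strict_total_def)
  qed
  moreover have "(x, y) \<in> map_prod f f ` snd N \<or> (y, x) \<in> map_prod f f ` snd N"
    if xy: "x \<in> f ` fst N" "y \<in> f ` fst N" "x \<noteq> y" for x y
  proof -
    obtain a where a: "a \<in> fst N" "x = f a" using xy(1) by auto
    obtain b where b: "b \<in> fst N" "y = f b" using xy(2) by auto
    have "a \<noteq> b" using a(2) b(2) xy(3) by auto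
    then show ?thesis using strict_totalD(2)[OF assms(2) a(1) b(1)] unfolding a(2) b(2) iff by simp
  qed
  ultimately show ?thesis by (simp add: strict_total_def copy_def)
qed

lemma strict_total_basic:
  "strict_total omega" "strict_total (reverse omega)" "strict_total zeta" "strict_total (finite_type k)"
  by (auto simp: strict_total_def omega_def reverse_def zeta_def finite_type_def)

lemma strict_total_alpha: "strict_total alpha"
  unfolding alpha_def
  by (intro strict_total_sum strict_total_lex_sum_eta strict_total_basic)

lemma strict_total_finite_types_and_alpha:
  "N \<in> finite_types_and_alpha X \<Longrightarrow> strict_total N"
  unfolding finite_types_and_alpha_def
  using strict_total_copy[OF inj_Inl strict_total_basic(4)] strict_total_copy[OF inj_Inr strict_total_alpha]
  by auto

lemma presents_cong:
  assumes "presents S lt N F" "strict_total N" "x \<in> S" "y \<in> S" "\<not> lt x y" "\<not> lt y x"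
  shows "F x = F y"
proof -
  have "F x \<in> fst N" "F y \<in> fst N" "(F x, F y) \<notin> snd N" "(F y, F x) \<notin> snd N"
    using assms unfolding presents_def by auto
  then show ?thesis using assms(2) unfolding strict_total_def by auto
qed

text \<open>It is enough that \<open>r\<close> is onto up to incomparability, since \<open>F\<close>
  identifies incomparable elements.\<close>

lemma presents_comp:
  assumes F: "presents S lt N F" and N: "strict_total N"
    and r: "\<And>x. x \<in> T \<Longrightarrow> r x \<in> S"
    and lt: "\<And>x y. x \<in> T \<Longrightarrow> y \<in> T \<Longrightarrow> lt' x y \<longleftrightarrow> lt (r x) (r y)"
    and onto: "\<And>s. s \<in> S \<Longrightarrow> \<exists>x\<in>T. \<not> lt s (r x) \<and> \<not> lt (r x) s"
  shows "presents T lt' N (\<lambda>x. F (r x))"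
  unfolding presents_def
proof
  show "(\<lambda>x. F (r x)) ` T = fst N"
  proof (intro set_eqI iffI)
    fix a assume "a \<in> (\<lambda>x. F (r x)) ` T"
    then show "a \<in> fst N" using F r by (auto simp: presents_def)
  next
    fix a assume "a \<in> fst N"
    then have "a \<in> F ` S" using F by (simp add: presents_def)
    then obtain s where s: "s \<in> S" "F s = a" by auto
    obtain x where x: "x \<in> T" "\<not> lt s (r x)" "\<not> lt (r x) s" using onto[OF s(1)] by auto
    have "F s = F (r x)" by (rule presents_cong[OF F N s(1) r[OF x(1)] x(2,3)])
    then show "a \<in> (\<lambda>x. F (r x)) ` T" using x(1) s(2) by auto
  qed
  show "\<forall>x\<in>T. \<forall>y\<in>T. lt' x y \<longleftrightarrow> (F (r x), F (r y)) \<in> snd N"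
    using F r lt by (simp add: presents_def)
qed

context cohesive_stages
begin

section \<open>Initial segments of the germs of computable functions\<close>

definition germ_less :: "(nat \<Rightarrow> nat) \<Rightarrow> (nat \<Rightarrow> nat) \<Rightarrow> bool" where
  "germ_less f g \<longleftrightarrow> (\<forall>\<^sub>F n in germ C. f n < g n)"

text \<open>The model of a single block: its elements are named by their positions, which range
  below the size \<open>\<sigma>\<close>.\<close>

definition germs_below :: "(nat \<Rightarrow> nat) \<Rightarrow> (nat \<Rightarrow> nat) set" where
  "germs_below \<sigma> = {\<rho>. computable \<rho> \<and> (\<forall>\<^sub>F n in germ C. \<rho> n < \<sigma> n)}"

definition std :: "(nat \<Rightarrow> nat) \<Rightarrow> nat" where
  "std f = (SOME c. \<forall>\<^sub>F n in germ C. f n = c)"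

lemma std_unique:
  assumes "\<forall>\<^sub>F n in germ C. f n = c" "\<forall>\<^sub>F n in germ C. f n = d" shows "c = d"
proof (rule ccontr)
  assume "c \<noteq> d"
  have "\<forall>\<^sub>F n in germ C. False" using assms by eventually_elim (use \<open>c \<noteq> d\<close> in simp)
  then show False using not_eventually_False by simp
qed

lemma std_eq: "\<forall>\<^sub>F n in germ C. f n = c \<Longrightarrow> std f = c"
  unfolding std_def using someI[of "\<lambda>c. \<forall>\<^sub>F n in germ C. f n = c" c] std_unique by auto

lemma eventually_std:
  assumes "computable f" "\<not> nonstandard f" shows "\<forall>\<^sub>F n in germ C. f n = std f"
proof -
  obtain c where c: "\<forall>\<^sub>F n in germ C. f n = c" using standard_or_nonstandard assms by auto
  then show ?thesis using std_eq[OF c] by simp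
qed

lemma eventually_const_iff: "(\<forall>\<^sub>F n in germ C. P) \<longleftrightarrow> P"
  using not_eventually_False by (cases P) simp_all

lemma germ_less_irrefl: "\<not> germ_less f f"
  using not_eventually_False by (simp add: germ_less_def)

lemma not_germ_less_eq: "\<forall>\<^sub>F n in germ C. f n = g n \<Longrightarrow> \<not> germ_less f g"
proof
  assume "\<forall>\<^sub>F n in germ C. f n = g n" "germ_less f g"
  then have "\<forall>\<^sub>F n in germ C. False" unfolding germ_less_def by eventually_elim simp
  then show False using not_eventually_False by simp
qed

lemma germ_less_asym: "germ_less f g \<Longrightarrow> \<not> germ_less g f"
proof
  assume "germ_less f g" "germ_less g f"
  then have "\<forall>\<^sub>F n in germ C. False" unfolding germ_less_def by eventually_elim simp
  then show False using not_eventually_False by simp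
qed

lemma germ_less_cong:
  assumes "\<forall>\<^sub>F n in germ C. f n = f' n" "\<forall>\<^sub>F n in germ C. g n = g' n" "germ_less f g"
  shows "germ_less f' g'"
  using assms unfolding germ_less_def by eventually_elim simp

lemma standard_less_nonstandard:
  assumes "\<forall>\<^sub>F n in germ C. f n = c" "nonstandard g" shows "germ_less f g"
  unfolding germ_less_def using assms(1) nonstandardD[OF assms(2), of c] by eventually_elim simp

lemma germ_less_const: "germ_less (\<lambda>_. c) (\<lambda>_. d) \<longleftrightarrow> c < d"
  by (simp add: germ_less_def eventually_const_iff)

lemma germ_less_std:
  assumes "\<forall>\<^sub>F n in germ C. f n = c" "\<forall>\<^sub>F n in germ C. g n = d"
  shows "germ_less f g \<longleftrightarrow> c < d"
proof -
  have "germ_less f g \<longleftrightarrow> germ_less (\<lambda>_. c) (\<lambda>_. d)"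
    using germ_less_cong[OF assms] germ_less_cong[of "\<lambda>_. c" f "\<lambda>_. d" g] assms
    by (metis (mono_tags, lifting) eventually_mono)
  then show ?thesis by (simp only: germ_less_const)
qed

lemma presents_standard_germs:
  "presents {f. computable f \<and> \<not> nonstandard f} germ_less omega std"
  unfolding presents_def
proof
  have "c \<in> std ` {f. computable f \<and> \<not> nonstandard f}" for c
  proof
    show "c = std (\<lambda>_. c)" by (rule std_eq[symmetric]) simp
    show "(\<lambda>_. c) \<in> {f. computable f \<and> \<not> nonstandard f}"
      using nonstandard_not_const[of "\<lambda>_. c" c] by (auto intro: computable_const)
  qed
  then show "std ` {f. computable f \<and> \<not> nonstandard f} = fst omega" by (auto simp: omega_def)
  show "\<forall>x\<in>{f. computable f \<and> \<not> nonstandard f}. \<forall>y\<in>{f. computable f \<and> \<not> nonstandard f}.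
      germ_less x y \<longleftrightarrow> (std x, std y) \<in> snd omega"
    using germ_less_std[OF eventually_std eventually_std] by (simp add: omega_def)
qed

lemma presents_finite_germs:
  assumes "\<forall>\<^sub>F n in germ C. \<sigma> n = k"
  shows "presents (germs_below \<sigma>) germ_less (finite_type k) std"
  unfolding presents_def
proof
  have std: "\<forall>\<^sub>F n in germ C. f n = std f" "std f < k" if f: "f \<in> germs_below \<sigma>" for f
  proof -
    have lt: "\<forall>\<^sub>F n in germ C. f n < \<sigma> n" "computable f" using f by (auto simp: germs_below_def)
    have le: "\<forall>\<^sub>F n in germ C. f n \<le> k"
      using lt(1) assms by eventually_elim simp
    obtain c where c: "\<forall>\<^sub>F n in germ C. f n = c" using bounded_eventually_const[OF lt(2) le] by auto
    then show "\<forall>\<^sub>F n in germ C. f n = std f" using std_eq[OF c] by simp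
    have "\<forall>\<^sub>F n in germ C. c < k" using c lt(1) assms by eventually_elim simp
    then show "std f < k" using std_eq[OF c] by (simp add: eventually_const_iff)
  qed
  have "c \<in> std ` germs_below \<sigma>" if "c < k" for c
  proof
    show "c = std (\<lambda>_. c)" by (rule std_eq[symmetric]) simp
    have "\<forall>\<^sub>F n in germ C. c < \<sigma> n" using assms by eventually_elim (simp add: that)
    then show "(\<lambda>_. c) \<in> germs_below \<sigma>" by (simp add: germs_below_def computable_const)
  qed
  then show "std ` germs_below \<sigma> = fst (finite_type k)"
    using std(2) by (auto simp: finite_type_def)
  show "\<forall>x\<in>germs_below \<sigma>. \<forall>y\<in>germs_below \<sigma>. germ_less x y \<longleftrightarrow> (std x, std y) \<in> snd (finite_type k)"
    using germ_less_std[OF std(1) std(1)] std(2) by (simp add: finite_type_def)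
qed

text \<open>Positions are counted from the top; the greatest germ \<open>\<sigma> - 1\<close>
  receives 0, hence the \<open>Suc\<close>.\<close>

lemma presents_costandard_germs:
  assumes \<sigma>: "computable \<sigma>" "nonstandard \<sigma>"
  defines "T \<equiv> {\<rho> \<in> germs_below \<sigma>. \<not> nonstandard (\<lambda>n. \<sigma> n - \<rho> n)}"
  shows "presents T germ_less (reverse omega) (\<lambda>\<rho>. std (\<lambda>n. \<sigma> n - Suc (\<rho> n)))"
  unfolding presents_def
proof
  let ?std = "\<lambda>\<rho>. std (\<lambda>n. \<sigma> n - Suc (\<rho> n))"
  have ev: "\<forall>\<^sub>F n in germ C. \<sigma> n = Suc (\<rho> n + ?std \<rho>)" if "\<rho> \<in> T" for \<rho>
  proof -
    have \<rho>: "computable \<rho>" "\<forall>\<^sub>F n in germ C. \<rho> n < \<sigma> n" "\<not> nonstandard (\<lambda>n. \<sigma> n - \<rho> n)"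
      using that by (auto simp: T_def germs_below_def)
    have "\<not> nonstandard (\<lambda>n. \<sigma> n - Suc (\<rho> n))"
    proof
      assume *: "nonstandard (\<lambda>n. \<sigma> n - Suc (\<rho> n))"
      have "nonstandard (\<lambda>n. \<sigma> n - \<rho> n)"
        by (rule nonstandard_mono[OF *]) (simp add: diff_le_mono2)
      then show False using \<rho>(3) by simp
    qed
    moreover have "computable (\<lambda>n. \<sigma> n - Suc (\<rho> n))" by (intro computable_intros \<sigma>(1) \<rho>(1))
    ultimately have "\<forall>\<^sub>F n in germ C. \<sigma> n - Suc (\<rho> n) = ?std \<rho>" using eventually_std by simp
    with \<rho>(2) show ?thesis by eventually_elim simp
  qed
  have "c \<in> ?std ` T" for c
  proof
    let ?\<rho> = "\<lambda>n. \<sigma> n - Suc c"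
    have big: "\<forall>\<^sub>F n in germ C. Suc c < \<sigma> n" by (rule nonstandardD[OF \<sigma>(2)])
    have "\<forall>\<^sub>F n in germ C. \<sigma> n - Suc (?\<rho> n) = c" using big by eventually_elim simp
    then show "c = ?std ?\<rho>" by (rule std_eq[symmetric])
    have "\<forall>\<^sub>F n in germ C. \<sigma> n - ?\<rho> n = Suc c" using big by eventually_elim simp
    then have "\<not> nonstandard (\<lambda>n. \<sigma> n - ?\<rho> n)" using nonstandard_not_const by auto
    moreover have "\<forall>\<^sub>F n in germ C. ?\<rho> n < \<sigma> n" using big by eventually_elim simp
    moreover have "computable ?\<rho>" by (intro computable_intros \<sigma>(1))
    ultimately show "?\<rho> \<in> T" by (simp add: T_def germs_below_def)
  qed
  then show "?std ` T = fst (reverse omega)" by (auto simp: reverse_def omega_def)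
  show "\<forall>x\<in>T. \<forall>y\<in>T. germ_less x y \<longleftrightarrow> (?std x, ?std y) \<in> snd (reverse omega)"
  proof (intro ballI)
    fix x y assume xy: "x \<in> T" "y \<in> T"
    have "(\<forall>\<^sub>F n in germ C. x n < y n) \<longleftrightarrow> (\<forall>\<^sub>F n in germ C. ?std y < ?std x)"
      by (rule eventually_cong[OF eventually_conj[OF ev[OF xy(1)] ev[OF xy(2)]]]) auto
    then show "germ_less x y \<longleftrightarrow> (?std x, ?std y) \<in> snd (reverse omega)"
      by (simp add: germ_less_def eventually_const_iff reverse_def omega_def)
  qed
qed

definition middle_germs :: "(nat \<Rightarrow> nat) \<Rightarrow> (nat \<Rightarrow> nat) set" where
  "middle_germs \<sigma> = {\<rho>. computable \<rho> \<and> nonstandard \<rho> \<and> nonstandard (\<lambda>n. \<sigma> n - \<rho> n)}"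

text \<open>Infinite distance. Middle germs incomparable in this sense are at a standard distance
  and will form one copy of \<open>zeta\<close>.\<close>

definition far_less :: "(nat \<Rightarrow> nat) \<Rightarrow> (nat \<Rightarrow> nat) \<Rightarrow> bool" where
  "far_less f g \<longleftrightarrow> nonstandard (\<lambda>n. g n - f n)"

lemma far_less_imp_germ_less: "far_less f g \<Longrightarrow> germ_less f g"
  unfolding far_less_def germ_less_def
  by (drule nonstandardD[of _ 0]) (simp only: zero_less_diff)

text \<open>Midpoints give density and, with 0 or \<open>\<sigma>\<close> as one end, also the
  absence of endpoints. Cotransitivity holds because a nonstandard distance cannot be the sum of two
  standard ones.\<close>

lemma middle_germs_weak_dense:
  assumes \<sigma>: "computable \<sigma>" "nonstandard \<sigma>"
  shows "weak_dense_colored (middle_germs \<sigma>) far_less (\<lambda>_. ()) UNIV"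
proof
  have diff: "nonstandard (\<lambda>n. f n - g n)" if "\<And>k. \<forall>\<^sub>F n in germ C. g n + k < f n" for f g
    unfolding nonstandard_def
  proof
    fix k show "\<forall>\<^sub>F n in germ C. k < f n - g n" using that[of k] by eventually_elim simp
  qed
  have diffD: "\<forall>\<^sub>F n in germ C. g n + k < f n" if "nonstandard (\<lambda>n. f n - g n)" for f g k
    using nonstandardD[OF that, of k] by eventually_elim simp
  have mid: "(\<lambda>n. (f n + g n) div 2) \<in> middle_germs \<sigma> \<and> far_less f (\<lambda>n. (f n + g n) div 2) \<and>
      far_less (\<lambda>n. (f n + g n) div 2) g"
    if f: "computable f" and g: "computable g" and fg: "nonstandard (\<lambda>n. g n - f n)"
      and g\<sigma>: "\<forall>\<^sub>F n in germ C. g n \<le> \<sigma> n" for f g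
  proof -
    have "\<forall>\<^sub>F n in germ C. f n + k < (f n + g n) div 2" for k
      using diffD[OF fg, of "2 * k + 2"] by eventually_elim simp
    then have 1: "far_less f (\<lambda>n. (f n + g n) div 2)" unfolding far_less_def by (rule diff)
    have "\<forall>\<^sub>F n in germ C. (f n + g n) div 2 + k < g n" for k
      using diffD[OF fg, of "2 * k + 2"] by eventually_elim simp
    then have 2: "far_less (\<lambda>n. (f n + g n) div 2) g" unfolding far_less_def by (rule diff)
    have 3: "nonstandard (\<lambda>n. (f n + g n) div 2)"
      using 1 unfolding far_less_def by (rule nonstandard_mono) simp
    have 4: "nonstandard (\<lambda>n. \<sigma> n - (f n + g n) div 2)"
      using 2 unfolding far_less_def
      by (rule nonstandard_mono) (use g\<sigma> in \<open>eventually_elim, simp add: diff_le_mono\<close>)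
    have "computable (\<lambda>n. (f n + g n) div 2)" by (intro computable_intros f g)
    with 1 2 3 4 show ?thesis by (simp add: middle_germs_def)
  qed
  have le_\<sigma>: "\<forall>\<^sub>F n in germ C. f n \<le> \<sigma> n" if "f \<in> middle_germs \<sigma>" for f
  proof -
    have "nonstandard (\<lambda>n. \<sigma> n - f n)" using that by (simp add: middle_germs_def)
    from diffD[OF this, of 0] show ?thesis by eventually_elim simp
  qed
  have "(\<lambda>n. (0 + \<sigma> n) div 2) \<in> middle_germs \<sigma>"
    using mid[of "\<lambda>_. 0" \<sigma>] \<sigma> by (simp add: computable_const)
  then show "middle_germs \<sigma> \<noteq> {}" by auto
  show "countable (middle_germs \<sigma>)"
    by (rule countable_subset[OF _ countable_computable]) (auto simp: middle_germs_def)
  show "\<not> far_less x x" for x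
    using germ_less_irrefl[of x] far_less_imp_germ_less[of x x] by auto
  show "far_less x z" if "far_less x y" "far_less y z" for x y z
    using that(1) unfolding far_less_def
  proof (rule nonstandard_mono)
    have "germ_less y z" using that(2) by (rule far_less_imp_germ_less)
    then show "\<forall>\<^sub>F n in germ C. y n - x n \<le> z n - x n"
      unfolding germ_less_def by eventually_elim simp
  qed
  show "far_less x y \<or> far_less y z"
    if xyz: "x \<in> middle_germs \<sigma>" "y \<in> middle_germs \<sigma>" "z \<in> middle_germs \<sigma>" "far_less x z" for x y z
  proof (rule disjCI)
    assume "\<not> far_less y z"
    have comp: "computable x" "computable y" "computable z"
      using xyz by (auto simp: middle_germs_def)
    have "computable (\<lambda>n. z n - y n)" by (intro computable_intros comp)
    then have *: "\<forall>\<^sub>F n in germ C. z n - y n = std (\<lambda>n. z n - y n)"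
      using \<open>\<not> far_less y z\<close> unfolding far_less_def by (rule eventually_std)
    show "far_less x y"
      unfolding far_less_def
    proof (rule diff)
      fix k
      show "\<forall>\<^sub>F n in germ C. x n + k < y n"
        using * diffD[OF xyz(4)[unfolded far_less_def], of "k + std (\<lambda>n. z n - y n)"]
        by eventually_elim linarith
    qed
  qed
  show "\<exists>y\<in>middle_germs \<sigma>. far_less y x" if x: "x \<in> middle_germs \<sigma>" for x
    using mid[of "\<lambda>_. 0" x] x le_\<sigma>[OF x] by (auto simp: middle_germs_def computable_const)
  show "\<exists>y\<in>middle_germs \<sigma>. far_less x y" if x: "x \<in> middle_germs \<sigma>" for x
    using mid[of x \<sigma>] x \<sigma> by (auto simp: middle_germs_def)
  show "\<exists>z\<in>middle_germs \<sigma>. far_less x z \<and> far_less z y \<and> () = k"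
    if xy: "x \<in> middle_germs \<sigma>" "y \<in> middle_germs \<sigma>" "far_less x y" for x y and k :: unit
  proof -
    have "computable x" "computable y" using xy by (simp_all add: middle_germs_def)
    from mid[OF this xy(3)[unfolded far_less_def] le_\<sigma>[OF xy(2)]] show ?thesis by auto
  qed
qed auto

lemma presents_middle_germs:
  assumes \<sigma>: "computable \<sigma>" "nonstandard \<sigma>"
  shows "\<exists>F. presents (middle_germs \<sigma>) germ_less (lex_sum eta (\<lambda>_. zeta)) F"
proof -
  interpret weak_dense_colored "middle_germs \<sigma>" far_less "\<lambda>_. ()" UNIV
    by (rule middle_germs_weak_dense[OF \<sigma>])
  obtain q :: "(nat \<Rightarrow> nat) \<Rightarrow> rat" where q: "q ` middle_germs \<sigma> = UNIV"
      "\<And>f g. f \<in> middle_germs \<sigma> \<Longrightarrow> g \<in> middle_germs \<sigma> \<Longrightarrow> far_less f g \<longleftrightarrow> q f < q g"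
    using map_to_rat[OF dense_colored_Rats] by auto
  have "\<exists>G. presents {f\<in>middle_germs \<sigma>. q f = r} germ_less zeta G" for r
  proof -
    have "r \<in> q ` middle_germs \<sigma>" using q(1) by simp
    then obtain b where b: "b \<in> middle_germs \<sigma>" "q b = r" by auto
    have bD: "computable b" "nonstandard b" "nonstandard (\<lambda>n. \<sigma> n - b n)"
      using b(1) by (auto simp: middle_germs_def)
    \<comment> \<open>The signed distance from the base point \<open>b\<close>; truncated
      subtraction makes one of the two terms 0.\<close>
    define G where "G f = int (std (\<lambda>n. f n - b n)) - int (std (\<lambda>n. b n - f n))" for f
    have G: "\<forall>\<^sub>F n in germ C. int (f n) = int (b n) + G f" if "f \<in> middle_germs \<sigma>" "q f = r" for f
    proof -
      have f: "computable f" using that(1) by (simp add: middle_germs_def)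
      have "\<not> far_less f b" "\<not> far_less b f" using q(2)[OF that(1) b(1)] q(2)[OF b(1) that(1)] that(2) b(2) by auto
      then have "\<forall>\<^sub>F n in germ C. b n - f n = std (\<lambda>n. b n - f n)"
        "\<forall>\<^sub>F n in germ C. f n - b n = std (\<lambda>n. f n - b n)"
        unfolding far_less_def by (auto intro!: eventually_std computable_diff f bD(1))
      then show ?thesis unfolding G_def by eventually_elim linarith
    qed
    have onto: "z \<in> G ` {f\<in>middle_germs \<sigma>. q f = r}" for z
    proof -
      \<comment> \<open>The shift of \<open>b\<close> by \<open>z\<close>, split into its positive
        and negative parts; as \<open>b\<close> is nonstandard, the subtraction is exact almost
        everywhere on \<open>C\<close>.\<close>
      define f where "f n = b n + nat z - nat (- z)" for n
      have f: "computable f" unfolding f_def by (intro computable_intros bD(1))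
      have fb: "\<forall>\<^sub>F n in germ C. int (f n) = int (b n) + z"
        using nonstandardD[OF bD(2), of "nat (- z)"] unfolding f_def by eventually_elim linarith
      have "nonstandard f"
        unfolding nonstandard_def
      proof
        fix k show "\<forall>\<^sub>F n in germ C. k < f n"
          using fb nonstandardD[OF bD(2), of "k + nat (- z)"] by eventually_elim linarith
      qed
      moreover have "nonstandard (\<lambda>n. \<sigma> n - f n)"
        unfolding nonstandard_def
      proof
        fix k show "\<forall>\<^sub>F n in germ C. k < \<sigma> n - f n"
          using fb nonstandardD[OF bD(3), of "k + nat z"] by eventually_elim linarith
      qed
      ultimately have fm: "f \<in> middle_germs \<sigma>" using f by (simp add: middle_germs_def)
      have "\<not> far_less f b"
      proof
        assume *: "far_less f b"
        have "\<forall>\<^sub>F n in germ C. False"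
          using fb nonstandardD[OF *[unfolded far_less_def], of "nat (- z)"] by eventually_elim linarith
        then show False using not_eventually_False by simp
      qed
      moreover have "\<not> far_less b f"
      proof
        assume *: "far_less b f"
        have "\<forall>\<^sub>F n in germ C. False"
          using fb nonstandardD[OF *[unfolded far_less_def], of "nat z"] by eventually_elim linarith
        then show False using not_eventually_False by simp
      qed
      ultimately have "q f = r" using q(2)[OF fm b(1)] q(2)[OF b(1) fm] b(2) by auto
      have "\<forall>\<^sub>F n in germ C. G f = z" using fb G[OF fm \<open>q f = r\<close>] by eventually_elim linarith
      then have "z = G f" by (simp add: eventually_const_iff)
      then show ?thesis using fm \<open>q f = r\<close> by auto
    qed
    have "presents {f\<in>middle_germs \<sigma>. q f = r} germ_less zeta G"
      unfolding presents_def
    proof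
      show "G ` {f\<in>middle_germs \<sigma>. q f = r} = fst zeta" using onto by (auto simp: zeta_def)
      show "\<forall>x\<in>{f\<in>middle_germs \<sigma>. q f = r}. \<forall>y\<in>{f\<in>middle_germs \<sigma>. q f = r}.
          germ_less x y \<longleftrightarrow> (G x, G y) \<in> snd zeta"
      proof (intro ballI)
        fix x y assume "x \<in> {f\<in>middle_germs \<sigma>. q f = r}" "y \<in> {f\<in>middle_germs \<sigma>. q f = r}"
        then have ev: "\<forall>\<^sub>F n in germ C. int (x n) = int (b n) + G x"
          "\<forall>\<^sub>F n in germ C. int (y n) = int (b n) + G y" using G by auto
        have "(\<forall>\<^sub>F n in germ C. x n < y n) \<longleftrightarrow> (\<forall>\<^sub>F n in germ C. G x < G y)"
          by (rule eventually_cong[OF eventually_conj[OF ev]]) linarith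
        then show "germ_less x y \<longleftrightarrow> (G x, G y) \<in> snd zeta"
          by (simp add: germ_less_def eventually_const_iff zeta_def)
      qed
    qed
    then show ?thesis by auto
  qed
  then have "\<forall>r. \<exists>G. presents {f\<in>middle_germs \<sigma>. q f = r} germ_less zeta G" by simp
  from choice[OF this] obtain G where
    G: "\<And>r. presents {f\<in>middle_germs \<sigma>. q f = r} germ_less zeta (G r)" by auto
  have "presents (middle_germs \<sigma>) germ_less (lex_sum eta (\<lambda>_. zeta)) (\<lambda>f. (q f, G (q f) f))"
  proof (rule presents_lex_sum_eta[OF q(1) _ G])
    fix x y assume "x \<in> middle_germs \<sigma>" "y \<in> middle_germs \<sigma>" "q x < q y"
    then have "germ_less x y" using q(2) far_less_imp_germ_less by simp
    then show "germ_less x y \<and> \<not> germ_less y x" using germ_less_asym by simp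
  qed
  then show ?thesis by auto
qed

text \<open>As in nonstandard models of arithmetic, the numbers below \<open>\<sigma>\<close> split
  into those at standard distance from 0, those at standard distance from \<open>\<sigma>\<close>,
  and the rest, which fall into densely ordered copies of \<open>zeta\<close>.\<close>

lemma presents_alpha_germs:
  assumes \<sigma>: "computable \<sigma>" "nonstandard \<sigma>"
  shows "\<exists>F. presents (germs_below \<sigma>) germ_less alpha F"
proof -
  let ?L = "{f. computable f \<and> \<not> nonstandard f}"
  let ?U = "{\<rho> \<in> germs_below \<sigma>. \<not> nonstandard (\<lambda>n. \<sigma> n - \<rho> n)}"
  obtain F where F: "presents (middle_germs \<sigma>) germ_less (lex_sum eta (\<lambda>_. zeta)) F"
    using presents_middle_germs[OF \<sigma>] by auto
  have far: "germ_less f g"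
    if "nonstandard (\<lambda>n. \<sigma> n - f n)" "\<not> nonstandard (\<lambda>n. \<sigma> n - g n)" "computable g" for f g
  proof -
    have "computable (\<lambda>n. \<sigma> n - g n)" by (intro computable_intros \<sigma>(1) that(3))
    then have "\<forall>\<^sub>F n in germ C. \<sigma> n - g n = std (\<lambda>n. \<sigma> n - g n)" using that(2) by (rule eventually_std)
    then show ?thesis unfolding germ_less_def
      using nonstandardD[OF that(1), of "std (\<lambda>n. \<sigma> n - g n)"] by eventually_elim linarith
  qed
  have "\<exists>F. presents (middle_germs \<sigma> \<union> ?U) germ_less (lex_sum eta (\<lambda>_. zeta) \<oplus> reverse omega) F"
  proof (intro exI, rule presents_sum[OF F presents_costandard_germs[OF \<sigma>]])
    show "middle_germs \<sigma> \<inter> ?U = {}" by (auto simp: middle_germs_def)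
    fix x y assume "x \<in> middle_germs \<sigma>" "y \<in> ?U"
    then have "germ_less x y" by (intro far) (auto simp: middle_germs_def germs_below_def)
    then show "germ_less x y \<and> \<not> germ_less y x" using germ_less_asym by simp
  qed
  then obtain F' where F': "presents (middle_germs \<sigma> \<union> ?U) germ_less
      (lex_sum eta (\<lambda>_. zeta) \<oplus> reverse omega) F'" by auto
  have nonst_U: "nonstandard y" if "y \<in> ?U" for y
  proof (rule ccontr)
    assume "\<not> nonstandard y"
    moreover have y: "computable y" "\<not> nonstandard (\<lambda>n. \<sigma> n - y n)"
      using that by (auto simp: germs_below_def)
    moreover have "computable (\<lambda>n. \<sigma> n - y n)" by (intro computable_intros \<sigma>(1) y(1))
    ultimately have "\<forall>\<^sub>F n in germ C. y n = std y"
      "\<forall>\<^sub>F n in germ C. \<sigma> n - y n = std (\<lambda>n. \<sigma> n - y n)" using eventually_std by auto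
    then have "\<forall>\<^sub>F n in germ C. False"
      using nonstandardD[OF \<sigma>(2), of "std y + std (\<lambda>n. \<sigma> n - y n)"] by eventually_elim linarith
    then show False using not_eventually_False by simp
  qed
  have "\<exists>F. presents (?L \<union> (middle_germs \<sigma> \<union> ?U)) germ_less alpha F"
    unfolding alpha_def
  proof (intro exI, rule presents_sum[OF presents_standard_germs F'])
    have nonst: "nonstandard y" if "y \<in> middle_germs \<sigma> \<union> ?U" for y
      using that
    proof
      assume "y \<in> middle_germs \<sigma>"
      then show ?thesis by (simp add: middle_germs_def)
    qed (rule nonst_U)
    show "?L \<inter> (middle_germs \<sigma> \<union> ?U) = {}"
    proof (rule equals0I)
      fix x assume x: "x \<in> ?L \<inter> (middle_germs \<sigma> \<union> ?U)"
      from nonst[OF IntD2[OF x]] show False using IntD1[OF x] by simp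
    qed
    fix x y assume x: "x \<in> ?L" and y: "y \<in> middle_germs \<sigma> \<union> ?U"
    from x have "\<forall>\<^sub>F n in germ C. x n = std x" by (intro eventually_std) auto
    then have "germ_less x y" using nonst[OF y] by (rule standard_less_nonstandard)
    then show "germ_less x y \<and> \<not> germ_less y x" using germ_less_asym by simp
  qed
  moreover have "?L \<union> (middle_germs \<sigma> \<union> ?U) = germs_below \<sigma>"
  proof (intro set_eqI iffI)
    fix f assume f: "f \<in> ?L \<union> (middle_germs \<sigma> \<union> ?U)"
    then have "germ_less f \<sigma>"
    proof (elim UnE)
      assume "f \<in> ?L"
      then show ?thesis by (intro standard_less_nonstandard[OF eventually_std \<sigma>(2)]) auto
    next
      assume "f \<in> middle_germs \<sigma>"
      then show ?thesis by (intro far_less_imp_germ_less) (simp add: middle_germs_def far_less_def)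
    qed (simp add: germs_below_def germ_less_def)
    moreover have "computable f" using f by (auto simp: middle_germs_def germs_below_def)
    ultimately show "f \<in> germs_below \<sigma>" by (simp add: germs_below_def germ_less_def)
  qed (auto simp: middle_germs_def germs_below_def)
  ultimately show ?thesis by simp
qed

text \<open>Every class of the power contains a total computable function, so a presentation of the
  germs of such functions determines its order-type.\<close>

lemma cohesive_power_iso:
  fixes M :: "nat lorder"
  assumes M: "lin_order M" "computable_set (prod_encode ` snd M)" and a: "a \<in> fst M"
    and N: "strict_total N"
    and F: "presents {f. computable f \<and> range f \<subseteq> fst M} (\<lambda>f g. \<forall>\<^sub>F n in germ C. (f n, g n) \<in> snd M) N F"
  shows "cohesive_power C M \<cong> N"
proof -
  let ?S = "{f. computable f \<and> range f \<subseteq> fst M}"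
  let ?lt = "\<lambda>f g. \<forall>\<^sub>F n in germ C. (f n, g n) \<in> snd M"
  let ?D = "cohesive_power_dom C M" and ?E = "cohesive_eq C M"
  let ?\<iota> = "\<lambda>(f :: nat \<Rightarrow> nat) n. Some (f n)"
  have dom: "\<phi> \<in> ?D \<Longrightarrow> \<forall>\<^sub>F n in germ C. \<exists>a. \<phi> n = Some a" for \<phi>
    using almost_subset_eventually[of C "\<lambda>n. \<exists>a. \<phi> n = Some a"]
    by (simp add: cohesive_power_dom_def dom_def)
  have E: "(\<phi>, \<psi>) \<in> ?E \<longleftrightarrow> \<phi> \<in> ?D \<and> \<psi> \<in> ?D \<and> (\<forall>\<^sub>F n in germ C. \<phi> n = \<psi> n)" for \<phi> \<psi>
  proof -
    have "\<phi> \<in> ?D \<Longrightarrow> (\<forall>\<^sub>F n in germ C. \<exists>a. \<phi> n = Some a \<and> \<psi> n = Some a) \<longleftrightarrow> (\<forall>\<^sub>F n in germ C. \<phi> n = \<psi> n)"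
      by (rule eventually_cong[OF dom]) auto
    then show ?thesis by (auto simp: cohesive_eq_def almost_subset_eventually)
  qed
  have equiv: "equiv ?D ?E"
  proof (rule equivI)
    show "?E \<subseteq> ?D \<times> ?D" by (auto simp: E)
    show "refl_on ?D ?E" by (auto simp: refl_on_def E)
    show "sym ?E" by (auto simp: sym_def E eq_commute)
    show "trans ?E"
    proof (rule transI)
      fix \<phi> \<psi> \<chi> assume *: "(\<phi>, \<psi>) \<in> ?E" "(\<psi>, \<chi>) \<in> ?E"
      then have "\<forall>\<^sub>F n in germ C. \<phi> n = \<psi> n" "\<forall>\<^sub>F n in germ C. \<psi> n = \<chi> n" by (simp_all add: E)
      then have "\<forall>\<^sub>F n in germ C. \<phi> n = \<chi> n" by eventually_elim simp
      then show "(\<phi>, \<chi>) \<in> ?E" using * by (simp add: E)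
    qed
  qed
  have \<iota>: "?\<iota> f \<in> ?D" if "f \<in> ?S" for f
    using that by (auto simp: cohesive_power_dom_def computable_def ran_def almost_subset_def dom_def)
  have total: "\<exists>f\<in>?S. (\<phi>, ?\<iota> f) \<in> ?E" if \<phi>: "\<phi> \<in> ?D" for \<phi>
  proof -
    obtain f where f: "computable f" "\<And>n. f n \<in> fst M" "\<forall>\<^sub>F n in germ C. \<phi> n = Some (f n)"
      using total_extension[of \<phi> "fst M" a] \<phi> a by (auto simp: cohesive_power_dom_def)
    then have "f \<in> ?S" by auto
    then show ?thesis using E f(3) \<phi> \<iota> by auto
  qed
  define p where "p c = (SOME f. f \<in> ?S \<and> ?\<iota> f \<in> c)" for c
  have p: "p c \<in> ?S \<and> ?\<iota> (p c) \<in> c" if c: "c \<in> ?D // ?E" for c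
  proof -
    obtain \<phi> where \<phi>: "\<phi> \<in> ?D" "c = ?E `` {\<phi>}" using c by (rule quotientE)
    obtain f where "f \<in> ?S" "(\<phi>, ?\<iota> f) \<in> ?E" using total[OF \<phi>(1)] by auto
    then have "\<exists>f. f \<in> ?S \<and> ?\<iota> f \<in> c" using \<phi>(2) by auto
    then show ?thesis unfolding p_def by (rule someI_ex)
  qed
  have eq_of: "?E `` {?\<iota> (p c)} = c" if c: "c \<in> ?D // ?E" for c
    using Image_singleton_iff equiv_class_eq[OF equiv] p[OF c] c
    by (metis (no_types, lifting) equiv quotientE)
  have dec: "decidable (\<lambda>n. (f n, g n) \<in> snd M)" if "computable f" "computable g" for f g
  proof -
    have "decidable (\<lambda>n. n \<in> prod_encode ` snd M)"
      using M(2) by (simp add: computable_set_def decidable_def computable_def)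
    from decidable_comp[OF this computable_pair[OF that]]
    show ?thesis by (simp add: inj_image_mem_iff[OF inj_prod_encode])
  qed
  \<comment> \<open>Each comparison is decidable, so it holds or fails on almost all of
    \<open>C\<close>; where both fail, linearity of \<open>M\<close> forces equality.\<close>
  have trichotomy: "?lt f g \<or> ?lt g f \<or> (\<forall>\<^sub>F n in germ C. f n = g n)" if "f \<in> ?S" "g \<in> ?S" for f g
  proof (rule ccontr)
    assume *: "\<not> ?thesis"
    have "\<forall>\<^sub>F n in germ C. (f n, g n) \<notin> snd M" "\<forall>\<^sub>F n in germ C. (g n, f n) \<notin> snd M"
      using * decidable_dichotomy[OF dec] that by auto
    then have "\<forall>\<^sub>F n in germ C. f n = g n"
    proof eventually_elim
      case (elim n)
      have "f n \<in> fst M" "g n \<in> fst M" using that by auto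
      then show ?case using elim lin_orderD(4)[OF M(1)] by auto
    qed
    then show False using * by simp
  qed
  define h where "h c = F (p c)" for c
  have ord: "(c, d) \<in> snd (cohesive_power C M) \<longleftrightarrow> (h c, h d) \<in> snd N"
    if cd: "c \<in> ?D // ?E" "d \<in> ?D // ?E" for c d
  proof -
    have "(c, d) \<in> snd (cohesive_power C M) \<longleftrightarrow> ?lt (p c) (p d)"
    proof
      assume "(c, d) \<in> snd (cohesive_power C M)"
      then obtain \<phi> \<psi> where *: "c = ?E `` {\<phi>}" "d = ?E `` {\<psi>}"
        "\<forall>\<^sub>F n in germ C. \<exists>a b. \<phi> n = Some a \<and> \<psi> n = Some b \<and> (a, b) \<in> snd M"
        by (auto simp: cohesive_power_def almost_subset_eventually)
      have "\<forall>\<^sub>F n in germ C. \<phi> n = Some (p c n)" "\<forall>\<^sub>F n in germ C. \<psi> n = Some (p d n)"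
        using p[OF cd(1)] p[OF cd(2)] *(1,2) by (simp_all add: E)
      then show "?lt (p c) (p d)" using *(3) by eventually_elim auto
    next
      assume "?lt (p c) (p d)"
      then have "C \<subseteq>\<^sup>* {n. \<exists>a b. ?\<iota> (p c) n = Some a \<and> ?\<iota> (p d) n = Some b \<and> (a, b) \<in> snd M}"
        by (simp add: almost_subset_eventually)
      moreover have "?\<iota> (p c) \<in> ?D" "?\<iota> (p d) \<in> ?D" using p[OF cd(1)] p[OF cd(2)] \<iota> by auto
      ultimately have "(?E `` {?\<iota> (p c)}, ?E `` {?\<iota> (p d)}) \<in> snd (cohesive_power C M)"
        unfolding cohesive_power_def snd_conv
        by (intro CollectI exI[of _ "?\<iota> (p c)"] exI[of _ "?\<iota> (p d)"] conjI refl)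
      then show "(c, d) \<in> snd (cohesive_power C M)" using eq_of cd by simp
    qed
    also have "\<dots> \<longleftrightarrow> (h c, h d) \<in> snd N"
      using F p[OF cd(1)] p[OF cd(2)] by (simp add: presents_def h_def)
    finally show ?thesis .
  qed
  have "inj_on h (?D // ?E)"
  proof (rule inj_onI)
    fix c d assume cd: "c \<in> ?D // ?E" "d \<in> ?D // ?E" "h c = h d"
    have "(h c, h d) \<notin> snd N" "(h d, h c) \<notin> snd N" using cd(3) N by (simp_all add: strict_total_def)
    then have "\<not> ?lt (p c) (p d)" "\<not> ?lt (p d) (p c)"
      using F p[OF cd(1)] p[OF cd(2)] by (simp_all add: presents_def h_def)
    then have "\<forall>\<^sub>F n in germ C. p c n = p d n" 
      using trichotomy[OF conjunct1[OF p[OF cd(1)]] conjunct1[OF p[OF cd(2)]]] by simp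
    then have "(?\<iota> (p c), ?\<iota> (p d)) \<in> ?E" using p[OF cd(1)] p[OF cd(2)] \<iota> by (simp add: E)
    then have "?E `` {?\<iota> (p c)} = ?E `` {?\<iota> (p d)}" by (rule equiv_class_eq[OF equiv])
    then show "c = d" using eq_of cd by simp
  qed
  moreover have "h ` (?D // ?E) = fst N"
  proof (intro set_eqI iffI)
    fix b assume "b \<in> h ` (?D // ?E)"
    then show "b \<in> fst N" using p F by (auto simp: h_def presents_def)
  next
    fix b assume "b \<in> fst N"
    then have "b \<in> F ` ?S" using F by (simp only: presents_def)
    then obtain f where f: "f \<in> ?S" "b = F f" by (rule imageE)
    define c where "c = ?E `` {?\<iota> f}"
    have c: "c \<in> ?D // ?E" unfolding c_def using \<iota>[OF f(1)] by (rule quotientI)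
    have ev: "\<forall>\<^sub>F n in germ C. f n = p c n"
      using p[OF c] unfolding c_def by (simp add: E)
    have "\<not> ?lt f (p c)" "\<not> ?lt (p c) f"
    proof -
      have "\<not> (\<forall>\<^sub>F n in germ C. P n)" if "\<And>n. f n = p c n \<Longrightarrow> \<not> P n" for P
      proof
        assume "\<forall>\<^sub>F n in germ C. P n"
        with ev have "\<forall>\<^sub>F n in germ C. False" by eventually_elim (use that in auto)
        then show False using not_eventually_False by simp
      qed
      from this[of "\<lambda>n. (f n, p c n) \<in> snd M"] this[of "\<lambda>n. (p c n, f n) \<in> snd M"]
      show "\<not> ?lt f (p c)" "\<not> ?lt (p c) f" using lin_orderD(2)[OF M(1)] by simp_all
    qed
    then have "F f = F (p c)" using presents_cong[OF F N f(1) conjunct1[OF p[OF c]]] by simp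
    then show "b \<in> h ` (?D // ?E)" using c f(2) by (auto simp: h_def)
  qed
  ultimately have "bij_betw h (fst (cohesive_power C M)) (fst N)"
    by (simp add: bij_betw_def cohesive_power_def)
  moreover have "fst (cohesive_power C M) = ?D // ?E" by (simp add: cohesive_power_def)
  ultimately show ?thesis unfolding same_order_type_def using ord by auto
qed

end

section \<open>The linear order\<close>

text \<open>Uniqueness of reduced dyadic fractions after cross-multiplication; it gives distinct
  cells distinct positions.\<close>

lemma odd_times_power2_inj:
  fixes i j s t :: nat
  assumes eq: "(2 * i + 1) * 2 ^ s = (2 * j + 1) * 2 ^ t"
  shows "i = j \<and> s = t"
proof -
  have le: "t' \<le> s'" if "(2 * i' + 1) * 2 ^ s' = (2 * j' + 1) * 2 ^ t'" for i' j' s' t' :: nat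
  proof (rule ccontr)
    assume "\<not> t' \<le> s'"
    then obtain d where "t' = s' + Suc d" by (metis less_iff_Suc_add not_le add_Suc_right)
    then have "(2 * i' + 1) * 2 ^ s' = ((2 * j' + 1) * 2 ^ Suc d) * 2 ^ s'"
      using that by (simp only: power_add ac_simps)
    then have "2 * i' + 1 = (2 * j' + 1) * 2 ^ Suc d" by (simp only: mult_cancel2) simp
    then have "even (2 * i' + 1)" by simp
    then show False by simp
  qed
  have "s = t" using le[OF eq] le[OF eq[symmetric]] by simp
  then show ?thesis using eq by simp
qed

text \<open>\<open>k\<close> is the least index with \<open>P < 2 * k\<close>, and a suitable
  residue occurs at some \<open>i \<le> k + 2 * t + 1\<close>. Then
  \<open>2 * i + 1 \<le> P + 4 * t + 5\<close>, whence the width \<open>4 * t + 6\<close>.\<close>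

lemma multiple_in_gap:
  fixes P Q c t :: nat
  assumes "P + 4 * t + 6 \<le> Q" "c \<le> t"
  shows "\<exists>i. P < 2 * i + 1 \<and> 2 * i + 1 < Q \<and> i mod Suc t = c"
proof -
  define k where "k = P div 2 + 1"
  define i where "i = (k div Suc t + 1) * Suc t + c"
  have "k = k div Suc t * Suc t + k mod Suc t" "k mod Suc t < Suc t"
    by (simp_all only: div_mult_mod_eq mod_less_divisor zero_less_Suc)
  then have "k \<le> i" "i \<le> k + Suc t + c"
    unfolding i_def by (simp_all only: add_mult_distrib mult_1)
  moreover have "P < 2 * k" "2 * k \<le> P + 2" by (simp_all add: k_def)
  ultimately have "P < 2 * i + 1" "2 * i + 1 < Q" using assms by linarith+
  moreover have "i mod Suc t = c"
    using assms(2) by (simp only: i_def mod_mult_self3 mod_less less_Suc_eq_le)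
  ultimately show ?thesis by auto
qed

text \<open>The linear order consists of finite blocks.  A block sits at a cell \<open>a = prod_encode (i, t)\<close>,
  standing for the dyadic rational \<open>(2 * i + 1) / 2 ^ t\<close>, whose stage \<open>t\<close> must be a stage
  of the enumeration of \<open>- C\<close> that is not restrained below the level of the cell.
  The color \<open>prod_encode (x, u)\<close> of a cell says that its block has size \<open>x\<close> if \<open>u\<close> witnesses
  \<open>x \<in> X\<close>, and some larger size, unbounded along the cells, otherwise.\<close>

definition cell_val :: "nat \<Rightarrow> real" where
  "cell_val a = real (2 * nfst a + 1) / 2 ^ nsnd a"

text \<open>Cross-multiplication keeps the comparison within the naturals and thus
  decidable.\<close>

definition cell_less :: "nat \<Rightarrow> nat \<Rightarrow> bool" where
  "cell_less a b \<longleftrightarrow> (2 * nfst a + 1) * 2 ^ nsnd b < (2 * nfst b + 1) * 2 ^ nsnd a"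

text \<open>Half the position, rounded down. As the numerators are odd, no cell sits at an even
  integer, so there are no boundary cases.\<close>

definition level :: "nat \<Rightarrow> nat" where
  "level a = nfst a div 2 ^ nsnd a"

text \<open>Along the cells of stage \<open>t\<close> the colors up to \<open>t\<close> recur
  cyclically, so every stage \<open>t \<ge> c\<close> offers the color \<open>c\<close>
  everywhere.\<close>

definition color :: "nat \<Rightarrow> nat" where
  "color a = nfst a mod Suc (nsnd a)"

definition len :: "nat \<Rightarrow> nat" where
  "len a = nfst (color a)"

lemma cell_less_val: "cell_less a b \<longleftrightarrow> cell_val a < cell_val b"
proof -
  have "cell_val a < cell_val b \<longleftrightarrow>
      real ((2 * nfst a + 1) * 2 ^ nsnd b) < real ((2 * nfst b + 1) * 2 ^ nsnd a)"
    unfolding cell_val_def by (simp add: divide_less_eq less_divide_eq algebra_simps)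
  then show ?thesis unfolding cell_less_def by (simp only: of_nat_less_iff)
qed

lemma cell_val_inj:
  assumes "cell_val a = cell_val b" shows "a = b"
proof -
  have "\<not> cell_less a b" "\<not> cell_less b a" using assms by (simp_all add: cell_less_val)
  then have "(2 * nfst a + 1) * 2 ^ nsnd b = (2 * nfst b + 1) * 2 ^ nsnd a"
    unfolding cell_less_def by linarith
  then have "nfst a = nfst b \<and> nsnd b = nsnd a" by (rule odd_times_power2_inj)
  then have "prod_decode a = prod_decode b" by (simp add: prod_eq_iff)
  then show ?thesis by (simp add: prod_decode_eq)
qed

lemma cell_val_bounds:
  "2 * real (level a) < cell_val a" "cell_val a < 2 * real (level a) + 2"
proof -
  let ?i = "nfst a" and ?p = "2 ^ nsnd a :: nat"
  have i: "?i = level a * ?p + ?i mod ?p" "?i mod ?p < ?p"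
    unfolding level_def by (simp_all only: div_mult_mod_eq mod_less_divisor zero_less_power zero_less_numeral)
  define m where "m = ?i mod ?p"
  have eq: "real (2 * ?i + 1) = 2 * real (level a) * 2 ^ nsnd a + (2 * real m + 1)"
    by (subst i(1)) (simp add: m_def algebra_simps)
  have "m + 1 \<le> ?p" unfolding m_def using i(2) by linarith
  then have "real (m + 1) \<le> real ?p" by (simp only: of_nat_le_iff)
  then have m: "real m + 1 \<le> 2 ^ nsnd a" by simp
  show "2 * real (level a) < cell_val a"
    unfolding cell_val_def eq by (simp add: less_divide_eq)
  have "2 * real m + 1 < 2 * 2 ^ nsnd a" using m by linarith
  then show "cell_val a < 2 * real (level a) + 2"
    unfolding cell_val_def eq by (simp add: divide_less_eq distrib_right)
qed

lemma level_less_imp_cell_less: "level a < level b \<Longrightarrow> cell_less a b"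
  using cell_val_bounds(2)[of a] cell_val_bounds(1)[of b] unfolding cell_less_val by linarith

lemma cell_less_imp_level_le: "cell_less a b \<Longrightarrow> level a \<le> level b"
  using level_less_imp_cell_less[of b a] unfolding cell_less_val by linarith

lemma cell_between:
  assumes "cell_less a b" and t: "t \<ge> 2 * (nsnd a + nsnd b) + c + 8"
  shows "\<exists>i. cell_less a (prod_encode (i, t)) \<and> cell_less (prod_encode (i, t)) b \<and>
    color (prod_encode (i, t)) = c"
proof -
  \<comment> \<open>Over the denominator \<open>2 ^ t\<close> the two positions become
    \<open>P\<close> and \<open>Q\<close>, at least \<open>2 ^ s\<close> apart. The bound on
    \<open>t\<close> gives \<open>s \<ge> t div 2 + 4\<close>, enough for the gap
    \<open>4 * t + 6\<close>.\<close>
  define s where "s = t - (nsnd a + nsnd b)"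
  define A where "A = 2 * nfst a + 1"
  define B where "B = 2 * nfst b + 1"
  have ts: "t = nsnd a + (nsnd b + s)" "t = nsnd b + (nsnd a + s)" using t by (simp_all add: s_def)
  define P where "P = A * 2 ^ (nsnd b + s)"
  define Q where "Q = B * 2 ^ (nsnd a + s)"
  have "A * 2 ^ nsnd b + 1 \<le> B * 2 ^ nsnd a" using assms(1) by (simp add: cell_less_def A_def B_def)
  then have "(A * 2 ^ nsnd b + 1) * 2 ^ s \<le> B * 2 ^ nsnd a * 2 ^ s" by (rule mult_le_mono1)
  then have "P + 2 ^ s \<le> Q" by (simp add: P_def Q_def power_add algebra_simps)
  moreover have "4 * t + 6 \<le> 2 ^ s"
  proof -
    have "t div 2 + 1 \<le> 2 ^ (t div 2)" using Suc_leI[OF less_exp[of "t div 2"]] by (simp only: Suc_eq_plus1)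
    then have "4 * t + 6 \<le> 16 * 2 ^ (t div 2)" by linarith
    also have "\<dots> = (2::nat) ^ (t div 2 + 4)" by (simp add: power_add)
    also have "\<dots> \<le> 2 ^ s" using t by (intro power_increasing) (simp_all add: s_def)
    finally show ?thesis .
  qed
  ultimately obtain i where i: "P < 2 * i + 1" "2 * i + 1 < Q" "i mod Suc t = c"
    using multiple_in_gap[of P t Q c] t by auto
  have 1: "cell_less a (prod_encode (i, t)) \<longleftrightarrow> P * 2 ^ nsnd a < (2 * i + 1) * 2 ^ nsnd a"
    unfolding cell_less_def P_def A_def by (simp add: ts(1) power_add algebra_simps)
  have 2: "cell_less (prod_encode (i, t)) b \<longleftrightarrow> (2 * i + 1) * 2 ^ nsnd b < Q * 2 ^ nsnd b"
    unfolding cell_less_def Q_def B_def by (simp add: ts(2) power_add algebra_simps)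
  have "cell_less a (prod_encode (i, t))" "cell_less (prod_encode (i, t)) b"
    unfolding 1 2 mult_less_cancel2 using i by simp_all
  then show ?thesis using i by (intro exI[of _ i]) (simp add: color_def)
qed

lemma computable_cells:
  assumes "computable f"
  shows "computable (\<lambda>n. level (f n))" "computable (\<lambda>n. color (f n))" "computable (\<lambda>n. len (f n))"
  unfolding len_def color_def level_def by (intro computable_intros assms)+

lemma decidable_cell_less:
  "computable f \<Longrightarrow> computable g \<Longrightarrow> decidable (\<lambda>n. cell_less (f n) (g n))"
  unfolding cell_less_def by (intro computable_intros)

section \<open>The blocks, the order built from them, and its order-type \<omega>\<close>

locale construction = cohesive_stages C St for C St :: "nat set" +
  fixes R X :: "nat set"
  assumes decidable_R: "decidable (\<lambda>n. n \<in> R)"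
    and X_def: "X = {x. \<exists>u. \<forall>v. prod_encode (x, prod_encode (u, v)) \<in> R}"
    and zero_notin_X: "0 \<notin> X"
begin

definition fails :: "nat \<Rightarrow> nat \<Rightarrow> bool" where
  "fails a v \<longleftrightarrow> prod_encode (len a, prod_encode (nsnd (color a), v)) \<notin> R"

definition bad :: "nat \<Rightarrow> bool" where
  "bad a \<longleftrightarrow> (\<exists>v. fails a v)"

definition cell :: "nat \<Rightarrow> bool" where
  "cell a \<longleftrightarrow> nsnd a \<in> St \<and> restraint (nsnd a) \<le> level a"

text \<open>Only failures up to \<open>j\<close> are consulted, so membership is decidable although
  \<open>bad\<close> is merely c.e. If \<open>v\<close> is the least failure, the block receives
  \<open>nfst a + 1\<close> extra positions from \<open>len a + v\<close> on, more than its
  level.\<close>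

definition in_block :: "nat \<Rightarrow> nat \<Rightarrow> bool" where
  "in_block a j \<longleftrightarrow> j < len a \<or> (\<exists>v\<le>j. v + len a \<le> j \<and> fails a v) \<and>
     \<not> (\<exists>v\<le>j. v + len a + nfst a < j \<and> fails a v)"

definition elem :: "nat \<Rightarrow> bool" where
  "elem y \<longleftrightarrow> cell (nfst y) \<and> in_block (nfst y) (nsnd y)"

definition elem_less :: "nat \<Rightarrow> nat \<Rightarrow> bool" where
  "elem_less y z \<longleftrightarrow> cell_less (nfst y) (nfst z) \<or> nfst y = nfst z \<and> nsnd y < nsnd z"

definition M :: "nat lorder" where
  "M = (Collect elem, {(y, z). elem y \<and> elem z \<and> elem_less y z})"

lemma decidable_fails:
  "computable f \<Longrightarrow> computable g \<Longrightarrow> decidable (\<lambda>n. fails (f n) (g n))"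
  unfolding fails_def by (intro computable_intros computable_cells decidable_comp[OF decidable_R])

lemma decidable_cell: "computable f \<Longrightarrow> decidable (\<lambda>n. cell (f n))"
  unfolding cell_def
  by (intro computable_intros computable_cells decidable_comp_St computable_restraint)

lemma decidable_in_block:
  assumes "computable f" "computable g" shows "decidable (\<lambda>n. in_block (f n) (g n))"
proof -
  have "decidable (\<lambda>p. in_block (nfst p) (nsnd p))"
    unfolding in_block_def
    by (intro computable_intros computable_cells decidable_fails)
  from decidable_comp[OF this computable_pair[OF assms]] show ?thesis by simp
qed

lemma decidable_elem: "computable f \<Longrightarrow> decidable (\<lambda>n. elem (f n))"
  unfolding elem_def by (intro computable_intros decidable_cell decidable_in_block)

lemma decidable_elem_less:
  "computable f \<Longrightarrow> computable g \<Longrightarrow> decidable (\<lambda>n. elem_less (f n) (g n))"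
  unfolding elem_less_def by (intro computable_intros decidable_cell_less)

lemma lin_order_M: "lin_order M"
  unfolding lin_order_def strict_linear_order_on_def
proof (intro conjI)
  show "snd M \<subseteq> fst M \<times> fst M" by (auto simp: M_def)
  show "trans (snd M)"
    by (rule transI) (auto simp: M_def elem_less_def cell_less_val)
  show "irrefl (snd M)" by (auto simp: irrefl_def M_def elem_less_def cell_less_val)
  show "total_on (fst M) (snd M)"
  proof (rule total_onI)
    fix x y assume xy: "x \<in> fst M" "y \<in> fst M" "x \<noteq> y"
    have "nfst x \<noteq> nfst y \<or> nsnd x \<noteq> nsnd y"
    proof (rule ccontr)
      assume "\<not> ?thesis"
      then have "prod_decode x = prod_decode y" by (simp add: prod_eq_iff)
      then show False using xy(3) by (simp add: prod_decode_eq)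
    qed
    then have "elem_less x y \<or> elem_less y x"
      using cell_val_inj[of "nfst x" "nfst y"] by (auto simp: elem_less_def cell_less_val)
    then show "(x, y) \<in> snd M \<or> (y, x) \<in> snd M" using xy by (auto simp: M_def)
  qed
qed

lemma computable_M: "computable_lin_order M"
  unfolding computable_lin_order_def
proof (intro conjI lin_order_M)
  have *: "computable_set A \<longleftrightarrow> decidable (\<lambda>n. n \<in> A)" for A
    by (simp add: computable_set_def decidable_def computable_def)
  show "computable_set (fst M)"
    unfolding * M_def by (simp add: decidable_elem computable_id)
  have "n \<in> prod_encode ` snd M \<longleftrightarrow> elem (nfst n) \<and> elem (nsnd n) \<and> elem_less (nfst n) (nsnd n)" for n
  proof -
    have "n \<in> prod_encode ` snd M \<longleftrightarrow> prod_encode (prod_decode n) \<in> prod_encode ` snd M" by simp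
    also have "\<dots> \<longleftrightarrow> prod_decode n \<in> snd M" by (rule inj_image_mem_iff[OF inj_prod_encode])
    finally show ?thesis by (simp add: M_def case_prod_beta)
  qed
  then show "computable_set (prod_encode ` snd M)"
    unfolding * by (simp only:) (intro computable_intros decidable_elem decidable_elem_less)
qed

lemma good_len_in_X: "\<not> bad a \<Longrightarrow> len a \<in> X"
  unfolding bad_def fails_def X_def by auto

lemma in_block_good: "\<not> bad a \<Longrightarrow> in_block a j \<longleftrightarrow> j < len a"
  unfolding bad_def in_block_def by auto

lemma in_block_bad:
  assumes "bad a"
  defines "v \<equiv> LEAST v. fails a v"
  shows "in_block a j \<longleftrightarrow> j < len a \<or> len a + v \<le> j \<and> j \<le> len a + v + nfst a"
proof -
  have v: "fails a v" unfolding v_def using assms(1) unfolding bad_def by (rule LeastI_ex)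
  have le: "v \<le> w" if "fails a w" for w unfolding v_def using that by (rule Least_le)
  have "(\<exists>w\<le>j. w + k \<le> j \<and> fails a w) \<longleftrightarrow> v + k \<le> j" for k
  proof
    assume "\<exists>w\<le>j. w + k \<le> j \<and> fails a w"
    then obtain w where "w + k \<le> j" "fails a w" by auto
    then show "v + k \<le> j" using le[of w] by simp
  next
    assume "v + k \<le> j"
    then show "\<exists>w\<le>j. w + k \<le> j \<and> fails a w" using v by (intro exI[of _ v]) simp
  qed
  from this[of "len a"] this[of "len a + nfst a + 1"] show ?thesis
    unfolding in_block_def by (simp add: Suc_le_eq ac_simps not_less)
qed

lemma card_block:
  "finite {j. in_block a j}"
  "card {j. in_block a j} = (if bad a then len a + nfst a + 1 else len a)"
proof -
  have "finite {j. in_block a j} \<and>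
      card {j. in_block a j} = (if bad a then len a + nfst a + 1 else len a)"
  proof (cases "bad a")
    case True
    define v where "v = (LEAST v. fails a v)"
    have eq: "{j. in_block a j} = {..<len a} \<union> {len a + v..len a + v + nfst a}"
      unfolding v_def by (auto simp: in_block_bad[OF True])
    have "card ({..<len a} \<union> {len a + v..len a + v + nfst a}) = len a + (nfst a + 1)"
      by (subst card_Un_disjoint) auto
    then show ?thesis unfolding eq using True by simp
  next
    case False
    then have eq: "{j. in_block a j} = {..<len a}" by (auto simp: in_block_good)
    show ?thesis unfolding eq using False by simp
  qed
  then show "finite {j. in_block a j}"
    "card {j. in_block a j} = (if bad a then len a + nfst a + 1 else len a)" by auto
qed

text \<open>A cell of length 0 is bad because \<open>0 \<notin> X\<close>, and so it receives extra
  elements.\<close>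

lemma block_nonempty: "\<exists>j. in_block a j"
proof -
  have "card {j. in_block a j} \<noteq> 0"
    unfolding card_block(2) using good_len_in_X[of a] zero_notin_X by (auto intro: gr0I)
  then show ?thesis using card.empty by (metis (mono_tags, lifting) empty_Collect_eq)
qed

lemma ex_elem_at_cell: "cell a \<Longrightarrow> \<exists>y. elem y \<and> nfst y = a"
proof -
  assume "cell a"
  moreover obtain j where "in_block a j" using block_nonempty by auto
  ultimately show ?thesis by (intro exI[of _ "prod_encode (a, j)"]) (simp add: elem_def)
qed

text \<open>Finitely many stages act up to level \<open>k\<close>, each has finitely many cells
  there, and every block is finite.\<close>

lemma finite_level_le: "finite {y. elem y \<and> level (nfst y) \<le> k}"
proof -
  define T where "T = {t\<in>St. restraint t \<le> k}"
  define cells where "cells = prod_encode ` (\<Union>t\<in>T. {..<Suc k * 2 ^ t} \<times> {t})"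
  have fin: "finite cells" unfolding cells_def T_def by (intro finite_imageI finite_UN_I finite_restraint_le) auto
  have cell: "a \<in> cells" if a: "cell a" "level a \<le> k" for a
  proof -
    have "nfst a < Suc k * 2 ^ nsnd a"
      using a(2) unfolding level_def by (simp add: div_less_iff_less_mult flip: less_Suc_eq_le)
    moreover have "nsnd a \<in> T" using a by (auto simp: T_def cell_def)
    ultimately have "prod_decode a \<in> (\<Union>t\<in>T. {..<Suc k * 2 ^ t} \<times> {t})"
      by (intro UN_I[of "nsnd a"]) (auto simp: mem_Times_iff)
    then show ?thesis unfolding cells_def by (rule rev_image_eqI) simp
  qed
  have "{y. elem y \<and> level (nfst y) \<le> k} \<subseteq> prod_encode ` (SIGMA a:cells. {j. in_block a j})"
  proof
    fix y assume "y \<in> {y. elem y \<and> level (nfst y) \<le> k}"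
    then have "(nfst y, nsnd y) \<in> (SIGMA a:cells. {j. in_block a j})"
      using cell[of "nfst y"] by (auto simp only: elem_def mem_Collect_eq mem_Sigma_iff)
    then have "prod_decode y \<in> (SIGMA a:cells. {j. in_block a j})" by (simp only: prod.collapse)
    then show "y \<in> prod_encode ` (SIGMA a:cells. {j. in_block a j})" by (rule rev_image_eqI) simp
  qed
  then show ?thesis
    by (rule finite_subset) (intro finite_imageI finite_SigmaI fin card_block)
qed

text \<open>One stage suffices: its restraint is a fixed number, and it has a cell at every level
  from there on.\<close>

lemma ex_elem_of_level: "\<exists>K. \<forall>k\<ge>K. \<exists>y. elem y \<and> level (nfst y) = k"
proof -
  have "\<forall>\<^sub>F n in germ C. \<exists>t\<in>St. 0 \<le> t \<and> restraint t \<le> n"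
    by (rule eventually_unrestrained_stage[OF computable_const computable_id nonstandard_id])
  then have "St \<noteq> {}" using not_eventually_False by auto
  then obtain t where t: "t \<in> St" by auto
  have "\<exists>y. elem y \<and> level (nfst y) = k" if "k \<ge> restraint t" for k
  proof -
    have lev: "level (prod_encode (k * 2 ^ t, t)) = k" by (simp add: level_def)
    then have "cell (prod_encode (k * 2 ^ t, t))" using t that by (simp add: cell_def)
    from ex_elem_at_cell[OF this] show ?thesis using lev by auto
  qed
  then show ?thesis by auto
qed

lemma infinite_M: "infinite (fst M)"
proof
  assume "finite (fst M)"
  then have fin: "finite ((\<lambda>y. level (nfst y)) ` fst M)" by simp
  obtain K where K: "\<And>k. k \<ge> K \<Longrightarrow> \<exists>y. elem y \<and> level (nfst y) = k" using ex_elem_of_level by auto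
  have "{K..} \<subseteq> (\<lambda>y. level (nfst y)) ` fst M"
  proof
    fix k assume "k \<in> {K..}"
    then obtain y where "elem y" "level (nfst y) = k" using K[of k] by auto
    then show "k \<in> (\<lambda>y. level (nfst y)) ` fst M" by (auto simp: M_def)
  qed
  then have "finite {K..}" using fin by (rule finite_subset)
  then show False by (simp add: infinite_Ici)
qed

lemma presents_M_omega:
  "presents (fst M) (\<lambda>x y. (x, y) \<in> snd M) omega (\<lambda>x. card {y. (y, x) \<in> snd M})"
proof (rule presents_omega[OF lin_order_M infinite_M])
  fix x
  have "{y. (y, x) \<in> snd M} \<subseteq> {y. elem y \<and> level (nfst y) \<le> level (nfst x)}"
    using cell_less_imp_level_le by (auto simp: M_def elem_less_def)
  then show "finite {y. (y, x) \<in> snd M}" using finite_level_le by (rule finite_subset)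
qed

lemma M_omega: "M \<cong> omega"
  by (rule presents_lin_order_iso[OF lin_order_M _ presents_M_omega]) (simp add: omega_def)

end

section \<open>The cohesive power\<close>

text \<open>Used to find the element of a block at a prescribed position.\<close>

lemma rank_surj:
  fixes B :: "nat set"
  assumes "finite B" "k < card B"
  shows "\<exists>j\<in>B. card {i. i < j \<and> i \<in> B} = k"
proof -
  let ?r = "\<lambda>j. card {i. i < j \<and> i \<in> B}"
  have less: "?r j < ?r j'" if "j \<in> B" "j < j'" for j j'
    by (rule psubset_card_mono) (use that in auto)
  have "?r ` B = {..<card B}"
  proof (rule card_subset_eq)
    have "?r j < card B" if "j \<in> B" for j
      by (rule psubset_card_mono) (use that assms(1) in auto)
    then show "?r ` B \<subseteq> {..<card B}" by auto
    have "inj_on ?r B"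
    proof (rule inj_onI, rule ccontr)
      fix x y assume xy: "x \<in> B" "y \<in> B" "?r x = ?r y" "x \<noteq> y"
      then consider "x < y" | "y < x" by linarith
      then show False using less[of x y] less[of y x] xy by cases auto
    qed
    then show "card (?r ` B) = card {..<card B}" by (simp add: card_image)
  qed simp
  then have "k \<in> ?r ` B" using assms(2) by simp
  then show ?thesis by auto
qed

section \<open>Germs of elements, standard and far\<close>

context construction
begin

definition elems :: "(nat \<Rightarrow> nat) set" where
  "elems = {\<Phi>. computable \<Phi> \<and> range \<Phi> \<subseteq> fst M}"

definition germ_elem_less :: "(nat \<Rightarrow> nat) \<Rightarrow> (nat \<Rightarrow> nat) \<Rightarrow> bool" where
  "germ_elem_less \<Phi> \<Psi> \<longleftrightarrow> (\<forall>\<^sub>F n in germ C. (\<Phi> n, \<Psi> n) \<in> snd M)"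

definition far_elems :: "(nat \<Rightarrow> nat) set" where
  "far_elems = {\<Phi>\<in>elems. nonstandard (\<lambda>n. level (nfst (\<Phi> n)))}"

definition block_less :: "(nat \<Rightarrow> nat) \<Rightarrow> (nat \<Rightarrow> nat) \<Rightarrow> bool" where
  "block_less \<Phi> \<Psi> \<longleftrightarrow> (\<forall>\<^sub>F n in germ C. cell_less (nfst (\<Phi> n)) (nfst (\<Psi> n)))"

text \<open>Almost every block along the germ is a correct guess of one and the same
  \<open>x\<close>; these germs supply the finite types.\<close>

definition solid :: "(nat \<Rightarrow> nat) \<Rightarrow> nat \<Rightarrow> bool" where
  "solid \<Phi> x \<longleftrightarrow> (\<forall>\<^sub>F n in germ C. \<not> bad (nfst (\<Phi> n)) \<and> len (nfst (\<Phi> n)) = x)"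

definition block_type :: "(nat \<Rightarrow> nat) \<Rightarrow> (nat + (nat + (rat \<times> int) + nat)) lorder" where
  "block_type \<Phi> = (if \<exists>x. solid \<Phi> x then copy Inl (finite_type (THE x. solid \<Phi> x))
     else copy Inr alpha)"

lemma elemsD: "\<Phi> \<in> elems \<Longrightarrow> computable \<Phi>" "\<Phi> \<in> elems \<Longrightarrow> elem (\<Phi> n)"
  by (auto simp: elems_def M_def)

lemma computable_nfst_elems: "\<Phi> \<in> elems \<Longrightarrow> computable (\<lambda>n. nfst (\<Phi> n))"
  by (intro computable_nfst elemsD)

lemma germ_elem_less_iff:
  assumes "\<Phi> \<in> elems" "\<Psi> \<in> elems"
  shows "germ_elem_less \<Phi> \<Psi> \<longleftrightarrow> (\<forall>\<^sub>F n in germ C. elem_less (\<Phi> n) (\<Psi> n))"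
  using elemsD(2)[OF assms(1)] elemsD(2)[OF assms(2)] by (simp add: germ_elem_less_def M_def)

lemma germ_elem_less_asym: "germ_elem_less \<Phi> \<Psi> \<Longrightarrow> \<not> germ_elem_less \<Psi> \<Phi>"
proof
  assume "germ_elem_less \<Phi> \<Psi>" "germ_elem_less \<Psi> \<Phi>"
  then have "\<forall>\<^sub>F n in germ C. (\<Phi> n, \<Phi> n) \<in> snd M"
    unfolding germ_elem_less_def by eventually_elim (rule lin_orderD(3)[OF lin_order_M])
  then have "\<forall>\<^sub>F n in germ C. False"
    by eventually_elim (use lin_orderD(2)[OF lin_order_M] in simp)
  then show False using not_eventually_False by simp
qed

lemma block_less_imp_germ_elem_less:
  "\<Phi> \<in> elems \<Longrightarrow> \<Psi> \<in> elems \<Longrightarrow> block_less \<Phi> \<Psi> \<Longrightarrow> germ_elem_less \<Phi> \<Psi>"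
  unfolding block_less_def germ_elem_less_iff
  by (erule eventually_mono) (simp add: elem_less_def)

lemma search_elem:
  assumes "decidable (\<lambda>p. P (nfst p) (nsnd p))" "\<forall>\<^sub>F n in germ C. \<exists>y. elem y \<and> P n y"
  shows "\<exists>\<Theta>\<in>elems. \<forall>\<^sub>F n in germ C. P n (\<Theta> n)"
proof -
  obtain a where a: "a \<in> fst M" using infinite_M by fastforce
  have dec: "decidable (\<lambda>p. elem (nsnd p) \<and> P (nfst p) (nsnd p))"
    by (intro computable_intros decidable_elem assms(1))
  obtain f where f: "computable f" "\<And>n. f n \<in> fst M" "\<forall>\<^sub>F n in germ C. elem (f n) \<and> P n (f n)"
    using search[of "\<lambda>n y. elem y \<and> P n y" "fst M", OF dec assms(2) _ a] by (auto simp: M_def)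
  have "f \<in> elems" using f(1,2) by (auto simp: elems_def)
  moreover have "\<forall>\<^sub>F n in germ C. P n (f n)" using f(3) by eventually_elim simp
  ultimately show ?thesis by auto
qed

text \<open>Finitely many elements lie up to any fixed level, so a germ of standard level is
  constant on almost all of \<open>C\<close>. Such germs form the initial copy of \<omega>.\<close>

lemma standard_elem:
  assumes "\<Phi> \<in> elems" "\<Phi> \<notin> far_elems"
  shows "\<forall>\<^sub>F n in germ C. \<Phi> n = std \<Phi>" "std \<Phi> \<in> fst M"
proof -
  have "computable (\<lambda>n. level (nfst (\<Phi> n)))"
    by (intro computable_cells computable_nfst_elems assms(1))
  moreover have "\<not> nonstandard (\<lambda>n. level (nfst (\<Phi> n)))" using assms by (simp add: far_elems_def)
  ultimately obtain k where k: "\<forall>\<^sub>F n in germ C. level (nfst (\<Phi> n)) = k"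
    using standard_or_nonstandard by auto
  define b where "b = Max {y. elem y \<and> level (nfst y) \<le> k}"
  have "\<forall>\<^sub>F n in germ C. \<Phi> n \<le> b"
    using k
  proof eventually_elim
    case (elim n)
    then show ?case unfolding b_def
      using elemsD(2)[OF assms(1), of n] by (intro Max_ge finite_level_le) simp
  qed
  then obtain c where c: "\<forall>\<^sub>F n in germ C. \<Phi> n = c"
    using bounded_eventually_const[OF elemsD(1)[OF assms(1)]] by auto
  then show "\<forall>\<^sub>F n in germ C. \<Phi> n = std \<Phi>" using std_eq[OF c] by simp
  have "\<forall>\<^sub>F n in germ C. elem c" using c
    by eventually_elim (use elemsD(2)[OF assms(1)] in auto)
  then show "std \<Phi> \<in> fst M" using std_eq[OF c] by (simp add: eventually_const_iff M_def)
qed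

lemma presents_standard_elems:
  "\<exists>F. presents (elems - far_elems) germ_elem_less omega F"
proof (intro exI, rule presents_comp[OF presents_M_omega strict_total_basic(1)])
  show "std \<Phi> \<in> fst M" if "\<Phi> \<in> elems - far_elems" for \<Phi>
    using standard_elem(2) that by simp
  fix \<Phi> \<Psi> assume "\<Phi> \<in> elems - far_elems" "\<Psi> \<in> elems - far_elems"
  then have ev: "\<forall>\<^sub>F n in germ C. \<Phi> n = std \<Phi>" "\<forall>\<^sub>F n in germ C. \<Psi> n = std \<Psi>"
    by (auto intro: standard_elem)
  have "(\<forall>\<^sub>F n in germ C. (\<Phi> n, \<Psi> n) \<in> snd M) \<longleftrightarrow> (\<forall>\<^sub>F n in germ C. (std \<Phi>, std \<Psi>) \<in> snd M)"
    by (rule eventually_cong[OF eventually_conj[OF ev]]) simp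
  then show "germ_elem_less \<Phi> \<Psi> \<longleftrightarrow> (std \<Phi>, std \<Psi>) \<in> snd M"
    by (simp add: germ_elem_less_def eventually_const_iff)
next
  fix y assume y: "y \<in> fst M"
  have "(\<lambda>_. y) \<in> elems" using y by (simp add: elems_def computable_const)
  moreover have "(\<lambda>_. y) \<notin> far_elems"
    using nonstandard_not_const[of "\<lambda>_. level (nfst y)" "level (nfst y)"] by (auto simp: far_elems_def)
  moreover have "std (\<lambda>_. y) = y" by (rule std_eq) simp
  ultimately show "\<exists>\<Phi>\<in>elems - far_elems. (y, std \<Phi>) \<notin> snd M \<and> (std \<Phi>, y) \<notin> snd M"
    using lin_orderD(2)[OF lin_order_M] by (intro bexI[of _ "\<lambda>_. y"]) auto
qed

lemma standard_less_far:
  assumes "\<Phi> \<in> elems - far_elems" "\<Psi> \<in> far_elems"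
  shows "germ_elem_less \<Phi> \<Psi>"
proof -
  have el: "\<Phi> \<in> elems" "\<Phi> \<notin> far_elems" "\<Psi> \<in> elems" "nonstandard (\<lambda>n. level (nfst (\<Psi> n)))"
    using assms by (auto simp: far_elems_def)
  have "block_less \<Phi> \<Psi>"
    unfolding block_less_def
    using standard_elem(1)[OF el(1,2)] nonstandardD[OF el(4), of "level (nfst (std \<Phi>))"]
    by eventually_elim (auto intro: level_less_imp_cell_less)
  then show ?thesis using block_less_imp_germ_elem_less el by simp
qed

subsection \<open>A single block\<close>

lemma solid_unique: "solid \<Phi> x \<Longrightarrow> solid \<Phi> y \<Longrightarrow> x = y"
  unfolding solid_def
  by (rule std_unique[of "\<lambda>n. len (nfst (\<Phi> n))"]) (auto elim: eventually_mono)

lemma solid_in_X: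
  assumes "solid \<Phi> x" shows "x \<in> X"
proof -
  have "\<forall>\<^sub>F n in germ C. x \<in> X"
    using assms unfolding solid_def by eventually_elim (use good_len_in_X in auto)
  then show ?thesis by (simp add: eventually_const_iff)
qed

lemma block_type_solid: "solid \<Phi> x \<Longrightarrow> block_type \<Phi> = copy Inl (finite_type x)"
  unfolding block_type_def using solid_unique by (metis the_equality)

lemma block_type_not_solid: "\<not> (\<exists>x. solid \<Phi> x) \<Longrightarrow> block_type \<Phi> = copy Inr alpha"
  by (simp add: block_type_def)

lemma block_type_in: "block_type \<Phi> \<in> finite_types_and_alpha X"
proof (cases "\<exists>x. solid \<Phi> x")
  case True
  then obtain x where "solid \<Phi> x" by auto
  then show ?thesis
    using block_type_solid solid_in_X by (auto simp: finite_types_and_alpha_def)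
qed (simp add: block_type_not_solid finite_types_and_alpha_def)

text \<open>\<open>bad\<close> is only c.e., but along \<open>C\<close> it is settled one way, and
  either way the size agrees with a computable function. For refuted guesses that function exceeds
  the level and is nonstandard; for correct ones it is \<open>len\<close>, which is either constant,
  making the germ solid, or nonstandard.\<close>

lemma block_size:
  assumes "\<Phi> \<in> far_elems"
  shows "\<exists>\<sigma>. computable \<sigma> \<and> (\<forall>\<^sub>F n in germ C. \<sigma> n = card {j. in_block (nfst (\<Phi> n)) j}) \<and>
    ((\<exists>x. solid \<Phi> x \<and> (\<forall>\<^sub>F n in germ C. \<sigma> n = x)) \<or> \<not> (\<exists>x. solid \<Phi> x) \<and> nonstandard \<sigma>)"
proof -
  have \<Phi>: "computable (\<lambda>n. nfst (\<Phi> n))" "nonstandard (\<lambda>n. level (nfst (\<Phi> n)))"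
    using assms computable_nfst_elems by (auto simp: far_elems_def)
  have "decidable (\<lambda>p. fails (nfst (\<Phi> (nfst p))) (nsnd p))"
    by (intro decidable_fails computable_comp[OF \<Phi>(1)] computable_intros)
  from ce_ex[OF this] have "ce {n. bad (nfst (\<Phi> n))}" by (simp add: bad_def)
  then have "(\<forall>\<^sub>F n in germ C. bad (nfst (\<Phi> n))) \<or> (\<forall>\<^sub>F n in germ C. \<not> bad (nfst (\<Phi> n)))"
    by (rule ce_dichotomy)
  then show ?thesis
  proof
    assume good: "\<forall>\<^sub>F n in germ C. \<not> bad (nfst (\<Phi> n))"
    let ?\<sigma> = "\<lambda>n. len (nfst (\<Phi> n))"
    have \<sigma>: "computable ?\<sigma>" by (rule computable_cells(3)[OF \<Phi>(1)])
    have card: "\<forall>\<^sub>F n in germ C. ?\<sigma> n = card {j. in_block (nfst (\<Phi> n)) j}"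
      using good by eventually_elim (simp add: card_block)
    show ?thesis
    proof (cases "nonstandard ?\<sigma>")
      case True
      have "\<not> solid \<Phi> x" for x
      proof
        assume "solid \<Phi> x"
        then have "\<forall>\<^sub>F n in germ C. ?\<sigma> n = x" unfolding solid_def by eventually_elim simp
        then show False using nonstandard_not_const[OF True] by simp
      qed
      with \<sigma> card True show ?thesis by (intro exI[of _ ?\<sigma>]) simp
    next
      case False
      then obtain x where x: "\<forall>\<^sub>F n in germ C. ?\<sigma> n = x"
        using standard_or_nonstandard[OF \<sigma>] by auto
      have "solid \<Phi> x" unfolding solid_def using good x by eventually_elim simp
      with \<sigma> card x show ?thesis by (intro exI[of _ ?\<sigma>]) auto
    qed
  next
    assume bad: "\<forall>\<^sub>F n in germ C. bad (nfst (\<Phi> n))"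
    let ?\<sigma> = "\<lambda>n. len (nfst (\<Phi> n)) + nfst (nfst (\<Phi> n)) + 1"
    have \<sigma>: "computable ?\<sigma>" by (intro computable_intros computable_cells(3) \<Phi>(1))
    have card: "\<forall>\<^sub>F n in germ C. ?\<sigma> n = card {j. in_block (nfst (\<Phi> n)) j}"
      using bad by eventually_elim (simp add: card_block)
    have "level a \<le> len a + nfst a + 1" for a
      using div_le_dividend[of "nfst a" "2 ^ nsnd a"] unfolding level_def by linarith
    then have "nonstandard ?\<sigma>" by (intro nonstandard_mono[OF \<Phi>(2)]) simp
    moreover have "\<not> solid \<Phi> x" for x
    proof
      assume "solid \<Phi> x"
      then have "\<forall>\<^sub>F n in germ C. False" unfolding solid_def using bad by eventually_elim simp
      then show False using not_eventually_False by simp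
    qed
    ultimately show ?thesis using \<sigma> card by (intro exI[of _ ?\<sigma>]) simp
  qed
qed

text \<open>The second component of an element need not be its position, because the extra part of a
  bad block may start after a gap.\<close>

definition block_rank :: "nat \<Rightarrow> nat" where
  "block_rank y = card {j. j < nsnd y \<and> in_block (nfst y) j}"

lemma computable_block_rank: "computable f \<Longrightarrow> computable (\<lambda>n. block_rank (f n))"
proof (rule computable_comp[of block_rank])
  show "computable block_rank"
    unfolding block_rank_def by (intro computable_intros decidable_in_block)
qed

lemma block_rank_less:
  assumes "elem y" shows "block_rank y < card {j. in_block (nfst y) j}"
  unfolding block_rank_def
  by (rule psubset_card_mono) (use assms card_block(1) in \<open>auto simp: elem_def\<close>)

lemma block_rank_less_iff:
  assumes "elem y" "elem z" "nfst y = nfst z"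
  shows "block_rank y < block_rank z \<longleftrightarrow> elem_less y z"
proof -
  have mono: "block_rank u < block_rank v" if "elem u" "nfst u = nfst v" "nsnd u < nsnd v" for u v
    unfolding block_rank_def
    by (rule psubset_card_mono) (use that in \<open>auto simp: elem_def\<close>)
  have "elem_less y z \<longleftrightarrow> nsnd y < nsnd z"
    using assms(3) by (simp add: elem_less_def cell_less_val)
  moreover have "block_rank y = block_rank z" if "nsnd y = nsnd z"
    using assms(3) that by (simp add: block_rank_def)
  ultimately show ?thesis
    using mono[of y z] mono[of z y] assms by (cases "nsnd y" "nsnd z" rule: linorder_cases) auto
qed

text \<open>The rank identifies a block of size \<open>\<sigma>\<close> with the germs below
  \<open>\<sigma>\<close>; it is onto because the element of a given rank can be searched
  for.\<close>

lemma presents_block: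
  assumes \<Phi>: "\<Phi> \<in> far_elems"
  shows "\<exists>G. presents {\<Psi>\<in>elems. \<forall>\<^sub>F n in germ C. nfst (\<Psi> n) = nfst (\<Phi> n)} germ_elem_less (block_type \<Phi>) G"
proof -
  let ?T = "{\<Psi>\<in>elems. \<forall>\<^sub>F n in germ C. nfst (\<Psi> n) = nfst (\<Phi> n)}"
  let ?r = "\<lambda>\<Psi> n. block_rank (\<Psi> n)"
  obtain \<sigma> where \<sigma>: "computable \<sigma>" "\<forall>\<^sub>F n in germ C. \<sigma> n = card {j. in_block (nfst (\<Phi> n)) j}"
    "(\<exists>x. solid \<Phi> x \<and> (\<forall>\<^sub>F n in germ C. \<sigma> n = x)) \<or> \<not> (\<exists>x. solid \<Phi> x) \<and> nonstandard \<sigma>"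
    using block_size[OF \<Phi>] by auto
  have "\<exists>F. presents (germs_below \<sigma>) germ_less (block_type \<Phi>) F"
    using \<sigma>(3)
  proof
    assume "\<exists>x. solid \<Phi> x \<and> (\<forall>\<^sub>F n in germ C. \<sigma> n = x)"
    then obtain x where x: "solid \<Phi> x" "\<forall>\<^sub>F n in germ C. \<sigma> n = x" by auto
    show ?thesis unfolding block_type_solid[OF x(1)]
      using presents_copy[OF inj_Inl presents_finite_germs[OF x(2)]] by blast
  next
    assume *: "\<not> (\<exists>x. solid \<Phi> x) \<and> nonstandard \<sigma>"
    then obtain F where "presents (germs_below \<sigma>) germ_less alpha F"
      using presents_alpha_germs[OF \<sigma>(1)] by auto
    then show ?thesis unfolding block_type_not_solid[OF conjunct1[OF *]]
      using presents_copy[OF inj_Inr] by blast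
  qed
  then obtain F where F: "presents (germs_below \<sigma>) germ_less (block_type \<Phi>) F" ..
  have "presents ?T germ_elem_less (block_type \<Phi>) (\<lambda>\<Psi>. F (?r \<Psi>))"
  proof (rule presents_comp[OF F strict_total_finite_types_and_alpha[OF block_type_in]])
    fix \<Psi> assume \<Psi>: "\<Psi> \<in> ?T"
    then have "\<forall>\<^sub>F n in germ C. nfst (\<Psi> n) = nfst (\<Phi> n)" by simp
    with \<sigma>(2) have "\<forall>\<^sub>F n in germ C. ?r \<Psi> n < \<sigma> n"
    proof eventually_elim
      case (elim n)
      have "elem (\<Psi> n)" using \<Psi> elemsD(2) by simp
      from block_rank_less[OF this] show ?case using elim by simp
    qed
    then show "?r \<Psi> \<in> germs_below \<sigma>"
      using \<Psi> by (simp add: germs_below_def computable_block_rank elemsD(1))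
  next
    fix \<Psi> \<Psi>' assume *: "\<Psi> \<in> ?T" "\<Psi>' \<in> ?T"
    then have ev: "\<forall>\<^sub>F n in germ C. nfst (\<Psi> n) = nfst (\<Phi> n)" "\<forall>\<^sub>F n in germ C. nfst (\<Psi>' n) = nfst (\<Phi> n)"
      and el: "\<Psi> \<in> elems" "\<Psi>' \<in> elems" by simp_all
    have "(\<forall>\<^sub>F n in germ C. elem_less (\<Psi> n) (\<Psi>' n)) \<longleftrightarrow> (\<forall>\<^sub>F n in germ C. ?r \<Psi> n < ?r \<Psi>' n)"
      by (rule eventually_cong[OF eventually_conj[OF ev]])
        (simp add: block_rank_less_iff elemsD(2)[OF el(1)] elemsD(2)[OF el(2)])
    then show "germ_elem_less \<Psi> \<Psi>' \<longleftrightarrow> germ_less (?r \<Psi>) (?r \<Psi>')"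
      unfolding germ_elem_less_iff[OF el] germ_less_def .
  next
    fix \<rho> assume \<rho>: "\<rho> \<in> germs_below \<sigma>"
    then have comp: "computable \<rho>" and lt: "\<forall>\<^sub>F n in germ C. \<rho> n < \<sigma> n"
      by (simp_all add: germs_below_def)
    have \<Phi>c: "computable (\<lambda>n. nfst (\<Phi> n))"
      using \<Phi> computable_nfst_elems by (simp add: far_elems_def)
    have \<Phi>el: "elem (\<Phi> n)" for n using \<Phi> elemsD(2) by (simp add: far_elems_def)
    let ?P = "\<lambda>n y. nfst y = nfst (\<Phi> n) \<and> block_rank y = \<rho> n"
    have "decidable (\<lambda>p. ?P (nfst p) (nsnd p))"
      by (intro computable_intros computable_block_rank computable_comp[OF comp] computable_comp[OF \<Phi>c])
    moreover have "\<forall>\<^sub>F n in germ C. \<exists>y. elem y \<and> ?P n y"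
      using lt \<sigma>(2)
    proof eventually_elim
      case (elim n)
      obtain j where j: "in_block (nfst (\<Phi> n)) j" "card {i. i < j \<and> in_block (nfst (\<Phi> n)) i} = \<rho> n"
        using rank_surj[OF card_block(1), of "\<rho> n" "nfst (\<Phi> n)"] elim by auto
      then show ?case using \<Phi>el[of n]
        by (intro exI[of _ "prod_encode (nfst (\<Phi> n), j)"]) (simp add: elem_def block_rank_def)
    qed
    ultimately obtain \<Theta> where \<Theta>: "\<Theta> \<in> elems" "\<forall>\<^sub>F n in germ C. ?P n (\<Theta> n)"
      using search_elem[of ?P] by auto
    have "\<forall>\<^sub>F n in germ C. nfst (\<Theta> n) = nfst (\<Phi> n)" "\<forall>\<^sub>F n in germ C. ?r \<Theta> n = \<rho> n"
      "\<forall>\<^sub>F n in germ C. \<rho> n = ?r \<Theta> n"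
      using \<Theta>(2) by (auto elim: eventually_mono)
    then show "\<exists>\<Psi>\<in>?T. \<not> germ_less \<rho> (?r \<Psi>) \<and> \<not> germ_less (?r \<Psi>) \<rho>"
      using \<Theta>(1) not_germ_less_eq by (intro bexI[of _ \<Theta>]) auto
  qed
  then show ?thesis by blast
qed

subsection \<open>The order of the blocks\<close>

lemma block_less_trans:
  assumes "block_less \<Phi> \<Psi>" "block_less \<Psi> \<Theta>" shows "block_less \<Phi> \<Theta>"
  using assms unfolding block_less_def by eventually_elim (simp add: cell_less_val)

lemma block_less_irrefl: "\<not> block_less \<Phi> \<Phi>"
  unfolding block_less_def using not_eventually_False by (simp add: cell_less_val)

lemma block_less_total:
  assumes "\<Phi> \<in> elems" "\<Psi> \<in> elems" "\<not> block_less \<Phi> \<Psi>" "\<not> block_less \<Psi> \<Phi>"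
  shows "\<forall>\<^sub>F n in germ C. nfst (\<Phi> n) = nfst (\<Psi> n)"
proof -
  note c = computable_nfst_elems[OF assms(1)] computable_nfst_elems[OF assms(2)]
  have "\<forall>\<^sub>F n in germ C. \<not> cell_less (nfst (\<Phi> n)) (nfst (\<Psi> n))"
    using decidable_dichotomy[OF decidable_cell_less[OF c]] assms(3) by (simp add: block_less_def)
  moreover have "\<forall>\<^sub>F n in germ C. \<not> cell_less (nfst (\<Psi> n)) (nfst (\<Phi> n))"
    using decidable_dichotomy[OF decidable_cell_less[OF c(2,1)]] assms(4) by (simp add: block_less_def)
  ultimately show ?thesis
    by eventually_elim (simp add: cell_less_val cell_val_inj)
qed

lemma block_type_cong:
  assumes "\<forall>\<^sub>F n in germ C. nfst (\<Phi> n) = nfst (\<Psi> n)"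
  shows "block_type \<Phi> = block_type \<Psi>"
proof -
  have "solid \<Phi> x \<longleftrightarrow> solid \<Psi> x" for x
    unfolding solid_def by (rule eventually_cong[OF assms]) simp
  then have "solid \<Phi> = solid \<Psi>" by (rule ext)
  then show ?thesis by (simp only: block_type_def)
qed

text \<open>Supplies blocks at prescribed nonstandard levels, which gives existence and rules out a
  first and a last block.\<close>

lemma far_elems_level:
  assumes "computable g" "nonstandard g"
  shows "\<exists>\<Theta>\<in>far_elems. \<forall>\<^sub>F n in germ C. level (nfst (\<Theta> n)) = g n"
proof -
  obtain K where K: "\<And>k. k \<ge> K \<Longrightarrow> \<exists>y. elem y \<and> level (nfst y) = k" using ex_elem_of_level by auto
  have dec: "decidable (\<lambda>p. level (nfst (nsnd p)) = g (nfst p))"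
    by (intro computable_intros computable_cells computable_comp[OF assms(1)])
  have "\<forall>\<^sub>F n in germ C. \<exists>y. elem y \<and> level (nfst y) = g n"
    using nonstandardD[OF assms(2), of K] by eventually_elim (rule K, simp)
  from search_elem[of "\<lambda>n y. level (nfst y) = g n", OF dec this]
  obtain \<Theta> where \<Theta>: "\<Theta> \<in> elems" "\<forall>\<^sub>F n in germ C. level (nfst (\<Theta> n)) = g n" by auto
  have "nonstandard (\<lambda>n. level (nfst (\<Theta> n)))"
    by (rule nonstandard_mono[OF assms(2)]) (use \<Theta>(2) in \<open>auto elim: eventually_mono\<close>)
  with \<Theta> show ?thesis by (intro bexI[of _ \<Theta>]) (simp_all add: far_elems_def)
qed

text \<open>Here the restraint pays off. A cell to the right of that of \<open>\<Phi> n\<close> has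
  at least the same level, so any stage restrained by no more than this level may act there; and
  such a stage occurs beyond the bound from which \<open>cell_between\<close> finds a cell of color
  \<open>c\<close>.\<close>

lemma far_elems_dense:
  assumes \<Phi>: "\<Phi> \<in> far_elems" and \<Psi>: "\<Psi> \<in> far_elems" and less: "block_less \<Phi> \<Psi>"
  shows "\<exists>\<Theta>\<in>far_elems. block_less \<Phi> \<Theta> \<and> block_less \<Theta> \<Psi> \<and>
    (\<forall>\<^sub>F n in germ C. color (nfst (\<Theta> n)) = c)"
proof -
  have \<Phi>D: "computable (\<lambda>n. nfst (\<Phi> n))" "nonstandard (\<lambda>n. level (nfst (\<Phi> n)))"
    using \<Phi> computable_nfst_elems by (auto simp: far_elems_def)
  have \<Psi>D: "computable (\<lambda>n. nfst (\<Psi> n))"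
    using \<Psi> computable_nfst_elems by (auto simp: far_elems_def)
  let ?P = "\<lambda>n y. cell_less (nfst (\<Phi> n)) (nfst y) \<and> cell_less (nfst y) (nfst (\<Psi> n)) \<and>
    color (nfst y) = c"
  have dec: "decidable (\<lambda>p. ?P (nfst p) (nsnd p))"
    by (intro computable_intros decidable_cell_less computable_cells computable_comp[OF \<Phi>D(1)]
        computable_comp[OF \<Psi>D])
  let ?f = "\<lambda>n. 2 * (nsnd (nfst (\<Phi> n)) + nsnd (nfst (\<Psi> n))) + c + 8"
  have "computable ?f" by (intro computable_intros \<Phi>D(1) \<Psi>D)
  from eventually_unrestrained_stage[OF this computable_cells(1)[OF \<Phi>D(1)] \<Phi>D(2)] less[unfolded block_less_def]
  have ex: "\<forall>\<^sub>F n in germ C. \<exists>y. elem y \<and> ?P n y"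
  proof eventually_elim
    case (elim n)
    then obtain t where t: "t \<in> St" "?f n \<le> t" "restraint t \<le> level (nfst (\<Phi> n))" by auto
    obtain i where i: "cell_less (nfst (\<Phi> n)) (prod_encode (i, t))"
      "cell_less (prod_encode (i, t)) (nfst (\<Psi> n))" "color (prod_encode (i, t)) = c"
      using cell_between[OF elim(2) t(2)] by auto
    have "cell (prod_encode (i, t))"
      using t cell_less_imp_level_le[OF i(1)] by (simp add: cell_def)
    then obtain y where "elem y" "nfst y = prod_encode (i, t)" using ex_elem_at_cell by auto
    with i show ?case by auto
  qed
  obtain \<Theta> where \<Theta>: "\<Theta> \<in> elems" "\<forall>\<^sub>F n in germ C. ?P n (\<Theta> n)"
    using search_elem[of ?P, OF dec ex] by auto
  have "\<forall>\<^sub>F n in germ C. level (nfst (\<Phi> n)) \<le> level (nfst (\<Theta> n))"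
    using \<Theta>(2) by eventually_elim (simp add: cell_less_imp_level_le)
  then have "nonstandard (\<lambda>n. level (nfst (\<Theta> n)))" by (rule nonstandard_mono[OF \<Phi>D(2)])
  then have "\<Theta> \<in> far_elems" using \<Theta>(1) by (simp add: far_elems_def)
  moreover have "block_less \<Phi> \<Theta>" "block_less \<Theta> \<Psi>" "\<forall>\<^sub>F n in germ C. color (nfst (\<Theta> n)) = c"
    unfolding block_less_def using \<Theta>(2) by (auto elim: eventually_mono)
  ultimately show ?thesis by auto
qed

text \<open>A member of \<open>X\<close> is realized through one of its witnesses. For \<alpha> a
  color of length 0 serves: since \<open>0 \<notin> X\<close>, its guess is always refuted.\<close>

lemma ex_color_of_type:
  assumes "S \<in> finite_types_and_alpha X"
  shows "\<exists>c. \<forall>\<Theta>. (\<forall>\<^sub>F n in germ C. color (nfst (\<Theta> n)) = c) \<longrightarrow> block_type \<Theta> = S"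
proof -
  consider (fin) x where "x \<in> X" "S = copy Inl (finite_type x)" | (alpha) "S = copy Inr alpha"
    using assms by (auto simp: finite_types_and_alpha_def)
  then show ?thesis
  proof cases
    case fin
    then obtain u where u: "\<And>v. prod_encode (x, prod_encode (u, v)) \<in> R" by (auto simp: X_def)
    have "block_type \<Theta> = S" if "\<forall>\<^sub>F n in germ C. color (nfst (\<Theta> n)) = prod_encode (x, u)" for \<Theta>
    proof -
      have "solid \<Theta> x"
        unfolding solid_def using that
        by eventually_elim (simp add: bad_def fails_def len_def u)
      then show ?thesis using fin block_type_solid by simp
    qed
    then show ?thesis by blast
  next
    case alpha
    have "block_type \<Theta> = S" if col: "\<forall>\<^sub>F n in germ C. color (nfst (\<Theta> n)) = prod_encode (0, 0)" for \<Theta>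
    proof -
      have "\<not> solid \<Theta> x" for x
      proof
        assume "solid \<Theta> x"
        then have "\<forall>\<^sub>F n in germ C. x = 0"
          unfolding solid_def using col by eventually_elim (simp add: len_def)
        then show False
          using solid_in_X[OF \<open>solid \<Theta> x\<close>] zero_notin_X by (simp add: eventually_const_iff)
      qed
      then show ?thesis using alpha block_type_not_solid by simp
    qed
    then show ?thesis by blast
  qed
qed

lemma far_elems_weak_dense:
  "weak_dense_colored far_elems block_less block_type (finite_types_and_alpha X)"
proof
  have el: "\<Phi> \<in> elems" if "\<Phi> \<in> far_elems" for \<Phi> using that by (simp add: far_elems_def)
  have lev: "computable (\<lambda>n. level (nfst (\<Phi> n)))" "nonstandard (\<lambda>n. level (nfst (\<Phi> n)))"
    if "\<Phi> \<in> far_elems" for \<Phi>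
    using that computable_cells(1)[OF computable_nfst_elems] by (auto simp: far_elems_def)
  show "far_elems \<noteq> {}" using far_elems_level[OF computable_id nonstandard_id] by auto
  show "countable far_elems"
    by (rule countable_subset[OF _ countable_computable]) (auto simp: far_elems_def elems_def)
  show "\<not> block_less \<Phi> \<Phi>" for \<Phi> by (rule block_less_irrefl)
  show "block_less \<Phi> \<Theta>" if "block_less \<Phi> \<Psi>" "block_less \<Psi> \<Theta>" for \<Phi> \<Psi> \<Theta>
    using that by (rule block_less_trans)
  show "block_less \<Phi> \<Psi> \<or> block_less \<Psi> \<Theta>"
    if far: "\<Phi> \<in> far_elems" "\<Psi> \<in> far_elems" "\<Theta> \<in> far_elems" and less: "block_less \<Phi> \<Theta>" for \<Phi> \<Psi> \<Theta>
  proof (rule disjCI)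
    assume "\<not> block_less \<Psi> \<Theta>"
    then have "\<forall>\<^sub>F n in germ C. \<not> cell_less (nfst (\<Psi> n)) (nfst (\<Theta> n))"
      using decidable_dichotomy[OF decidable_cell_less[OF computable_nfst_elems[OF el[OF far(2)]]
            computable_nfst_elems[OF el[OF far(3)]]]] by (simp add: block_less_def)
    then show "block_less \<Phi> \<Psi>"
      using less unfolding block_less_def by eventually_elim (simp add: cell_less_val)
  qed
  show "\<exists>\<Psi>\<in>far_elems. block_less \<Psi> \<Phi>" if \<Phi>: "\<Phi> \<in> far_elems" for \<Phi>
  proof -
    \<comment> \<open>Half of a nonstandard level is still nonstandard, and strictly
      smaller.\<close>
    have "computable (\<lambda>n. level (nfst (\<Phi> n)) div 2)" by (intro computable_intros lev(1) \<Phi>)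
    from far_elems_level[OF this nonstandard_div2[OF lev(2)[OF \<Phi>]]]
    obtain \<Theta> where \<Theta>: "\<Theta> \<in> far_elems" "\<forall>\<^sub>F n in germ C. level (nfst (\<Theta> n)) = level (nfst (\<Phi> n)) div 2"
      by auto
    have "block_less \<Theta> \<Phi>"
      unfolding block_less_def using \<Theta>(2) nonstandardD[OF lev(2)[OF \<Phi>], of 0]
      by eventually_elim (rule level_less_imp_cell_less, linarith)
    with \<Theta>(1) show ?thesis by auto
  qed
  show "\<exists>\<Psi>\<in>far_elems. block_less \<Phi> \<Psi>" if \<Phi>: "\<Phi> \<in> far_elems" for \<Phi>
  proof -
    have c: "computable (\<lambda>n. Suc (level (nfst (\<Phi> n))))" by (intro computable_intros lev(1) \<Phi>)
    have "nonstandard (\<lambda>n. Suc (level (nfst (\<Phi> n))))"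
      by (rule nonstandard_mono[OF lev(2)[OF \<Phi>]]) simp
    from far_elems_level[OF c this]
    obtain \<Theta> where \<Theta>: "\<Theta> \<in> far_elems" "\<forall>\<^sub>F n in germ C. level (nfst (\<Theta> n)) = Suc (level (nfst (\<Phi> n)))"
      by auto
    have "block_less \<Phi> \<Theta>"
      unfolding block_less_def using \<Theta>(2) by eventually_elim (simp add: level_less_imp_cell_less)
    with \<Theta>(1) show ?thesis by auto
  qed
  show "block_type \<Phi> \<in> finite_types_and_alpha X" for \<Phi> by (rule block_type_in)
  show "block_type \<Phi> = block_type \<Psi>"
    if "\<Phi> \<in> far_elems" "\<Psi> \<in> far_elems" "\<not> block_less \<Phi> \<Psi>" "\<not> block_less \<Psi> \<Phi>" for \<Phi> \<Psi>
    by (rule block_type_cong[OF block_less_total[OF el[OF that(1)] el[OF that(2)] that(3,4)]])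
  show "\<exists>\<Theta>\<in>far_elems. block_less \<Phi> \<Theta> \<and> block_less \<Theta> \<Psi> \<and> block_type \<Theta> = S"
    if far: "\<Phi> \<in> far_elems" "\<Psi> \<in> far_elems" "block_less \<Phi> \<Psi>" and S: "S \<in> finite_types_and_alpha X"
    for \<Phi> \<Psi> S
  proof -
    obtain c where c: "\<And>\<Theta>. \<forall>\<^sub>F n in germ C. color (nfst (\<Theta> n)) = c \<Longrightarrow> block_type \<Theta> = S"
      using ex_color_of_type[OF S] by auto
    obtain \<Theta> where \<Theta>: "\<Theta> \<in> far_elems" "block_less \<Phi> \<Theta>" "block_less \<Theta> \<Psi>"
      "\<forall>\<^sub>F n in germ C. color (nfst (\<Theta> n)) = c"
      using far_elems_dense[OF far] by auto
    show ?thesis using \<Theta>(1-3) c[OF \<Theta>(4)] by auto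
  qed
qed

text \<open>Totality of the shuffle is part of the conclusion because it, too, rests on the chosen
  coloring being genuine.\<close>

lemma presents_far_elems:
  "\<exists>F. presents far_elems germ_elem_less (shuffle (finite_types_and_alpha X)) F \<and>
    strict_total (shuffle (finite_types_and_alpha X))"
proof -
  interpret weak_dense_colored far_elems block_less block_type "finite_types_and_alpha X"
    by (rule far_elems_weak_dense)
  \<comment> \<open>The coloring chosen in \<open>shuffle\<close>. The blocks themselves witness
    that one exists, and they are then matched with the rationals colored by
    \<open>d\<close>.\<close>
  define d where "d = (SOME d. dense_coloring (finite_types_and_alpha X) d)"
  have d: "dense_coloring (finite_types_and_alpha X) d"
    using dense_colored_imp_dense_coloring[OF dense_colored_reps] unfolding d_def by (rule someI_ex)
  have st: "strict_total (d r)" for r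
    by (rule strict_total_finite_types_and_alpha) (use d in \<open>auto simp: dense_coloring_def\<close>)
  obtain q :: "(nat \<Rightarrow> nat) \<Rightarrow> rat" where q: "q ` far_elems = UNIV"
      "\<And>\<Phi> \<Psi>. \<Phi> \<in> far_elems \<Longrightarrow> \<Psi> \<in> far_elems \<Longrightarrow> block_less \<Phi> \<Psi> \<longleftrightarrow> q \<Phi> < q \<Psi>"
      "\<And>\<Phi>. \<Phi> \<in> far_elems \<Longrightarrow> d (q \<Phi>) = block_type \<Phi>"
    using map_to_rat[OF dense_colored_rat[OF d]] by auto
  have el: "\<Phi> \<in> elems" if "\<Phi> \<in> far_elems" for \<Phi> using that by (simp add: far_elems_def)
  have "\<exists>G. presents {\<Psi>\<in>far_elems. q \<Psi> = r} germ_elem_less (d r) G" for r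
  proof -
    have "r \<in> q ` far_elems" using q(1) by simp
    then obtain \<Phi> where \<Phi>: "\<Phi> \<in> far_elems" "q \<Phi> = r" by auto
    \<comment> \<open>Equal rationals mean the same block almost everywhere; conversely, an element
      of a far block is itself far.\<close>
    have "{\<Psi>\<in>far_elems. q \<Psi> = r} = {\<Psi>\<in>elems. \<forall>\<^sub>F n in germ C. nfst (\<Psi> n) = nfst (\<Phi> n)}"
    proof (intro set_eqI iffI)
      fix \<Psi> assume "\<Psi> \<in> {\<Psi>\<in>far_elems. q \<Psi> = r}"
      then have \<Psi>: "\<Psi> \<in> far_elems" "q \<Psi> = q \<Phi>" using \<Phi>(2) by auto
      then have "\<not> block_less \<Psi> \<Phi>" "\<not> block_less \<Phi> \<Psi>" using q(2) \<Phi>(1) by auto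
      then show "\<Psi> \<in> {\<Psi>\<in>elems. \<forall>\<^sub>F n in germ C. nfst (\<Psi> n) = nfst (\<Phi> n)}"
        using block_less_total[OF el[OF \<Psi>(1)] el[OF \<Phi>(1)]] el[OF \<Psi>(1)] by simp
    next
      fix \<Psi> assume "\<Psi> \<in> {\<Psi>\<in>elems. \<forall>\<^sub>F n in germ C. nfst (\<Psi> n) = nfst (\<Phi> n)}"
      then have \<Psi>: "\<Psi> \<in> elems" and ev: "\<forall>\<^sub>F n in germ C. nfst (\<Psi> n) = nfst (\<Phi> n)" by auto
      have "nonstandard (\<lambda>n. level (nfst (\<Psi> n)))"
      proof (rule nonstandard_mono)
        show "nonstandard (\<lambda>n. level (nfst (\<Phi> n)))" using \<Phi>(1) by (simp add: far_elems_def)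
        show "\<forall>\<^sub>F n in germ C. level (nfst (\<Phi> n)) \<le> level (nfst (\<Psi> n))"
          using ev by eventually_elim simp
      qed
      then have far: "\<Psi> \<in> far_elems" using \<Psi> by (simp add: far_elems_def)
      have "\<not> block_less \<Psi> \<Phi>" "\<not> block_less \<Phi> \<Psi>"
      proof -
        have "(\<forall>\<^sub>F n in germ C. cell_less (nfst (\<Psi> n)) (nfst (\<Phi> n))) \<longleftrightarrow> (\<forall>\<^sub>F n in germ C. False)"
          "(\<forall>\<^sub>F n in germ C. cell_less (nfst (\<Phi> n)) (nfst (\<Psi> n))) \<longleftrightarrow> (\<forall>\<^sub>F n in germ C. False)"
          by (rule eventually_cong[OF ev], simp add: cell_less_val)+
        then show "\<not> block_less \<Psi> \<Phi>" "\<not> block_less \<Phi> \<Psi>"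
          unfolding block_less_def using not_eventually_False by simp_all
      qed
      then have "q \<Psi> = r" using q(2)[OF far \<Phi>(1)] q(2)[OF \<Phi>(1) far] \<Phi>(2) by auto
      then show "\<Psi> \<in> {\<Psi>\<in>far_elems. q \<Psi> = r}" using far by simp
    qed
    then show ?thesis using presents_block[OF \<Phi>(1)] q(3)[OF \<Phi>(1)] \<Phi>(2) by simp
  qed
  then have "\<forall>r. \<exists>G. presents {\<Psi>\<in>far_elems. q \<Psi> = r} germ_elem_less (d r) G" by simp
  from choice[OF this] obtain G where
    G: "\<And>r. presents {\<Psi>\<in>far_elems. q \<Psi> = r} germ_elem_less (d r) (G r)" by auto
  have "presents far_elems germ_elem_less (lex_sum eta d) (\<lambda>\<Psi>. (q \<Psi>, G (q \<Psi>) \<Psi>))"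
  proof (rule presents_lex_sum_eta[OF q(1) _ G])
    fix \<Phi> \<Psi> assume *: "\<Phi> \<in> far_elems" "\<Psi> \<in> far_elems" "q \<Phi> < q \<Psi>"
    then have "block_less \<Phi> \<Psi>" using q(2) by simp
    then have "germ_elem_less \<Phi> \<Psi>" using block_less_imp_germ_elem_less el * by simp
    then show "germ_elem_less \<Phi> \<Psi> \<and> \<not> germ_elem_less \<Psi> \<Phi>" using germ_elem_less_asym by simp
  qed
  moreover have "shuffle (finite_types_and_alpha X) = lex_sum eta d" by (simp add: shuffle_def d_def)
  ultimately show ?thesis using strict_total_lex_sum_eta[of d, OF st] by auto
qed

lemma cohesive_power_M:
  "cohesive_power C M \<cong> omega \<oplus> shuffle (finite_types_and_alpha X)"
proof -
  obtain F where F: "presents (elems - far_elems) germ_elem_less omega F"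
    using presents_standard_elems by auto
  obtain F' where F': "presents far_elems germ_elem_less (shuffle (finite_types_and_alpha X)) F'"
    and st: "strict_total (shuffle (finite_types_and_alpha X))"
    using presents_far_elems by auto
  have "germ_elem_less x y \<and> \<not> germ_elem_less y x" if "x \<in> elems - far_elems" "y \<in> far_elems" for x y
    using standard_less_far[OF that] germ_elem_less_asym by simp
  from presents_sum[OF F F' _ this]
  obtain H where H: "presents (elems - far_elems \<union> far_elems) germ_elem_less
      (omega \<oplus> shuffle (finite_types_and_alpha X)) H" by auto
  have "elems - far_elems \<union> far_elems = {f. computable f \<and> range f \<subseteq> fst M}"
    by (auto simp: far_elems_def elems_def)
  moreover have "germ_elem_less = (\<lambda>f g. \<forall>\<^sub>F n in germ C. (f n, g n) \<in> snd M)"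
    by (intro ext) (simp add: germ_elem_less_def)
  ultimately have H': "presents {f. computable f \<and> range f \<subseteq> fst M}
      (\<lambda>f g. \<forall>\<^sub>F n in germ C. (f n, g n) \<in> snd M) (omega \<oplus> shuffle (finite_types_and_alpha X)) H"
    using H by simp
  obtain a where a: "a \<in> fst M" using infinite_M by fastforce
  have "computable_set (prod_encode ` snd M)" using computable_M by (simp add: computable_lin_order_def)
  from cohesive_power_iso[OF lin_order_M this a strict_total_sum[OF strict_total_basic(1) st] H']
  show ?thesis .
qed

end

theorem theorem6p5:
  fixes X C :: "nat set"
  assumes "X \<subseteq> UNIV - {0}"
    and "sigma2 X"
    and "cohesive C"
    and "ce (- C)"
  shows "\<exists>M :: nat lorder. computable_lin_order M \<and> M \<cong> omega \<and>
    cohesive_power C M \<cong> omega \<oplus> shuffle (finite_types_and_alpha X)"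
proof -
  obtain St where St: "decidable (\<lambda>t. t \<in> St)" "inj_on nfst St" "nfst ` St = - C"
    using ce_stages[OF assms(4)] by auto
  obtain R where R: "computable_set R" "X = {x. \<exists>u. \<forall>v. prod_encode (x, prod_encode (u, v)) \<in> R}"
    using assms(2) unfolding sigma2_def by auto
  interpret construction C St R X
  proof
    show "decidable (\<lambda>n. n \<in> R)"
      using R(1) by (simp add: computable_set_def decidable_def computable_def)
    show "0 \<notin> X" using assms(1) by auto
  qed (use assms(3) St R(2) in simp_all)
  show ?thesis using computable_M M_omega cohesive_power_M by blast
qed

end
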